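(* The group $T\mathcal{A}$ contains $\bigoplus_\omega\mathbb{Q}$, and the group $V\!\mathcal{A}$ contains $\bigoplus_\omega(\mathbb{Q}\oplus\mathbb{Q}/\mathbb{Z})$. Hence $T\mathcal{A}$ contains every countable, torsion-free abelian group, and $V\!\mathcal{A}$ contains every countable abelian group.
   Context: "Contains" means: has a subgroup isomorphic to. $\bigoplus_\omega$ denotes a direct sum of countably infinitely many copies. Thompson's group $T$ is the group of all piecewise-linear homeomorphisms of $S^1=\mathbb{R}/\mathbb{Z}$ whose breakpoints are dyadic and whose linear segments all have the form $t\mapsto 2^nt+b$ with $n\in\mathbb{Z}$, $b\in\mathbb{Z}[\tfrac12]$. For $f\in\mathrm{Homeo}(S^1)$, let $\mathrm{sing}(f)$ be the set of points $p\in S^1$ such that $f$ does not agree with any element of $T$ on any neighborhood of $p$. $T\mathcal{A}$ is the group of all $f\in\mathrm{Homeo}(S^1)$ such that: (1) $\mathrm{sing}(f)$ is a finite set of dyadic points; (2) if $p\in\mathrm{sing}(f)$, then $L_{f(p)}\circ f$ agrees with $f\circ L_p$ in some neighborhood of $p$, where $L_p$ denotes the linear map in a neighborhood of $p$ that fixes $p$ and has slope $2$. Let $\mathfrak{C}_2=\{0,1\}^\omega$ be the Cantor set, ordered lexicographically. Thompson's group $V$ is the group of homeomorphisms $f$ of $\mathfrak{C}_2$ such that for every $p\in\mathfrak{C}_2$ there are finite prefixes $\alpha,\beta$ of $p$ and $f(p)$, respectively, so that $f$ agrees with the prefix replacement $\alpha\psi\mapsto\beta\psi$ in a neighborhood of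 $p$. For $f\in\mathrm{Homeo}(\mathfrak{C}_2)$, let $\mathrm{sing}(f)$ be the set of points $p$ such that $f$ does not agree with any element of $V$ on any neighborhood of $p$. Write $\overline{0}=000\cdots$ and $\overline{1}=111\cdots$. $V\!\mathcal{A}$ is the group of all $f\in\mathrm{Homeo}(\mathfrak{C}_2)$ such that: (1) $\mathrm{sing}(f)$ is finite, and each point of $\mathrm{sing}(f)$ ends in either $\overline{0}$ or $\overline{1}$; (2) if $p\in\mathrm{sing}(f)$, there is a neighborhood of $p$ on which $f$ is order-preserving and $L_{f(p)}\circ f$ agrees with $f\circ L_p$, where $L_p$ denotes the prefix replacement $\alpha0\psi\mapsto\alpha\psi$ if $p=\alpha\overline{0}$, or $\alpha1\psi\mapsto\alpha\psi$ if $p=\alpha\overline{1}$. *)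

theory Defs
  imports
    "HOL-Analysis.Analysis"
    "HOL-Algebra.Algebra"
    "HOL-Library.Omega_Words_Fun"
    "HOL-Library.Fun_Lexorder"
begin

section \<open>Groups of homeomorphisms and containment\<close>

definition homeo_group :: "('a::topological_space \<Rightarrow> 'a) monoid" where
  "homeo_group = \<lparr>carrier = {f. homeomorphic_map euclidean euclidean f}, mult = (\<circ>), one = id\<rparr>"

lemma group_homeo_group: "group (homeo_group :: ('a::topological_space \<Rightarrow> 'a) monoid)"
proof (rule groupI)
  fix f :: "'a \<Rightarrow> 'a"
  assume "f \<in> carrier homeo_group"
  then obtain g where g: "homeomorphic_maps euclidean euclidean f g"
    by (auto simp: homeo_group_def homeomorphic_map_maps)
  then have "homeomorphic_map euclidean euclidean g" and "g \<circ> f = id"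
    using homeomorphic_maps_map[of euclidean euclidean f g] by auto
  then show "\<exists>g\<in>carrier homeo_group. g \<otimes>\<^bsub>homeo_group\<^esub> f = \<one>\<^bsub>homeo_group\<^esub>"
    by (auto simp: homeo_group_def)
qed (auto simp: homeo_group_def o_assoc intro: homeomorphic_map_compose)

text \<open>The singular set of \<open>f\<close> relative to a set \<open>F\<close> of model homeomorphisms.\<close>

definition sing :: "('a::topological_space \<Rightarrow> 'a) set \<Rightarrow> ('a \<Rightarrow> 'a) \<Rightarrow> 'a set" where
  "sing F f = {p. \<not> (\<exists>g\<in>F. \<forall>\<^sub>F x in nhds p. f x = g x)}"

definition contains_group :: "('a, 'm) monoid_scheme \<Rightarrow> ('b, 'n) monoid_scheme \<Rightarrow> bool" where
  "contains_group G H \<longleftrightarrow> (\<exists>K. subgroup K G \<and> G\<lparr>carrier := K\<rparr> \<cong> H)"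

definition torsion_free :: "('a, 'm) monoid_scheme \<Rightarrow> bool" where
  "torsion_free A \<longleftrightarrow>
     (\<forall>x\<in>carrier A. \<forall>n::nat. 0 < n \<longrightarrow> x [^]\<^bsub>A\<^esub> n = \<one>\<^bsub>A\<^esub> \<longrightarrow> x = \<one>\<^bsub>A\<^esub>)"

definition rat_group :: "rat monoid" where
  "rat_group = \<lparr>carrier = UNIV, mult = (+), one = 0\<rparr>"

abbreviation rat_mod_int_group :: "rat set monoid" where
  "rat_mod_int_group \<equiv> rat_group Mod \<int>"


section \<open>The circle and the group \<open>TA\<close>\<close>

quotient_type circle = real / "\<lambda>x y. x - y \<in> (\<int> :: real set)"
proof (rule equivpI)
  show "reflp (\<lambda>x y. x - y \<in> (\<int> :: real set))"
    by (simp add: reflp_def)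
  have "y - x \<in> \<int>" if "x - y \<in> \<int>" for x y :: real
    using Ints_minus[OF that] by simp
  then show "symp (\<lambda>x y. x - y \<in> (\<int> :: real set))"
    by (auto intro: sympI)
  have "x - z \<in> \<int>" if "x - y \<in> \<int>" "y - z \<in> \<int>" for x y z :: real
    using Ints_add[OF that] by simp
  then show "transp (\<lambda>x y. x - y \<in> (\<int> :: real set))"
    by (blast intro: transpI)
qed

text \<open>The quotient topology; \<open>abs_circle\<close> is the projection from the reals.\<close>

instantiation circle :: topological_space
begin

definition open_circle :: "circle set \<Rightarrow> bool" where
  "open_circle U \<longleftrightarrow> open (abs_circle -` U)"

instance
  by standard (auto simp: open_circle_def vimage_Union)

end

definition dyadics :: "real set" where
  "dyadics = {of_int m / 2 ^ k | m k. True}"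

text \<open>
  The list \<open>xs\<close> subdivides \<open>[0, 1]\<close> at dyadic points. Since \<open>0\<close> is dyadic, no generality is
  lost in subdividing the circle there, whether or not it is a breakpoint.
\<close>

definition thompson_T :: "(circle \<Rightarrow> circle) set" where
  "thompson_T = {f. f \<in> carrier homeo_group \<and>
     (\<exists>xs. sorted_wrt (<) xs \<and> xs \<noteq> [] \<and> hd xs = 0 \<and> last xs = 1 \<and> set xs \<subseteq> dyadics \<and>
       (\<forall>i. Suc i < length xs \<longrightarrow>
         (\<exists>n::int. \<exists>b\<in>dyadics. \<forall>t\<in>{xs ! i..xs ! Suc i}.
            f (abs_circle t) = abs_circle (2 powi n * t + b))))}"

text \<open>
  The map \<open>L\<^sub>p\<close> fixing \<open>p\<close> with slope \<open>2\<close>. The formula is well defined on the whole circle,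
  being \<open>x \<mapsto> 2x - p\<close> modulo the integers; only its germ at \<open>p\<close> is used.
\<close>

lift_definition circle_L :: "circle \<Rightarrow> circle \<Rightarrow> circle" is
  "\<lambda>p x. p + 2 * (x - p) :: real"
proof -
  fix p p' x x' :: real
  assume p: "p - p' \<in> \<int>" and x: "x - x' \<in> \<int>"
  have "2 * (x - x') - (p - p') \<in> \<int>"
    by (rule Ints_diff[OF Ints_mult[OF Ints_numeral x] p])
  then show "p + 2 * (x - p) - (p' + 2 * (x' - p')) \<in> \<int>"
    by (simp add: algebra_simps)
qed

definition TA :: "(circle \<Rightarrow> circle) monoid" where
  "TA = homeo_group\<lparr>carrier := {f \<in> carrier homeo_group.
     finite (sing thompson_T f) \<and>
     sing thompson_T f \<subseteq> abs_circle ` dyadics \<and>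
     (\<forall>p\<in>sing thompson_T f. \<forall>\<^sub>F x in nhds p. circle_L (f p) (f x) = f (circle_L p x))}\<rparr>"


section \<open>The Cantor set and the group \<open>VA\<close>\<close>

text \<open>
  Infinite binary words with the product topology; \<open>False\<close> and \<open>True\<close> stand for the
  letters \<open>0\<close> and \<open>1\<close>. The lexicographic order is \<^const>\<open>less_fun\<close>.
\<close>

type_synonym cantor = "nat \<Rightarrow> bool"

text \<open>The map \<open>\<alpha>\<psi> \<mapsto> \<beta>\<psi>\<close>; only its values on words with prefix \<open>\<alpha>\<close> are meaningful.\<close>

definition prefix_replacement :: "bool list \<Rightarrow> bool list \<Rightarrow> cantor \<Rightarrow> cantor" where
  "prefix_replacement \<alpha> \<beta> x = \<beta> \<frown> Omega_Words_Fun.suffix (length \<alpha>) x"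

definition thompson_V :: "(cantor \<Rightarrow> cantor) set" where
  "thompson_V = {f. f \<in> carrier homeo_group \<and>
     (\<forall>p. \<exists>\<alpha> \<beta>. p \<in> range (conc \<alpha>) \<and> f p \<in> range (conc \<beta>) \<and>
        (\<forall>\<^sub>F x in nhds p. f x = prefix_replacement \<alpha> \<beta> x))}"

text \<open>
  \<open>cantor_L p g\<close> says that \<open>g\<close> is \<open>L\<^sub>p\<close> for some way of writing \<open>p\<close> as \<open>\<alpha>ccc\<dots>\<close>. The
  word \<open>\<alpha>\<close> is not unique, but all choices give the same germ at \<open>p\<close>, and only that germ is used.
\<close>

definition cantor_L :: "cantor \<Rightarrow> (cantor \<Rightarrow> cantor) \<Rightarrow> bool" where
  "cantor_L p g \<longleftrightarrow>
     (\<exists>\<alpha> c. p = \<alpha> \<frown> (\<lambda>_. c) \<and> g = prefix_replacement (\<alpha> @ [c]) \<alpha>)"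

text \<open>
  Existence of \<open>h\<close> below includes that \<open>L\<close> at \<open>f p\<close> is defined, that is, that \<open>f p\<close> is
  eventually constant.
\<close>

definition VA :: "(cantor \<Rightarrow> cantor) monoid" where
  "VA = homeo_group\<lparr>carrier := {f \<in> carrier homeo_group.
     finite (sing thompson_V f) \<and>
     (\<forall>p\<in>sing thompson_V f. \<exists>\<alpha> c. p = \<alpha> \<frown> (\<lambda>_. c)) \<and>
     (\<forall>p\<in>sing thompson_V f. \<exists>U g h. open U \<and> p \<in> U \<and>
        monotone_on U less_fun less_fun f \<and>
        cantor_L p g \<and> cantor_L (f p) h \<and> (\<forall>x\<in>U. h (f x) = f (g x)))}\<rparr>"

end

theory Submission
  imports Defs
begin

text \<open>
  Every countable abelian group embeds in a direct sum of copies of \<open>\<rat> \<oplus> \<rat>/\<int>\<close>, and already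
  in a direct sum of copies of \<open>\<rat>\<close> if it is torsion-free: adjoin the elements of the group one
  at a time, and let every step contribute one coordinate, a homomorphism that vanishes on what
  was there before and is faithful on what is new. Such homomorphisms exist because divisible
  groups are injective (\<open>hom_to_divisible\<close>), and the sum stays direct because an element is killed
  by all coordinates that come after it (\<open>embeds_in_sum_group\<close>). It remains to make the two
  direct sums act.

  Both actions come from one idea. Write a digit of base \<open>b\<close> in unary, as one of the words
  \<open>0, 10, 110, \<dots>, 1\<dots>10, 1\<dots>11\<close>. These are a complete prefix code, so digits of the bases
  \<open>1, 2, \<dots>, n\<close> cut the Cantor set into \<open>n!\<close> cylinders, in increasing order. Shifting the index of
  the cylinder by \<open>a\<close> modulo \<open>n!\<close> and keeping the rest of the word is a rotation by \<open>a/n!\<close>.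
  Refining the cylinders from \<open>n\<close> to \<open>n + 1\<close> multiplies indices by \<open>n + 1\<close>, so the rotation
  depends only on the number \<open>a/n!\<close> modulo \<open>\<int>\<close>, and \<open>\<rat>/\<int>\<close> acts by elements of \<open>V\<close>. Put an
  integer in front of the digits, coded by \<open>\<dots>, 001, 01, 10, 110, \<dots>\<close>. Then the indices are no
  longer cyclic, and \<open>\<rat>\<close> acts by increasing maps on the words other than \<open>000\<dots>\<close> and \<open>111\<dots>\<close>,
  as it acts on the real line by translations. Deleting the first letter of a word close to \<open>000\<dots>\<close>
  or \<open>111\<dots>\<close> is the translation by \<open>1\<close> or \<open>-1\<close>. It commutes with all other translations because
  \<open>\<rat>\<close> is commutative, and this is exactly what the definition of \<open>VA\<close> demands at the two singular
  points (\<open>self_similar_line\<close>). Infinitely many rotations and lines, on the disjoint cylinders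
  \<open>0\<dots>01\<close>, give the action of the direct sum (\<open>act_in_VA\<close>).

  For the circle, keep only the lines. The resulting maps of the Cantor set are increasing
  bijections, so they preserve the pairs of words with no word in between, and these are the pairs
  of binary expansions of one number. Hence the maps descend to the unit interval and to the circle
  (\<open>descend_in_TA\<close>). A prefix replacement becomes affine with dyadic coefficients; it extends to an
  element of \<open>T\<close> because any two intervals with dyadic ends are related by a dyadic piecewise
  linear map (\<open>dyadic_pl_exists\<close>).
\<close>

section \<open>Containment from faithful representations\<close>

definition faithful_rep :: "('x \<Rightarrow> 'x, 'm) monoid_scheme \<Rightarrow> ('h, 'k) monoid_scheme \<Rightarrow> ('h \<Rightarrow> 'x \<Rightarrow> 'x) \<Rightarrow> bool" where
  "faithful_rep G H \<phi> \<longleftrightarrow> (\<forall>x\<in>carrier H. \<phi> x \<in> carrier G) \<and>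
     (\<forall>x\<in>carrier H. \<forall>y\<in>carrier H. \<phi> (x \<otimes>\<^bsub>H\<^esub> y) = \<phi> x \<circ> \<phi> y) \<and>
     \<phi> \<one>\<^bsub>H\<^esub> = id \<and> inj_on \<phi> (carrier H)"

text \<open>
  Inverses for composition are unique, so the inverse of \<open>\<phi> x\<close> is the image of the inverse
  of \<open>x\<close>. This is what makes the image of \<open>H\<close> a subgroup of \<open>G\<close>.
\<close>
lemma contains_group_if_faithful_rep:
  assumes H: "group H"
    and mult: "mult G = (\<circ>)" and one: "one G = id"
    and rep: "faithful_rep G H \<phi>"
  shows "contains_group G H"
proof -
  have closed: "\<And>x. x \<in> carrier H \<Longrightarrow> \<phi> x \<in> carrier G"
    and hom: "\<And>x y. x \<in> carrier H \<Longrightarrow> y \<in> carrier H \<Longrightarrow> \<phi> (x \<otimes>\<^bsub>H\<^esub> y) = \<phi> x \<circ> \<phi> y"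
    and id: "\<phi> \<one>\<^bsub>H\<^esub> = id" and inj: "inj_on \<phi> (carrier H)"
    using rep unfolding faithful_rep_def by blast+
  interpret H: group H by (rule H)
  let ?K = "\<phi> ` carrier H"
  have inv: "inv\<^bsub>G\<^esub> (\<phi> x) = \<phi> (inv\<^bsub>H\<^esub> x)" if x: "x \<in> carrier H" for x
  proof -
    have l: "\<phi> (inv\<^bsub>H\<^esub> x) \<circ> \<phi> x = id" and r: "\<phi> x \<circ> \<phi> (inv\<^bsub>H\<^esub> x) = id"
      using x id by (simp_all flip: hom)
    show ?thesis unfolding m_inv_def[of G]
    proof (rule the_equality)
      show "\<phi> (inv\<^bsub>H\<^esub> x) \<in> carrier G \<and> \<phi> x \<otimes>\<^bsub>G\<^esub> \<phi> (inv\<^bsub>H\<^esub> x) = \<one>\<^bsub>G\<^esub> \<and>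
          \<phi> (inv\<^bsub>H\<^esub> x) \<otimes>\<^bsub>G\<^esub> \<phi> x = \<one>\<^bsub>G\<^esub>"
        using x closed l r by (simp add: mult one)
      fix y assume "y \<in> carrier G \<and> \<phi> x \<otimes>\<^bsub>G\<^esub> y = \<one>\<^bsub>G\<^esub> \<and> y \<otimes>\<^bsub>G\<^esub> \<phi> x = \<one>\<^bsub>G\<^esub>"
      then have "\<phi> (inv\<^bsub>H\<^esub> x) \<circ> (\<phi> x \<circ> y) = \<phi> (inv\<^bsub>H\<^esub> x)" by (simp add: mult one)
      then show "y = \<phi> (inv\<^bsub>H\<^esub> x)" by (simp add: o_assoc l)
    qed
  qed
  have sub: "subgroup ?K G"
  proof (rule subgroup.intro)
    show "?K \<subseteq> carrier G" using closed by blast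
    show "x \<otimes>\<^bsub>G\<^esub> y \<in> ?K" if "x \<in> ?K" "y \<in> ?K" for x y
      using that by (auto simp: mult simp flip: hom)
    show "\<one>\<^bsub>G\<^esub> \<in> ?K" using id by (metis H.one_closed imageI one)
    show "inv\<^bsub>G\<^esub> x \<in> ?K" if "x \<in> ?K" for x
      using that by (auto simp: inv)
  qed
  have "inv_into (carrier H) \<phi> \<in> iso (G\<lparr>carrier := ?K\<rparr>) H"
  proof (rule isoI)
    show "inv_into (carrier H) \<phi> \<in> hom (G\<lparr>carrier := ?K\<rparr>) H"
      by (rule homI) (auto simp: mult inv_into_f_f[OF inj] simp flip: hom)
    show "bij_betw (inv_into (carrier H) \<phi>) (carrier (G\<lparr>carrier := ?K\<rparr>)) (carrier H)"
      using inj by (simp add: bij_betw_inv_into inj_on_imp_bij_betw)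
  qed
  then show ?thesis
    unfolding contains_group_def using sub is_isoI by blast
qed

lemma faithful_rep_comp:
  assumes rep: "faithful_rep G H \<phi>" and f: "f \<in> hom A H" "inj_on f (carrier A)" and "group A" "group H"
  shows "faithful_rep G A (\<lambda>x. \<phi> (f x))"
proof -
  have c: "f x \<in> carrier H" if "x \<in> carrier A" for x using f(1) that by (auto simp: hom_def)
  have "inj_on (\<lambda>x. \<phi> (f x)) (carrier A)"
    using rep c f(2) unfolding faithful_rep_def inj_on_def by metis
  then show ?thesis
    using rep c hom_one[OF f(1) \<open>group A\<close> \<open>group H\<close>] hom_mult[OF f(1)]
    unfolding faithful_rep_def by simp
qed

section \<open>Homomorphisms into divisible groups\<close>

definition divisible :: "('a, 'm) monoid_scheme \<Rightarrow> bool" where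
  "divisible D \<longleftrightarrow> (\<forall>d\<in>carrier D. \<forall>m::nat. 0 < m \<longrightarrow> (\<exists>e\<in>carrier D. e [^]\<^bsub>D\<^esub> m = d))"

definition adjoin :: "('a, 'm) monoid_scheme \<Rightarrow> 'a set \<Rightarrow> 'a \<Rightarrow> 'a set" where
  "adjoin G H x = {h \<otimes>\<^bsub>G\<^esub> x [^]\<^bsub>G\<^esub> j | h (j::int). h \<in> H}"

lemma (in comm_group) subgroup_adjoin:
  assumes H: "subgroup H G" and x: "x \<in> carrier G"
  shows "subgroup (adjoin G H x) G"
proof (rule subgroupI)
  have HG: "h \<in> carrier G" if "h \<in> H" for h using H that by (simp add: subgroup.mem_carrier)
  show "adjoin G H x \<subseteq> carrier G" using x by (auto simp: adjoin_def HG)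
  show "adjoin G H x \<noteq> {}" using subgroup.one_closed[OF H] by (auto simp: adjoin_def)
  show "inv a \<in> adjoin G H x" if aH: "a \<in> adjoin G H x" for a
  proof -
    obtain h and j :: int where a: "a = h \<otimes> x [^] j" and h: "h \<in> H" using aH unfolding adjoin_def by blast
    have "inv a = inv h \<otimes> x [^] (- j)"
      using x HG[OF h] by (simp add: a inv_mult int_pow_neg)
    then show ?thesis using subgroup.m_inv_closed[OF H h] by (auto simp: adjoin_def)
  qed
  show "a \<otimes> b \<in> adjoin G H x" if ab: "a \<in> adjoin G H x" "b \<in> adjoin G H x" for a b
  proof -
    obtain h k and i j :: int where a: "a = h \<otimes> x [^] i" "h \<in> H" and b: "b = k \<otimes> x [^] j" "k \<in> H"
      using ab by (auto simp: adjoin_def)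
    have "a \<otimes> b = (h \<otimes> k) \<otimes> x [^] (i + j)"
      using x HG[OF a(2)] HG[OF b(2)] by (simp add: a b int_pow_mult m_ac)
    then show ?thesis using subgroup.m_closed[OF H a(2) b(2)] by (auto simp: adjoin_def)
  qed
qed

lemma (in group) adjoin_superset:
  assumes H: "subgroup H G" and x: "x \<in> carrier G"
  shows "H \<subseteq> adjoin G H x" and "x \<in> adjoin G H x"
proof
  fix h assume h: "h \<in> H"
  then have "h = h \<otimes> x [^] (0::int)" using subgroup.mem_carrier[OF H] by simp
  then show "h \<in> adjoin G H x" using h unfolding adjoin_def by blast
next
  have "x = \<one> \<otimes> x [^] (1::int)" using x by (simp add: int_pow_1)
  then show "x \<in> adjoin G H x" using subgroup.one_closed[OF H] unfolding adjoin_def by blast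
qed

lemma (in group) adjoinE:
  assumes "x \<in> adjoin G B a"
  obtains b and j :: int where "b \<in> B" "x = b \<otimes> a [^] j"
  using assms unfolding adjoin_def by blast

text \<open>
  These exponents form a subgroup of the integers; \<open>m\<close> is its least positive element, or
  \<open>0\<close> if there is none.
\<close>
lemma (in group) exponents_multiples:
  assumes B: "subgroup B G" and a: "a \<in> carrier G"
  shows "\<exists>m::nat. \<forall>j::int. a [^] j \<in> B \<longleftrightarrow> int m dvd j"
proof -
  have neg: "a [^] (- j) \<in> B" if "a [^] j \<in> B" for j :: int
    using subgroup.m_inv_closed[OF B that] a by (simp add: int_pow_neg)
  have mult: "a [^] (j * i) \<in> B" if "a [^] j \<in> B" for i j :: int
    using subgroup_int_pow_closed[OF B that, of i] a by (simp add: int_pow_pow)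
  have add: "a [^] (j + i) \<in> B" if "a [^] j \<in> B" "a [^] i \<in> B" for i j :: int
    using subgroup.m_closed[OF B that] a by (simp add: int_pow_mult)
  show ?thesis
  proof (cases "\<exists>m::nat. 0 < m \<and> a [^] int m \<in> B")
    case False
    have "j = 0" if j: "a [^] j \<in> B" for j :: int
    proof (rule ccontr)
      assume "j \<noteq> 0"
      moreover have "a [^] int (nat \<bar>j\<bar>) \<in> B" using j neg[OF j] by (cases "0 \<le> j") simp_all
      ultimately show False using False by (metis zero_less_abs_iff zero_less_nat_eq)
    qed
    moreover have "a [^] (0::int) \<in> B" using subgroup.one_closed[OF B] by simp
    ultimately have "a [^] j \<in> B \<longleftrightarrow> int 0 dvd j" for j :: int by auto
    then show ?thesis by blast
  next
    case True
    define m where "m = (LEAST m::nat. 0 < m \<and> a [^] int m \<in> B)"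
    have m: "0 < m" "a [^] int m \<in> B" using LeastI_ex[OF True] by (simp_all add: m_def)
    have least: "m \<le> k" if "0 < k" "a [^] int k \<in> B" for k
      using that by (auto simp: m_def intro: Least_le)
    have "int m dvd j" if j: "a [^] j \<in> B" for j :: int
    proof -
      have "a [^] (j + int m * (- (j div int m))) \<in> B" by (intro add mult m(2) j)
      moreover have "j + int m * (- (j div int m)) = int (nat (j mod int m))"
        using m(1) by (simp add: minus_mult_div_eq_mod)
      ultimately have "a [^] int (nat (j mod int m)) \<in> B" by simp
      moreover have "nat (j mod int m) < m" using m(1) by (simp add: nat_less_iff)
      ultimately have "nat (j mod int m) = 0" using least by (meson gr0I not_le)
      then have "j mod int m = 0" using m(1) pos_mod_sign[of "int m" j] by linarith
      then show ?thesis by (rule mod_0_imp_dvd)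
    qed
    moreover have "a [^] j \<in> B" if "int m dvd j" for j :: int
    proof -
      obtain i where "j = int m * i" using \<open>int m dvd j\<close> by (rule dvdE)
      then show ?thesis using mult[OF m(2)] by simp
    qed
    ultimately show ?thesis by blast
  qed
qed

lemma comm_group_DirProd:
  assumes "comm_group A" "comm_group D"
  shows "comm_group (A \<times>\<times> D)"
proof -
  interpret A: comm_group A by fact
  interpret D: comm_group D by fact
  show ?thesis
    by (rule group.group_comm_groupI[OF DirProd_group]) (auto simp: A.m_comm D.m_comm)
qed

lemma int_pow_DirProd:
  assumes "group A" "group D" "a \<in> carrier A" "d \<in> carrier D"
  shows "(a, d) [^]\<^bsub>A \<times>\<times> D\<^esub> (j::int) = (a [^]\<^bsub>A\<^esub> j, d [^]\<^bsub>D\<^esub> j)"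
proof -
  have "fst \<in> hom (A \<times>\<times> D) A" "snd \<in> hom (A \<times>\<times> D) D" by (auto simp: hom_def)
  note this[THEN hom_int_pow, of "(a, d)" j]
  then show ?thesis using assms by (simp add: DirProd_group prod_eq_iff)
qed

text \<open>
  The graph of a homomorphism from a subgroup of \<open>A\<close> to \<open>D\<close>. In this form a
  homomorphism is extended by a larger set, and a union of a chain of homomorphisms is the union of the sets.
\<close>
definition hom_graph :: "('a, 'm) monoid_scheme \<Rightarrow> ('d, 'k) monoid_scheme \<Rightarrow> ('a \<times> 'd) set \<Rightarrow> bool" where
  "hom_graph A D R \<longleftrightarrow> subgroup R (A \<times>\<times> D) \<and> (\<forall>d. (\<one>\<^bsub>A\<^esub>, d) \<in> R \<longrightarrow> d = \<one>\<^bsub>D\<^esub>)"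

context
  fixes A :: "('a, 'm) monoid_scheme" and D :: "('d, 'k) monoid_scheme"
  assumes A: "comm_group A" and D: "comm_group D"
begin

interpretation A: comm_group A by (rule A)
interpretation D: comm_group D by (rule D)
interpretation AD: comm_group "A \<times>\<times> D" by (rule comm_group_DirProd[OF A D])

lemma hom_graph_mem:
  assumes "hom_graph A D R" "(a, d) \<in> R"
  shows "a \<in> carrier A" "d \<in> carrier D"
  using assms subgroup.mem_carrier[of R "A \<times>\<times> D" "(a, d)"] by (auto simp: hom_graph_def)

lemma hom_graph_mult:
  assumes "hom_graph A D R" "(a, d) \<in> R" "(a', d') \<in> R"
  shows "(a \<otimes>\<^bsub>A\<^esub> a', d \<otimes>\<^bsub>D\<^esub> d') \<in> R"
  using assms subgroup.m_closed[of R "A \<times>\<times> D" "(a, d)" "(a', d')"] by (auto simp: hom_graph_def)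

lemma hom_graph_pow:
  assumes R: "hom_graph A D R" and ad: "(a, d) \<in> R"
  shows "(a [^]\<^bsub>A\<^esub> (j::int), d [^]\<^bsub>D\<^esub> j) \<in> R"
  using AD.int_pow_closed int_pow_DirProd[of A D a d j] hom_graph_mem[OF R ad] R ad
    AD.subgroup_int_pow_closed[of R "(a, d)" j]
  by (auto simp: hom_graph_def A.is_group D.is_group)

lemma hom_graph_functional:
  assumes R: "hom_graph A D R" and "(a, d) \<in> R" "(a, d') \<in> R"
  shows "d = d'"
proof -
  note c = hom_graph_mem[OF R assms(2)] hom_graph_mem[OF R assms(3)]
  have "(a \<otimes>\<^bsub>A\<^esub> a [^]\<^bsub>A\<^esub> (-1::int), d \<otimes>\<^bsub>D\<^esub> d' [^]\<^bsub>D\<^esub> (-1::int)) \<in> R"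
    using assms hom_graph_mult hom_graph_pow by blast
  then have "(\<one>\<^bsub>A\<^esub>, d \<otimes>\<^bsub>D\<^esub> inv\<^bsub>D\<^esub> d') \<in> R"
    using c by (simp add: A.int_pow_neg D.int_pow_neg A.int_pow_1 D.int_pow_1)
  then have "d \<otimes>\<^bsub>D\<^esub> inv\<^bsub>D\<^esub> d' = \<one>\<^bsub>D\<^esub>" using R by (auto simp: hom_graph_def)
  then show ?thesis using c D.inv_equality D.inv_inv by (metis D.inv_closed)
qed

text \<open>
  The assumption \<open>comp\<close> says that the map \<open>a \<mapsto> d\<close> agrees with
  \<open>R\<close> on the powers of \<open>a\<close> at which \<open>R\<close> is defined.
\<close>
lemma hom_graph_adjoin:
  assumes R: "hom_graph A D R" and a: "a \<in> carrier A" and d: "d \<in> carrier D"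
    and comp: "\<And>(j::int) e. (a [^]\<^bsub>A\<^esub> j, e) \<in> R \<Longrightarrow> e = d [^]\<^bsub>D\<^esub> j"
  shows "hom_graph A D (adjoin (A \<times>\<times> D) R (a, d))"
  unfolding hom_graph_def
proof (intro conjI allI impI)
  show "subgroup (adjoin (A \<times>\<times> D) R (a, d)) (A \<times>\<times> D)"
    using AD.subgroup_adjoin R a d by (simp add: hom_graph_def)
next
  fix y assume "(\<one>\<^bsub>A\<^esub>, y) \<in> adjoin (A \<times>\<times> D) R (a, d)"
  then obtain b e and j :: int where be: "(b, e) \<in> R"
    and 1: "\<one>\<^bsub>A\<^esub> = b \<otimes>\<^bsub>A\<^esub> a [^]\<^bsub>A\<^esub> j" and y: "y = e \<otimes>\<^bsub>D\<^esub> d [^]\<^bsub>D\<^esub> j"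
    using a d by (auto simp: adjoin_def int_pow_DirProd A.is_group D.is_group)
  note c = hom_graph_mem[OF R be]
  have "b = a [^]\<^bsub>A\<^esub> (- j)"
    using 1 c a by (metis A.int_pow_closed A.int_pow_neg A.inv_equality A.inv_inv)
  then have "e = d [^]\<^bsub>D\<^esub> (- j)" using comp be by blast
  then show "y = \<one>\<^bsub>D\<^esub>" using d by (simp add: y D.int_pow_neg)
qed

text \<open>
  Let \<open>R\<close> be defined at the powers of \<open>a\<close> with exponents divisible by
  \<open>m\<close>, with value \<open>e\<close> at \<open>a\<close> to the power \<open>m\<close>. An
  \<open>m\<close>-th root of \<open>e\<close> can serve as the value at \<open>a\<close>.
\<close>
lemma hom_graph_extend:
  assumes R: "hom_graph A D R" and div: "divisible D" and a: "a \<in> carrier A"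
  shows "\<exists>R'. hom_graph A D R' \<and> R \<subseteq> R' \<and> a \<in> fst ` R'"
proof -
  have "group_hom (A \<times>\<times> D) A fst"
    by (intro group_hom.intro group_hom_axioms.intro AD.is_group A.is_group) (auto simp: hom_def)
  then have "subgroup (fst ` R) A"
    using R unfolding hom_graph_def by (intro group_hom.subgroup_img_is_subgroup) blast+
  then obtain m :: nat where m: "\<And>j::int. a [^]\<^bsub>A\<^esub> j \<in> fst ` R \<longleftrightarrow> int m dvd j"
    using A.exponents_multiples a by blast
  obtain e where e: "(a [^]\<^bsub>A\<^esub> int m, e) \<in> R" using m[of "int m"] by force
  obtain d where d: "d \<in> carrier D" "d [^]\<^bsub>D\<^esub> int m = e"
  proof (cases "m = 0")
    case True
    then have "e = \<one>\<^bsub>D\<^esub>" using e R by (simp add: hom_graph_def)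
    then show ?thesis using that[of "\<one>\<^bsub>D\<^esub>"] by simp
  next
    case False
    then show ?thesis using that div hom_graph_mem(2)[OF R e] unfolding divisible_def int_pow_int by blast
  qed
  have comp: "e' = d [^]\<^bsub>D\<^esub> j" if j: "(a [^]\<^bsub>A\<^esub> j, e') \<in> R" for j :: int and e'
  proof -
    have "a [^]\<^bsub>A\<^esub> j \<in> fst ` R" by (rule image_eqI[OF _ j]) simp
    then obtain i where i: "j = int m * i" using m by (blast elim: dvdE)
    have "(a [^]\<^bsub>A\<^esub> j, e [^]\<^bsub>D\<^esub> i) \<in> R"
      using hom_graph_pow[OF R e, of i] a by (simp add: A.int_pow_pow i)
    then have "e' = e [^]\<^bsub>D\<^esub> i" by (rule hom_graph_functional[OF R j])
    then show ?thesis using d by (simp add: i D.int_pow_pow[symmetric])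
  qed
  have "(a, d) \<in> adjoin (A \<times>\<times> D) R (a, d)" "R \<subseteq> adjoin (A \<times>\<times> D) R (a, d)"
    using AD.adjoin_superset R a d(1) by (simp_all add: hom_graph_def)
  moreover from this(1) have "a \<in> fst ` adjoin (A \<times>\<times> D) R (a, d)" by (metis fst_conv image_eqI)
  ultimately show ?thesis using hom_graph_adjoin[OF R a d(1) comp] by blast
qed

text \<open>
  Divisible groups are injective: a maximal graph, which exists by Zorn's lemma, is defined everywhere by
  \<open>hom_graph_extend\<close>.
\<close>
lemma hom_graph_total_extension:
  assumes R: "hom_graph A D R" and div: "divisible D"
  shows "\<exists>f\<in>hom A D. \<forall>(a, d)\<in>R. f a = d"
proof -
  let ?S = "{M. hom_graph A D M \<and> R \<subseteq> M}"
  have "\<exists>M\<in>?S. \<forall>N\<in>?S. M \<subseteq> N \<longrightarrow> N = M"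
  proof (rule subset_Zorn_nonempty[of ?S])
    show "?S \<noteq> {}" using R by auto
    fix \<C> assume ne: "\<C> \<noteq> {}" and ch: "subset.chain ?S \<C>"
    then have mem: "hom_graph A D M" "R \<subseteq> M" if "M \<in> \<C>" for M
      using that by (auto simp: subset_chain_def)
    have sub: "subgroup M (A \<times>\<times> D)" if "M \<in> \<C>" for M using mem that by (simp add: hom_graph_def)
    have "subgroup (\<Union>\<C>) (A \<times>\<times> D)"
    proof (rule AD.subgroupI)
      show "\<Union>\<C> \<subseteq> carrier (A \<times>\<times> D)" using subgroup.subset[OF sub] by (rule Union_least)
      obtain M where "M \<in> \<C>" using ne by blast
      then show "\<Union>\<C> \<noteq> {}" using subgroup.one_closed[OF sub] by blast
      show "inv\<^bsub>A \<times>\<times> D\<^esub> x \<in> \<Union>\<C>" if x: "x \<in> \<Union>\<C>" for x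
      proof -
        from x obtain M where M: "M \<in> \<C>" "x \<in> M" by blast
        from M(1) subgroup.m_inv_closed[OF sub[OF M(1)] M(2)] show ?thesis by (rule UnionI)
      qed
      fix x y assume "x \<in> \<Union>\<C>" "y \<in> \<Union>\<C>"
      then obtain M N where MN: "M \<in> \<C>" "N \<in> \<C>" "x \<in> M" "y \<in> N" by blast
      then have "M \<subseteq> N \<or> N \<subseteq> M" using ch by (simp add: subset_chain_def)
      then obtain L where L: "L \<in> \<C>" "x \<in> L" "y \<in> L" using MN by (elim disjE) auto
      from L(1) subgroup.m_closed[OF sub[OF L(1)] L(2,3)] show "x \<otimes>\<^bsub>A \<times>\<times> D\<^esub> y \<in> \<Union>\<C>"
        by (rule UnionI)
    qed
    then show "\<Union>\<C> \<in> ?S" using mem ne unfolding hom_graph_def by blast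
  qed
  then obtain M where "M \<in> ?S" and max': "\<forall>N\<in>?S. M \<subseteq> N \<longrightarrow> N = M"
    by (elim bexE)
  then have M: "hom_graph A D M" "R \<subseteq> M" by simp_all
  have max: "N = M" if "hom_graph A D N" "M \<subseteq> N" for N
    using max' that M(2) by (metis (mono_tags, lifting) mem_Collect_eq order_trans)
  have tot: "\<exists>d. (a, d) \<in> M" if "a \<in> carrier A" for a
  proof -
    obtain M' where M': "hom_graph A D M'" "M \<subseteq> M'" "a \<in> fst ` M'"
      using hom_graph_extend[OF M(1) div \<open>a \<in> carrier A\<close>] by blast
    from max[OF M'(1,2)] M'(3) have "a \<in> fst ` M" by simp
    then show ?thesis by auto
  qed
  define f where "f a = (THE d. (a, d) \<in> M)" for a
  have f: "f a = d" if "(a, d) \<in> M" for a d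
    unfolding f_def using that hom_graph_functional[OF M(1)] by blast
  have fM: "(a, f a) \<in> M" if "a \<in> carrier A" for a using tot[OF that] f by blast
  have "f \<in> hom A D"
    by (rule homI) (blast intro: f hom_graph_mult[OF M(1)] fM hom_graph_mem(2)[OF M(1)])+
  moreover have "\<forall>(a, d)\<in>R. f a = d" using f M(2) by auto
  ultimately show ?thesis by (intro bexI[of _ f])
qed

text \<open>
  Every element of the subgroup generated by \<open>B\<close> and \<open>a\<close> is a product of an element
  of \<open>B\<close> and a power of \<open>a\<close>; mapping it to that power of \<open>d\<close> is well
  defined by \<open>ann\<close>, and this homomorphism extends to \<open>A\<close>.
\<close>
lemma hom_to_divisible:
  assumes div: "divisible D" and B: "subgroup B A"
    and a: "a \<in> carrier A" and d: "d \<in> carrier D"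
    and ann: "\<And>j::int. a [^]\<^bsub>A\<^esub> j \<in> B \<Longrightarrow> d [^]\<^bsub>D\<^esub> j = \<one>\<^bsub>D\<^esub>"
  shows "\<exists>f\<in>hom A D. (\<forall>b\<in>B. f b = \<one>\<^bsub>D\<^esub>) \<and> f a = d"
proof -
  let ?R = "B \<times> {\<one>\<^bsub>D\<^esub>}"
  have "subgroup ?R (A \<times>\<times> D)"
    by (rule AD.subgroupI)
      (use B in \<open>auto simp: subgroup.mem_carrier subgroup.m_closed subgroup.m_inv_closed
        subgroup.one_closed A.is_group D.is_group\<close>, use subgroup.one_closed in blast)
  then have R: "hom_graph A D ?R" by (auto simp: hom_graph_def)
  let ?R' = "adjoin (A \<times>\<times> D) ?R (a, d)"
  have "hom_graph A D ?R'"
    by (rule hom_graph_adjoin[OF R a d]) (use ann in auto)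
  from hom_graph_total_extension[OF this div]
  obtain f where f: "f \<in> hom A D" "\<forall>(a, d)\<in>?R'. f a = d" by blast
  have "?R \<subseteq> ?R'" "(a, d) \<in> ?R'"
    using AD.adjoin_superset R a d by (simp_all add: hom_graph_def)
  then have "f b = \<one>\<^bsub>D\<^esub>" if "b \<in> B" for b using f(2) that by force
  moreover have "f a = d" using \<open>(a, d) \<in> ?R'\<close> f(2) by force
  ultimately show ?thesis using f(1) by blast
qed

section \<open>Embedding countable abelian groups\<close>

text \<open>
  An element of \<open>B n\<close> is killed by all \<open>f m\<close> with \<open>m \<ge> n\<close>, so the
  joint map of the \<open>f n\<close> has values in the direct sum. It is injective because an element other
  than \<open>\<one>\<close> first appears in some \<open>B (Suc n)\<close>, and then \<open>f n\<close> does
  not kill it.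
\<close>
lemma embeds_in_sum_group:
  fixes B :: "nat \<Rightarrow> 'a set" and f :: "nat \<Rightarrow> 'a \<Rightarrow> 'd"
  assumes B0: "B 0 = {\<one>\<^bsub>A\<^esub>}" and cover: "carrier A \<subseteq> (\<Union>n. B n)" and mono: "\<And>n. B n \<subseteq> B (Suc n)"
    and hom: "\<And>n. f n \<in> hom A D"
    and ker: "\<And>n x. x \<in> B n \<Longrightarrow> f n x = \<one>\<^bsub>D\<^esub>"
    and faith: "\<And>n x. x \<in> B (Suc n) \<Longrightarrow> f n x = \<one>\<^bsub>D\<^esub> \<Longrightarrow> x \<in> B n"
  defines "\<Phi> \<equiv> \<lambda>x n. f n x"
  shows "\<Phi> \<in> hom A (sum_group UNIV (\<lambda>_. D))" "inj_on \<Phi> (carrier A)"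
proof -
  have "B i \<subseteq> B j" if "i \<le> j" for i j using that mono by (rule lift_Suc_mono_le[rotated])
  then have kill: "f j x = \<one>\<^bsub>D\<^esub>" if "x \<in> B i" "i \<le> j" for i j x using that ker by blast
  have fin: "finite {n. f n x \<noteq> \<one>\<^bsub>D\<^esub>}" if "x \<in> carrier A" for x
  proof -
    obtain i where i: "x \<in> B i" using \<open>x \<in> carrier A\<close> cover by blast
    have "{n. f n x \<noteq> \<one>\<^bsub>D\<^esub>} \<subseteq> {..<i}"
    proof
      fix n assume "n \<in> {n. f n x \<noteq> \<one>\<^bsub>D\<^esub>}"
      then show "n \<in> {..<i}" using kill[OF i, of n] by (cases "i \<le> n") simp_all
    qed
    then show ?thesis using finite_subset by blast
  qed
  show \<Phi>: "\<Phi> \<in> hom A (sum_group UNIV (\<lambda>_. D))"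
    unfolding \<Phi>_def using hom fin
    by (intro homI) (auto simp: carrier_sum_group D.is_group hom_def Pi_iff)
  interpret group_hom A "sum_group UNIV (\<lambda>_. D)" \<Phi>
    using \<Phi> by (simp add: group_hom_def group_hom_axioms_def A.is_group D.is_group)
  show "inj_on \<Phi> (carrier A)"
    unfolding inj_on_one_iff
  proof (intro allI impI)
    fix x assume x: "x \<in> carrier A" and "\<Phi> x = \<one>\<^bsub>sum_group UNIV (\<lambda>_. D)\<^esub>"
    then have z: "f n x = \<one>\<^bsub>D\<^esub>" for n by (simp add: \<Phi>_def fun_eq_iff)
    have "x \<in> B 0" if "x \<in> B n" for n using that by (induction n) (use faith z in auto)
    then show "x = \<one>\<^bsub>A\<^esub>" using x cover B0 by blast
  qed
qed

text \<open>
  The chain for \<open>embeds_in_sum_group\<close> is built by adjoining the elements of \<open>A\<close> in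
  the order of an enumeration; \<open>P\<close> is an invariant of the subgroups in the chain.
\<close>
lemma embeds_by_extension:
  assumes countable: "countable (carrier A)"
    and P: "P {\<one>\<^bsub>A\<^esub>}"
    and step: "\<And>B a. P B \<Longrightarrow> a \<in> carrier A \<Longrightarrow> \<exists>B' f. P B' \<and> B \<subseteq> B' \<and> a \<in> B' \<and> f \<in> hom A D \<and>
      (\<forall>x\<in>B. f x = \<one>\<^bsub>D\<^esub>) \<and> (\<forall>x\<in>B'. f x = \<one>\<^bsub>D\<^esub> \<longrightarrow> x \<in> B)"
  shows "\<exists>\<Phi>\<in>hom A (sum_group (UNIV :: nat set) (\<lambda>_. D)). inj_on \<Phi> (carrier A)"
proof -
  define good where "good B a p \<longleftrightarrow> P (fst p) \<and> B \<subseteq> fst p \<and> a \<in> fst p \<and> snd p \<in> hom A D \<and>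
      (\<forall>x\<in>B. snd p x = \<one>\<^bsub>D\<^esub>) \<and> (\<forall>x\<in>fst p. snd p x = \<one>\<^bsub>D\<^esub> \<longrightarrow> x \<in> B)"
    for B a and p :: "'a set \<times> ('a \<Rightarrow> 'd)"
  define next_step where "next_step B a = (SOME p. good B a p)" for B a
  have good: "good B a (next_step B a)" if Ba: "P B" "a \<in> carrier A" for B a
  proof -
    obtain B' f where "good B a (B', f)" using step[OF Ba] unfolding good_def fst_conv snd_conv by blast
    then show ?thesis unfolding next_step_def by (rule someI)
  qed
  define a where "a = from_nat_into (carrier A)"
  have a: "a n \<in> carrier A" for n unfolding a_def using A.one_closed by (intro from_nat_into) auto
  define B where "B = rec_nat {\<one>\<^bsub>A\<^esub>} (\<lambda>n H. fst (next_step H (a n)))"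
  have B: "B 0 = {\<one>\<^bsub>A\<^esub>}" "B (Suc n) = fst (next_step (B n) (a n))" for n by (simp_all add: B_def)
  have PB: "P (B n)" for n
  proof (induction n)
    case (Suc n)
    then show ?case using good[OF Suc a] unfolding B good_def by blast
  qed (simp add: B P)
  let ?f = "\<lambda>n. snd (next_step (B n) (a n))"
  have mem: "a n \<in> B (Suc n)" and mono: "B n \<subseteq> B (Suc n)" and hom: "?f n \<in> hom A D"
    and ker: "\<And>x. x \<in> B n \<Longrightarrow> ?f n x = \<one>\<^bsub>D\<^esub>" and faith: "\<And>x. x \<in> B (Suc n) \<Longrightarrow> ?f n x = \<one>\<^bsub>D\<^esub> \<Longrightarrow> x \<in> B n" for n
    using good[OF PB a, of n n] unfolding good_def B(2)[symmetric] by blast+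
  have cover: "carrier A \<subseteq> (\<Union>n. B n)"
  proof
    fix x assume "x \<in> carrier A"
    then obtain n where "x = a n" unfolding a_def using from_nat_into_surj[OF countable] by metis
    then have "x \<in> B (Suc n)" using mem by simp
    then show "x \<in> (\<Union>n. B n)" by blast
  qed
  show ?thesis
    using embeds_in_sum_group[of B ?f, OF B(1) cover mono hom ker faith] by blast
qed

end

text \<open>
  The elements that are torsion modulo \<open>H\<close>.
\<close>
definition isolator :: "('a, 'm) monoid_scheme \<Rightarrow> 'a set \<Rightarrow> 'a set" where
  "isolator G H = {x \<in> carrier G. \<exists>k::nat. 0 < k \<and> x [^]\<^bsub>G\<^esub> k \<in> H}"

lemma (in comm_group) subgroup_isolator:
  assumes H: "subgroup H G"
  shows "subgroup (isolator G H) G"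
proof (rule subgroupI)
  have pow: "h [^] (n::nat) \<in> H" if "h \<in> H" for h n
    using H that by (induction n) (simp_all add: subgroup.one_closed subgroup.m_closed)
  show "isolator G H \<subseteq> carrier G" by (auto simp: isolator_def)
  have "\<one> [^] (1::nat) \<in> H" using subgroup.one_closed[OF H] by simp
  then show "isolator G H \<noteq> {}" unfolding isolator_def using zero_less_one one_closed by blast
  show "inv a \<in> isolator G H" if aI: "a \<in> isolator G H" for a
  proof -
    obtain k :: nat where k: "0 < k" "a [^] k \<in> H" "a \<in> carrier G" using aI unfolding isolator_def by blast
    have "inv a [^] k \<in> H" using subgroup.m_inv_closed[OF H k(2)] k(3) by (simp add: nat_pow_inv)
    then show ?thesis using k unfolding isolator_def by blast
  qed
  show "a \<otimes> b \<in> isolator G H" if ab: "a \<in> isolator G H" "b \<in> isolator G H" for a b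
  proof -
    obtain k :: nat where k: "0 < k" "a [^] k \<in> H" "a \<in> carrier G" using ab(1) unfolding isolator_def by blast
    obtain l :: nat where l: "0 < l" "b [^] l \<in> H" "b \<in> carrier G" using ab(2) unfolding isolator_def by blast
    have "(a \<otimes> b) [^] (k * l) = (a [^] k) [^] l \<otimes> (b [^] l) [^] k"
      using k l by (simp add: nat_pow_distrib nat_pow_pow mult.commute)
    then have "(a \<otimes> b) [^] (k * l) \<in> H" using pow k l subgroup.m_closed[OF H] by simp
    then show ?thesis using k l unfolding isolator_def by (metis (mono_tags, lifting) m_closed mem_Collect_eq nat_0_less_mult_iff)
  qed
qed

lemma (in group) isolator_superset:
  assumes "subgroup H G" shows "H \<subseteq> isolator G H"
proof
  fix h assume h: "h \<in> H"
  then have "h \<in> carrier G" using subgroup.mem_carrier[OF assms] by blast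
  moreover from this have "h [^] (1::nat) \<in> H" using h by simp
  ultimately show "h \<in> isolator G H" unfolding isolator_def using zero_less_one by blast
qed

lemma (in group) isolator_isolator: "isolator G (isolator G H) \<subseteq> isolator G H"
proof
  fix x assume "x \<in> isolator G (isolator G H)"
  then obtain k l :: nat where "x \<in> carrier G" "0 < k" "0 < l" "(x [^] k) [^] l \<in> H"
    unfolding isolator_def by blast
  then have "x \<in> carrier G" "x [^] (k * l) \<in> H" "0 < k * l" by (simp_all add: nat_pow_pow)
  then show "x \<in> isolator G H" unfolding isolator_def by blast
qed

text \<open>
  Adjoining \<open>a\<close> to \<open>B\<close> enlarges it by a cyclic quotient. Since \<open>D\<close> has
  cyclic subgroups of all orders (\<open>m = 0\<close> in \<open>cyc\<close> stands for infinite order), it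
  has one that is isomorphic to this quotient.
\<close>
lemma countable_abelian_embeds:
  assumes A: "comm_group A" and D: "comm_group D" and countable: "countable (carrier A)"
    and div: "divisible D"
    and cyc: "\<And>m::nat. \<exists>d\<in>carrier D. \<forall>j::int. d [^]\<^bsub>D\<^esub> j = \<one>\<^bsub>D\<^esub> \<longleftrightarrow> int m dvd j"
  shows "\<exists>\<Phi>\<in>hom A (sum_group (UNIV :: nat set) (\<lambda>_. D)). inj_on \<Phi> (carrier A)"
proof (rule embeds_by_extension[OF A D countable, where P = "\<lambda>B. subgroup B A"])
  interpret A: comm_group A by fact
  interpret D: comm_group D by fact
  show "subgroup {\<one>\<^bsub>A\<^esub>} A" by (rule A.triv_subgroup)
  fix B a assume sub: "subgroup B A" and a: "a \<in> carrier A"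
  obtain m :: nat where m: "\<And>j::int. a [^]\<^bsub>A\<^esub> j \<in> B \<longleftrightarrow> int m dvd j"
    using A.exponents_multiples[OF sub a] by blast
  obtain d where d: "d \<in> carrier D" "\<And>j::int. d [^]\<^bsub>D\<^esub> j = \<one>\<^bsub>D\<^esub> \<longleftrightarrow> int m dvd j"
    using cyc[of m] by blast
  obtain f where f: "f \<in> hom A D" "\<And>b. b \<in> B \<Longrightarrow> f b = \<one>\<^bsub>D\<^esub>" "f a = d"
    using hom_to_divisible[OF A D div sub a d(1)] m d(2) by blast
  have "x \<in> B" if x: "x \<in> adjoin A B a" "f x = \<one>\<^bsub>D\<^esub>" for x
  proof -
    obtain b and j :: int where bj: "b \<in> B" "x = b \<otimes>\<^bsub>A\<^esub> a [^]\<^bsub>A\<^esub> j"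
      using x(1) by (rule A.adjoinE)
    have bc: "b \<in> carrier A" using subgroup.mem_carrier[OF sub bj(1)] .
    have "f x = f b \<otimes>\<^bsub>D\<^esub> f a [^]\<^bsub>D\<^esub> j"
      unfolding bj(2) using hom_mult[OF f(1) bc] hom_int_pow[OF f(1) a A.is_group D.is_group] a by simp
    then have "d [^]\<^bsub>D\<^esub> j = \<one>\<^bsub>D\<^esub>" using x(2) f bj(1) d(1) by simp
    then have "a [^]\<^bsub>A\<^esub> j \<in> B" using d(2) m by simp
    then show ?thesis unfolding bj(2) using subgroup.m_closed[OF sub bj(1)] by simp
  qed
  then show "\<exists>B' f. subgroup B' A \<and> B \<subseteq> B' \<and> a \<in> B' \<and> f \<in> hom A D \<and>
      (\<forall>x\<in>B. f x = \<one>\<^bsub>D\<^esub>) \<and> (\<forall>x\<in>B'. f x = \<one>\<^bsub>D\<^esub> \<longrightarrow> x \<in> B)"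
    using f(1,2) A.subgroup_adjoin[OF sub a] A.adjoin_superset[OF sub a] by blast
qed

text \<open>
  The chain consists of isolated subgroups, modulo which \<open>A\<close> stays torsion-free. So a new element
  \<open>a\<close> has infinite order modulo \<open>B\<close> and may be mapped to \<open>d\<close>. If this
  homomorphism kills an element with a power \<open>b \<otimes> a [^] j\<close>, then \<open>j = 0\<close>, so
  that the element is torsion modulo \<open>B\<close>.
\<close>
lemma countable_torsion_free_embeds:
  assumes A: "comm_group A" and D: "comm_group D" and countable: "countable (carrier A)"
    and tf: "torsion_free A" and div: "divisible D"
    and d: "d \<in> carrier D" "\<And>j::int. d [^]\<^bsub>D\<^esub> j = \<one>\<^bsub>D\<^esub> \<longleftrightarrow> j = 0"
  shows "\<exists>\<Phi>\<in>hom A (sum_group (UNIV :: nat set) (\<lambda>_. D)). inj_on \<Phi> (carrier A)"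
proof (rule embeds_by_extension[OF A D countable, where P = "\<lambda>B. subgroup B A \<and> isolator A B \<subseteq> B"])
  interpret A: comm_group A by fact
  interpret D: comm_group D by fact
  show "subgroup {\<one>\<^bsub>A\<^esub>} A \<and> isolator A {\<one>\<^bsub>A\<^esub>} \<subseteq> {\<one>\<^bsub>A\<^esub>}"
    using A.triv_subgroup tf by (auto simp: torsion_free_def isolator_def)
  fix B a
  assume PB: "subgroup B A \<and> isolator A B \<subseteq> B" and a: "a \<in> carrier A"
  have sub: "subgroup B A" using PB by (rule conjunct1)
  have iso: "x \<in> B" if "x \<in> carrier A" "0 < (k::nat)" "x [^]\<^bsub>A\<^esub> k \<in> B" for x k
    using PB that unfolding isolator_def by blast
  \<comment> \<open>if \<open>a\<close> is in \<open>B\<close> already, the step is trivial\<close>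
  let ?d = "if a \<in> B then \<one>\<^bsub>D\<^esub> else d" and ?B = "isolator A (adjoin A B a)"
  obtain m :: nat where m: "\<And>j::int. a [^]\<^bsub>A\<^esub> j \<in> B \<longleftrightarrow> int m dvd j"
    using A.exponents_multiples[OF sub a] by blast
  have m0: "m = 0" if "a \<notin> B"
  proof (rule ccontr)
    assume "m \<noteq> 0"
    moreover have "a [^]\<^bsub>A\<^esub> m \<in> B" using m[of "int m"] by (simp add: int_pow_int)
    ultimately show False using iso[OF a, of m] that by simp
  qed
  have "\<exists>f\<in>hom A D. (\<forall>b\<in>B. f b = \<one>\<^bsub>D\<^esub>) \<and> f a = ?d"
  proof (rule hom_to_divisible[OF A D div sub a])
    show "?d \<in> carrier D" using d(1) by simp
    fix j :: int assume "a [^]\<^bsub>A\<^esub> j \<in> B"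
    then show "?d [^]\<^bsub>D\<^esub> j = \<one>\<^bsub>D\<^esub>" using m m0 d(2) by auto
  qed
  then obtain f where f: "f \<in> hom A D" "\<And>b. b \<in> B \<Longrightarrow> f b = \<one>\<^bsub>D\<^esub>" "f a = ?d" by blast
  have "x \<in> B" if x: "x \<in> ?B" "f x = \<one>\<^bsub>D\<^esub>" for x
  proof -
    obtain k :: nat where k: "0 < k" "x [^]\<^bsub>A\<^esub> k \<in> adjoin A B a" "x \<in> carrier A"
      using x(1) unfolding isolator_def by blast
    obtain b and j :: int where bj: "b \<in> B" "x [^]\<^bsub>A\<^esub> k = b \<otimes>\<^bsub>A\<^esub> a [^]\<^bsub>A\<^esub> j"
      using k(2) by (rule A.adjoinE)
    have bc: "b \<in> carrier A" using subgroup.mem_carrier[OF sub bj(1)] .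
    have "f (x [^]\<^bsub>A\<^esub> k) = f b \<otimes>\<^bsub>D\<^esub> f a [^]\<^bsub>D\<^esub> j"
      unfolding bj(2) using hom_mult[OF f(1) bc] hom_int_pow[OF f(1) a A.is_group D.is_group] a by simp
    moreover have "f (x [^]\<^bsub>A\<^esub> k) = \<one>\<^bsub>D\<^esub>"
      using hom_nat_pow[OF f(1) k(3) A.is_group D.is_group, of k] x(2) by simp
    ultimately have "?d [^]\<^bsub>D\<^esub> j = \<one>\<^bsub>D\<^esub>" using f bj(1) d(1) by (simp split: if_splits)
    then have "a [^]\<^bsub>A\<^esub> j \<in> B"
      using d(2) subgroup.one_closed[OF sub] A.subgroup_int_pow_closed[OF sub, of a j]
      by (auto split: if_splits)
    then have "x [^]\<^bsub>A\<^esub> k \<in> B" unfolding bj(2) using subgroup.m_closed[OF sub bj(1)] by simp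
    then show ?thesis by (rule iso[OF k(3,1)])
  qed
  moreover have adj: "subgroup (adjoin A B a) A" by (rule A.subgroup_adjoin[OF sub a])
  moreover have "isolator A ?B \<subseteq> ?B" by (rule A.isolator_isolator)
  moreover have "B \<subseteq> ?B" "a \<in> ?B"
    using A.adjoin_superset[OF sub a] A.isolator_superset[OF adj] by blast+
  ultimately show "\<exists>B' f. (subgroup B' A \<and> isolator A B' \<subseteq> B') \<and>
      B \<subseteq> B' \<and> a \<in> B' \<and> f \<in> hom A D \<and>
      (\<forall>x\<in>B. f x = \<one>\<^bsub>D\<^esub>) \<and> (\<forall>x\<in>B'. f x = \<one>\<^bsub>D\<^esub> \<longrightarrow> x \<in> B)"
    using f(1,2) A.subgroup_isolator[OF adj] by blast
qed

section \<open>The rationals and the rationals modulo the integers\<close>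

lemma comm_group_rat: "comm_group rat_group"
proof (rule comm_groupI)
  fix x :: rat
  show "\<exists>y\<in>carrier rat_group. y \<otimes>\<^bsub>rat_group\<^esub> x = \<one>\<^bsub>rat_group\<^esub>"
    by (rule bexI[of _ "- x"]) (simp_all add: rat_group_def)
qed (simp_all add: rat_group_def)

lemma rat_group_simps [simp]:
  "carrier rat_group = UNIV" "x \<otimes>\<^bsub>rat_group\<^esub> y = x + y" "\<one>\<^bsub>rat_group\<^esub> = 0"
  by (simp_all add: rat_group_def)

lemma rat_group_inv: "inv\<^bsub>rat_group\<^esub> x = - x"
  using group.inv_equality[OF comm_group.axioms(2)[OF comm_group_rat], of "- x" x] by simp

lemma rat_group_nat_pow: "x [^]\<^bsub>rat_group\<^esub> (n::nat) = of_nat n * x"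
proof -
  interpret comm_group rat_group by (rule comm_group_rat)
  show ?thesis by (induction n) (simp_all add: algebra_simps)
qed

lemma rat_group_int_pow: "x [^]\<^bsub>rat_group\<^esub> (j::int) = of_int j * x"
proof -
  interpret comm_group rat_group by (rule comm_group_rat)
  show ?thesis by (cases j rule: int_cases2) (simp_all add: int_pow_int int_pow_neg rat_group_nat_pow rat_group_inv)
qed

lemma subgroup_Ints: "subgroup \<int> rat_group"
  by (rule subgroup.intro) (auto simp: rat_group_inv)

lemma normal_Ints: "\<int> \<lhd> rat_group"
  using comm_group.subgroup_imp_normal[OF comm_group_rat subgroup_Ints] .

lemma comm_group_rat_mod_int: "comm_group rat_mod_int_group"
  using comm_group.abelian_FactGroup[OF comm_group_rat subgroup_Ints] .

lemma divisible_rat: "divisible rat_group"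
  unfolding divisible_def
proof (intro ballI allI impI)
  fix q :: rat and m :: nat assume "0 < m"
  then show "\<exists>e\<in>carrier rat_group. e [^]\<^bsub>rat_group\<^esub> m = q"
    by (intro bexI[of _ "q / of_nat m"]) (simp_all add: rat_group_nat_pow)
qed

abbreviation coset :: "rat \<Rightarrow> rat set" where
  "coset q \<equiv> \<int> #>\<^bsub>rat_group\<^esub> q"

lemma mem_coset_iff: "r \<in> coset q \<longleftrightarrow> r - q \<in> \<int>"
proof
  assume "r - q \<in> \<int>"
  then have "\<exists>h\<in>\<int>. r = h + q" by (intro bexI[of _ "r - q"]) simp
  then show "r \<in> coset q" by (auto simp: r_coset_def)
qed (auto simp: r_coset_def)

lemma carrier_rat_mod_int: "carrier rat_mod_int_group = range coset"
  by (auto simp: FactGroup_def RCOSETS_def)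

lemma coset_hom: "coset \<in> hom rat_group rat_mod_int_group"
  using normal.r_coset_hom_Mod[OF normal_Ints] .

lemma one_rat_mod_int: "\<one>\<^bsub>rat_mod_int_group\<^esub> = \<int>"
  by (simp add: FactGroup_def)

lemma coset_eq_iff: "coset q = coset r \<longleftrightarrow> q - r \<in> \<int>"
proof
  assume "coset q = coset r"
  then show "q - r \<in> \<int>" using mem_coset_iff[of q q] mem_coset_iff[of q r] by simp
next
  assume qr: "q - r \<in> \<int>"
  have "x - q \<in> \<int> \<longleftrightarrow> x - r \<in> \<int>" for x
    using Ints_add[OF _ qr, of "x - q"] Ints_diff[OF _ qr, of "x - r"] by auto
  then show "coset q = coset r" by (auto simp: mem_coset_iff)
qed

text \<open>
  The subgroup \<open>\<int>\<close> itself is the identity of the quotient.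
\<close>
lemma coset_eq_Ints_iff: "coset q = \<int> \<longleftrightarrow> q \<in> \<int>"
proof -
  have "coset 0 = \<int>" by (auto simp: mem_coset_iff)
  then show ?thesis using coset_eq_iff[of q 0] by simp
qed

lemma coset_nat_pow: "coset q [^]\<^bsub>rat_mod_int_group\<^esub> (n::nat) = coset (of_nat n * q)"
  using hom_nat_pow[OF coset_hom, of q n] comm_group.axioms(2)[OF comm_group_rat]
    comm_group.axioms(2)[OF comm_group_rat_mod_int] by (simp add: rat_group_nat_pow)

lemma coset_int_pow: "coset q [^]\<^bsub>rat_mod_int_group\<^esub> (j::int) = coset (of_int j * q)"
  using hom_int_pow[OF coset_hom, of q j] comm_group.axioms(2)[OF comm_group_rat]
    comm_group.axioms(2)[OF comm_group_rat_mod_int] by (simp add: rat_group_int_pow)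

lemma divisible_rat_mod_int: "divisible rat_mod_int_group"
  unfolding divisible_def carrier_rat_mod_int
proof (intro ballI allI impI)
  fix c and m :: nat assume "c \<in> range coset" and m: "0 < m"
  then obtain q where "c = coset q" by blast
  then have "coset (q / of_nat m) [^]\<^bsub>rat_mod_int_group\<^esub> m = c" using m by (simp add: coset_nat_pow)
  then show "\<exists>e\<in>range coset. e [^]\<^bsub>rat_mod_int_group\<^esub> m = c" by blast
qed

lemma nat_pow_DirProd: "(a, d) [^]\<^bsub>A \<times>\<times> D\<^esub> (n::nat) = (a [^]\<^bsub>A\<^esub> n, d [^]\<^bsub>D\<^esub> n)"
  by (induction n) (simp_all add: nat_pow_def DirProd_def)

lemma divisible_DirProd: "divisible A \<Longrightarrow> divisible D \<Longrightarrow> divisible (A \<times>\<times> D)"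
  unfolding divisible_def
proof (intro ballI allI impI)
  fix x and m :: nat
  assume A: "\<forall>d\<in>carrier A. \<forall>m::nat. 0 < m \<longrightarrow> (\<exists>e\<in>carrier A. e [^]\<^bsub>A\<^esub> m = d)"
    and D: "\<forall>d\<in>carrier D. \<forall>m::nat. 0 < m \<longrightarrow> (\<exists>e\<in>carrier D. e [^]\<^bsub>D\<^esub> m = d)"
    and x: "x \<in> carrier (A \<times>\<times> D)" and m: "0 < m"
  obtain a d where ad: "x = (a, d)" "a \<in> carrier A" "d \<in> carrier D" using x by auto
  obtain a' d' where "a' \<in> carrier A" "d' \<in> carrier D" "a' [^]\<^bsub>A\<^esub> m = a" "d' [^]\<^bsub>D\<^esub> m = d"
    using A D ad m by blast
  then show "\<exists>e\<in>carrier (A \<times>\<times> D). e [^]\<^bsub>A \<times>\<times> D\<^esub> m = x"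
    by (intro bexI[of _ "(a', d')"]) (simp_all add: nat_pow_DirProd ad)
qed

text \<open>
  The number \<open>1\<close> has infinite order in \<open>\<rat>\<close>, and \<open>1/m\<close> has order
  \<open>m\<close> in \<open>\<rat>/\<int>\<close>.
\<close>
lemma rat_cyclic_subgroups:
  "\<exists>d\<in>carrier (rat_group \<times>\<times> rat_mod_int_group).
     \<forall>j::int. d [^]\<^bsub>rat_group \<times>\<times> rat_mod_int_group\<^esub> j = \<one>\<^bsub>rat_group \<times>\<times> rat_mod_int_group\<^esub> \<longleftrightarrow> int m dvd j"
proof -
  have pow: "(q, coset r) [^]\<^bsub>rat_group \<times>\<times> rat_mod_int_group\<^esub> j = (of_int j * q, coset (of_int j * r))" for q r and j :: int
    using int_pow_DirProd[of rat_group rat_mod_int_group q "coset r" j] comm_group.axioms(2)[OF comm_group_rat]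
      comm_group.axioms(2)[OF comm_group_rat_mod_int]
    by (simp add: rat_group_int_pow coset_int_pow carrier_rat_mod_int)
  have one: "\<one>\<^bsub>rat_group \<times>\<times> rat_mod_int_group\<^esub> = (0, \<int>)"
    by (simp add: DirProd_def one_rat_mod_int)
  have mem: "(q, coset r) \<in> carrier (rat_group \<times>\<times> rat_mod_int_group)" for q r
    by (simp add: carrier_rat_mod_int)
  show ?thesis
  proof (cases "m = 0")
    case True
    show ?thesis
      by (rule bexI[OF _ mem[of 1 0]]) (use True in \<open>simp add: pow one coset_eq_Ints_iff\<close>)
  next
    case False
    have "of_int j * (1 / of_nat m) \<in> (\<int> :: rat set) \<longleftrightarrow> int m dvd j" for j :: int
    proof
      assume "of_int j * (1 / of_nat m) \<in> (\<int> :: rat set)"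
      then obtain i :: int where "of_int j * (1 / of_nat m) = (of_int i :: rat)" by (rule Ints_cases)
      then have "(of_int j :: rat) = of_int (int m * i)" using False by (simp add: field_simps)
      then have "j = int m * i" by (simp only: of_int_eq_iff)
      then show "int m dvd j" by simp
    next
      assume "int m dvd j"
      then obtain i where "j = int m * i" by (rule dvdE)
      then have "of_int j * (1 / of_nat m) = (of_int i :: rat)" using False by simp
      then show "of_int j * (1 / of_nat m) \<in> (\<int> :: rat set)" by simp
    qed
    then show ?thesis
      by (intro bexI[OF _ mem[of 0 "1 / of_nat m"]]) (simp add: pow one coset_eq_Ints_iff)
  qed
qed

section \<open>Words and their lexicographic order\<close>

lemma conc_inject [simp]: "\<alpha> \<frown> x = \<alpha> \<frown> y \<longleftrightarrow> x = y"
  by (metis suffix_conc_length)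

lemma conc_const: "replicate n c \<frown> (\<lambda>_. c) = (\<lambda>_. c)"
  by (rule ext) (simp add: conc_def)

lemma Cons_conc: "(c # \<alpha>) \<frown> x = [c] \<frown> \<alpha> \<frown> x"
  by simp

lemma word_cases:
  obtains c y where "(w :: cantor) = [c] \<frown> y"
proof
  show "w = [w 0] \<frown> (\<lambda>i. w (Suc i))" by (rule ext) (simp add: conc_def)
qed

lemma word_split_prefix: "(w :: cantor) = map w [0..<n] \<frown> (\<lambda>i. w (n + i))"
  by (rule ext) (auto simp: conc_def)

abbreviation word_less :: "cantor \<Rightarrow> cantor \<Rightarrow> bool" (infix "\<prec>\<^sub>L" 50) where
  "x \<prec>\<^sub>L y \<equiv> less_fun x y"

lemma less_conc_iff [simp]: "\<alpha> \<frown> x \<prec>\<^sub>L \<alpha> \<frown> y \<longleftrightarrow> x \<prec>\<^sub>L y"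
proof -
  have "[c] \<frown> x \<prec>\<^sub>L [c] \<frown> y \<longleftrightarrow> x \<prec>\<^sub>L y" for c :: bool and x y
  proof
    assume "[c] \<frown> x \<prec>\<^sub>L [c] \<frown> y"
    then obtain k where k: "([c] \<frown> x) k < ([c] \<frown> y) k" "\<And>k'. k' < k \<Longrightarrow> ([c] \<frown> x) k' = ([c] \<frown> y) k'"
      by (rule less_funE) blast
    then obtain k1 where k1: "k = Suc k1" by (cases k) auto
    then have "x k1 < y k1" "x j = y j" if "j < k1" for j
      using k(1) k(2)[of "Suc j"] that by simp_all
    moreover have "x k1 < y k1" using k(1) k1 by simp
    ultimately show "x \<prec>\<^sub>L y" unfolding less_fun_def by blast
  next
    assume "x \<prec>\<^sub>L y"
    then obtain k where k: "x k < y k" "\<And>k'. k' < k \<Longrightarrow> x k' = y k'"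
      by (rule less_funE) blast
    have "([c] \<frown> x) k' = ([c] \<frown> y) k'" if "k' < Suc k" for k'
      using that k(2) by (cases k') simp_all
    moreover have "([c] \<frown> x) (Suc k) < ([c] \<frown> y) (Suc k)" using k(1) by simp
    ultimately show "[c] \<frown> x \<prec>\<^sub>L [c] \<frown> y" unfolding less_fun_def by blast
  qed
  then show ?thesis
    by (induction \<alpha>) (simp_all add: Cons_conc del: conc_conc)
qed

lemma less_first: "[False] \<frown> x \<prec>\<^sub>L [True] \<frown> y"
  unfolding less_fun_def by (rule exI[of _ 0]) simp

lemma word_less_cases: "x \<prec>\<^sub>L y \<or> x = y \<or> y \<prec>\<^sub>L x"
proof (cases "x = y")
  case False
  then obtain i where "x i \<noteq> y i" by auto
  define k where "k = (LEAST i. x i \<noteq> y i)"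
  have k: "x k \<noteq> y k" unfolding k_def using \<open>x i \<noteq> y i\<close> by (rule LeastI)
  have "x j = y j" if "j < k" for j using not_less_Least that unfolding k_def by blast
  moreover have "x k < y k \<or> y k < x k" using k by auto
  ultimately show ?thesis unfolding less_fun_def by metis
qed simp

text \<open>
  The order of cylinders. Unlike the order of words it can be checked on prefixes, and it survives appending
  letters.
\<close>
definition before :: "bool list \<Rightarrow> bool list \<Rightarrow> bool" where
  "before \<alpha> \<beta> \<longleftrightarrow> (\<forall>x y. \<alpha> \<frown> x \<prec>\<^sub>L \<beta> \<frown> y)"

lemma before_append: "before \<alpha> \<beta> \<Longrightarrow> before (\<alpha> @ \<gamma>) (\<beta> @ \<delta>)"
  by (auto simp: before_def simp flip: conc_conc)

lemma before_append_same: "before \<alpha> \<beta> \<Longrightarrow> before (\<gamma> @ \<alpha>) (\<gamma> @ \<beta>)"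
  by (auto simp: before_def simp flip: conc_conc)

lemma before_first: "before (False # \<alpha>) (True # \<beta>)"
  unfolding before_def
proof (intro allI)
  fix x y
  have "[False] \<frown> \<alpha> \<frown> x \<prec>\<^sub>L [True] \<frown> \<beta> \<frown> y" by (rule less_first)
  then show "(False # \<alpha>) \<frown> x \<prec>\<^sub>L (True # \<beta>) \<frown> y" by simp
qed

text \<open>
  An increasing family of cylinders is disjoint, so a word determines its index and its tail.
\<close>
lemma before_tails:
  assumes incr: "\<And>K K'. K < K' \<Longrightarrow> before (p K) (p K')"
    and eq: "p K \<frown> x = p K' \<frown> y"
  shows "(K :: 'i :: linorder) = K'" "x = y"
proof -
  show "K = K'"
    using incr[of K K'] incr[of K' K] eq less_fun_irrefl[of "p K \<frown> x"]
    by (metis before_def linorder_neqE)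
  then show "x = y" using eq by simp
qed

section \<open>Mixed radix codes\<close>

text \<open>
  Unary notation in base \<open>b\<close>. The last digit carries no terminating \<open>0\<close>; this makes
  the prefix code complete. In base \<open>1\<close> the only digit is the empty word.
\<close>
definition digit :: "nat \<Rightarrow> nat \<Rightarrow> bool list" where
  "digit b j = replicate j True @ (if Suc j < b then [False] else [])"

lemma digit_exists: "0 < b \<Longrightarrow> \<exists>j y. j < b \<and> w = digit b j \<frown> y"
proof (induction b arbitrary: w)
  case (Suc b)
  show ?case
  proof (cases "b = 0")
    case True
    then have "w = digit (Suc b) 0 \<frown> w" by (simp add: digit_def)
    then show ?thesis by blast
  next
    case b: False
    obtain c y where w: "w = [c] \<frown> y" by (rule word_cases)
    show ?thesis
    proof (cases c)
      case True
      obtain j z where j: "j < b" "y = digit b j \<frown> z" using Suc.IH b by blast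
      have "digit (Suc b) (Suc j) = True # digit b j" by (simp add: digit_def)
      then have "w = digit (Suc b) (Suc j) \<frown> z" using w j True by simp
      then show ?thesis using j(1) by (meson Suc_mono)
    next
      case False
      then have "w = digit (Suc b) 0 \<frown> y" using w b by (simp add: digit_def)
      then show ?thesis by blast
    qed
  qed
qed simp

lemma digit_before: "j < j' \<Longrightarrow> j' < b \<Longrightarrow> before (digit b j) (digit b j')"
proof (induction j arbitrary: j' b)
  case 0
  then obtain i where "j' = Suc i" by (cases j') auto
  with 0 show ?case by (simp add: digit_def before_first)
next
  case (Suc j)
  then obtain i c where ic: "j' = Suc i" "b = Suc c" by (cases j'; cases b) auto
  have "digit (Suc c) (Suc k) = [True] @ digit c k" for k by (simp add: digit_def)
  then show ?case using before_append_same[of "digit c j" "digit c i" "[True]"] Suc ic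
    by (simp del: append_Cons)
qed

lemma digit_inject:
  assumes "j < b" "j' < b" "digit b j \<frown> x = digit b j' \<frown> y"
  shows "j = j'" "x = y"
proof -
  show "j = j'"
    using assms digit_before[of j j' b] digit_before[of j' j b] less_fun_irrefl[of "digit b j \<frown> x"]
    by (metis before_def linorder_neqE)
  then show "x = y" using assms by simp
qed

text \<open>
  Think of \<open>code p n K\<close> as the interval from \<open>K/n!\<close> to \<open>(K + 1)/n!\<close>.
  Its integer part is coded by \<open>p\<close>, and its fractional part has the digits of \<open>K\<close> in
  the bases \<open>1, \<dots>, n\<close>.
\<close>
fun code :: "(int \<Rightarrow> bool list) \<Rightarrow> nat \<Rightarrow> int \<Rightarrow> bool list" where
  "code p 0 K = p K"
| "code p (Suc n) K = code p n (K div int (Suc n)) @ digit (Suc n) (nat (K mod int (Suc n)))"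

text \<open>
  The \<open>n + 1\<close> parts of an interval. The formula for their indices is the reason why translations
  at different levels are compatible.
\<close>
lemma code_refine:
  assumes "j < Suc n"
  shows "code p (Suc n) (K * int (Suc n) + int j) = code p n K @ digit (Suc n) j"
proof -
  have "(K * int (Suc n) + int j) div int (Suc n) = K"
    using assms by (simp add: div_add1_eq[of "K * int (Suc n)"] del: of_nat_Suc)
  moreover have "(K * int (Suc n) + int j) mod int (Suc n) = int j"
    using assms by (simp del: of_nat_Suc)
  ultimately show ?thesis by (simp del: of_nat_Suc)
qed

lemma code_cover: "\<exists>K' z. p K \<frown> y = code p n K' \<frown> z"
proof (induction n)
  case 0
  show ?case by (metis code.simps(1))
next
  case (Suc n)
  then obtain K' z where z: "p K \<frown> y = code p n K' \<frown> z" by blast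
  obtain j x where "j < Suc n" "z = digit (Suc n) j \<frown> x" using digit_exists[of "Suc n" z] by blast
  then have "p K \<frown> y = code p (Suc n) (K' * int (Suc n) + int j) \<frown> x"
    unfolding code_refine[OF \<open>j < Suc n\<close>] z by simp
  then show ?case by blast
qed

lemma code_range: "\<exists>K' z. code p n K \<frown> y = p K' \<frown> z"
proof (induction n arbitrary: K y)
  case (Suc n)
  then show ?case by (simp flip: conc_conc)
qed auto

text \<open>
  What translation of indices needs of a code: the word determines the tail, and it determines the index up to
  indices that cannot be told apart even after a shift. Prefix codes have this property, and so does the
  constant code, which forgets the integer part.
\<close>
definition shiftable :: "(int \<Rightarrow> bool list) \<Rightarrow> bool" where
  "shiftable p \<longleftrightarrow> (\<forall>K K' x y. p K \<frown> x = p K' \<frown> y \<longrightarrow> x = y \<and> (\<forall>a. p (K + a) = p (K' + a)))"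

lemma shiftableD:
  assumes "shiftable p" "p K \<frown> x = p K' \<frown> y"
  shows "x = y" "p (K + a) = p (K' + a)"
  using assms unfolding shiftable_def by blast+

lemma shiftable_code:
  assumes "shiftable p"
  shows "shiftable (code p n)"
proof (induction n)
  case 0
  have "code p 0 = p" by (rule ext) simp
  then show ?case using assms by simp
next
  case (Suc n)
  let ?s = "int (Suc n)"
  show ?case unfolding shiftable_def
  proof (intro allI impI)
    fix K K' x y assume "code p (Suc n) K \<frown> x = code p (Suc n) K' \<frown> y"
    then have "code p n (K div ?s) \<frown> digit (Suc n) (nat (K mod ?s)) \<frown> x =
        code p n (K' div ?s) \<frown> digit (Suc n) (nat (K' mod ?s)) \<frown> y"
      by (simp only: code.simps conc_conc)
    then have d: "digit (Suc n) (nat (K mod ?s)) \<frown> x = digit (Suc n) (nat (K' mod ?s)) \<frown> y"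
      and sh: "\<And>a. code p n (K div ?s + a) = code p n (K' div ?s + a)"
      by (rule shiftableD[OF Suc])+
    have lt: "nat (k mod ?s) < Suc n" for k by (simp add: nat_less_iff del: of_nat_Suc)
    have "nat (K mod ?s) = nat (K' mod ?s)" and xy: "x = y"
      using digit_inject[OF lt lt d] by auto
    then have r: "K mod ?s = K' mod ?s"
      using pos_mod_sign[of ?s K] pos_mod_sign[of ?s K'] by (simp add: eq_nat_nat_iff del: of_nat_Suc)
    have "code p (Suc n) (K + a) = code p (Suc n) (K' + a)" for a
    proof -
      have dv: "(k + a) div ?s = k div ?s + (k mod ?s + a) div ?s" for k
      proof -
        have eq: "k + a = (k mod ?s + a) + k div ?s * ?s" by (simp add: algebra_simps del: of_nat_Suc)
        show ?thesis unfolding eq by (rule div_mult_self1) (simp del: of_nat_Suc)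
      qed
      have "(K + a) mod ?s = (K' + a) mod ?s" using r by (rule mod_add_cong) simp
      then show ?thesis by (simp only: code.simps dv[of K] dv[of K'] sh r)
    qed
    then show "x = y \<and> (\<forall>a. code p (Suc n) (K + a) = code p (Suc n) (K' + a))" using xy by blast
  qed
qed

text \<open>
  Both the integer part and the digits are written in increasing order.
\<close>
lemma code_before:
  assumes "\<And>K K'. K < K' \<Longrightarrow> before (p K) (p K')" and "K < K'"
  shows "before (code p n K) (code p n K')"
  using assms(2)
proof (induction n arbitrary: K K')
  case 0
  then show ?case using assms(1) by simp
next
  case (Suc n)
  let ?s = "int (Suc n)"
  have "K div ?s \<le> K' div ?s" using Suc.prems by (intro zdiv_mono1) auto
  then consider "K div ?s < K' div ?s" | "K div ?s = K' div ?s" "K mod ?s < K' mod ?s"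
    using Suc.prems by (smt (verit) mult_div_mod_eq)
  then show ?case
  proof cases
    case 1
    then show ?thesis using Suc.IH before_append by (simp del: of_nat_Suc)
  next
    case 2
    have "nat (K mod ?s) < nat (K' mod ?s)"
      using 2(2) pos_mod_sign[of ?s K] by (subst nat_mono_iff) (linarith, assumption)
    moreover have "nat (K' mod ?s) < Suc n" by (simp add: nat_less_iff del: of_nat_Suc)
    ultimately show ?thesis using 2(1) by (simp add: before_append_same digit_before del: of_nat_Suc)
  qed
qed

section \<open>Translating indices\<close>

text \<open>
  A word has a representation at every level \<open>n\<close>, so adding \<open>q\<close> to the number that
  is coded is first only a relation.
\<close>
definition translates :: "(int \<Rightarrow> bool list) \<Rightarrow> rat \<Rightarrow> cantor \<Rightarrow> cantor \<Rightarrow> bool" where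
  "translates p q w w' \<longleftrightarrow>
     (\<exists>n K a y. q * fact n = of_int a \<and> w = code p n K \<frown> y \<and> w' = code p n (K + a) \<frown> y)"

definition translate :: "(int \<Rightarrow> bool list) \<Rightarrow> rat \<Rightarrow> cantor \<Rightarrow> cantor" where
  "translate p q w = (if \<exists>w'. translates p q w w' then SOME w'. translates p q w w' else w)"

definition domain_of :: "(int \<Rightarrow> bool list) \<Rightarrow> cantor set" where
  "domain_of p = {p K \<frown> y | K y. True}"

lemma fact_clears_denominator: "\<exists>n0. \<forall>n\<ge>n0. \<exists>a. (q::rat) * fact n = of_int a"
proof -
  obtain c d :: int where q: "q = of_int c / of_int d" "d > 0"
    by (cases q) (auto simp: Fract_of_int_quotient)
  have "\<exists>a. q * fact n = of_int a" if n: "n \<ge> nat d" for n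
  proof -
    have "nat d dvd fact n" using n q(2) by (intro dvd_fact) auto
    then obtain e where e: "fact n = nat d * e" by (auto elim: dvdE)
    have "(fact n :: rat) = of_nat (fact n)" by simp
    also have "\<dots> = of_int d * of_nat e" unfolding e using q(2) by simp
    finally have "q * fact n = of_int (c * int e)" using q by simp
    then show ?thesis by blast
  qed
  then show ?thesis by blast
qed

lemma translates_refine:
  fixes q :: rat
  assumes q: "q * fact n = of_int a"
  shows "\<exists>K' a' z. q * fact (Suc n) = of_int a' \<and> code p n K \<frown> y = code p (Suc n) K' \<frown> z \<and>
    code p n (K + a) \<frown> y = code p (Suc n) (K' + a') \<frown> z"
proof -
  obtain j z where j: "j < Suc n" "y = digit (Suc n) j \<frown> z" using digit_exists[of "Suc n" y] by blast
  have "q * fact (Suc n) = (q * fact n) * of_nat (Suc n)" by (simp only: fact_Suc of_nat_mult mult_ac)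
  also have "\<dots> = of_int (a * int (Suc n))" unfolding q by simp
  finally have "q * fact (Suc n) = of_int (a * int (Suc n))" .
  moreover have "code p n k \<frown> y = code p (Suc n) (k * int (Suc n) + int j) \<frown> z" for k
    by (simp only: code_refine[OF j(1)] j(2) conc_conc)
  moreover have "(K + a) * int (Suc n) + int j = K * int (Suc n) + int j + a * int (Suc n)"
    by (simp add: algebra_simps)
  ultimately show ?thesis by metis
qed

lemma translates_level:
  fixes q :: rat
  assumes "n0 \<le> n" "q * fact n0 = of_int a"
  shows "\<exists>K' a' z. q * fact n = of_int a' \<and> code p n0 K \<frown> y = code p n K' \<frown> z \<and>
    code p n0 (K + a) \<frown> y = code p n (K' + a') \<frown> z"
  using assms(1)
proof (induction n rule: dec_induct)
  case base
  then show ?case using assms(2) by blast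
next
  case (step n)
  then obtain K' a' z where *: "q * fact n = of_int a'" "code p n0 K \<frown> y = code p n K' \<frown> z"
    "code p n0 (K + a) \<frown> y = code p n (K' + a') \<frown> z" by blast
  show ?case using translates_refine[OF *(1), of p K' z] unfolding *(2,3) .
qed

context
  fixes p :: "int \<Rightarrow> bool list"
  assumes p: "shiftable p"
begin

text \<open>
  Two representations of a word can be compared at the larger of their levels.
\<close>
lemma translates_functional:
  assumes "translates p q w w1" "translates p q w w2"
  shows "w1 = w2"
proof -
  obtain n K a y where 1: "q * fact n = of_int a" "w = code p n K \<frown> y" "w1 = code p n (K + a) \<frown> y"
    using assms(1) unfolding translates_def by blast
  obtain m L b z where 2: "q * fact m = of_int b" "w = code p m L \<frown> z" "w2 = code p m (L + b) \<frown> z"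
    using assms(2) unfolding translates_def by blast
  let ?N = "max n m"
  obtain K' a' y' where 3: "q * fact ?N = of_int a'" "w = code p ?N K' \<frown> y'" "w1 = code p ?N (K' + a') \<frown> y'"
    using translates_level[OF _ 1(1), of ?N p K y] unfolding 1 by auto
  obtain L' b' z' where 4: "q * fact ?N = of_int b'" "w = code p ?N L' \<frown> z'" "w2 = code p ?N (L' + b') \<frown> z'"
    using translates_level[OF _ 2(1), of ?N p L z] unfolding 2 by auto
  have "a' = b'" using 3(1) 4(1) by simp
  moreover have eq: "code p ?N K' \<frown> y' = code p ?N L' \<frown> z'" using 3(2) 4(2) by simp
  ultimately show ?thesis
    using 3(3) 4(3) shiftableD[OF shiftable_code[OF p] eq] by metis
qed

lemma translate_code:
  assumes "q * fact n = of_int a"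
  shows "translate p q (code p n K \<frown> y) = code p n (K + a) \<frown> y"
proof -
  have t: "translates p q (code p n K \<frown> y) (code p n (K + a) \<frown> y)"
    unfolding translates_def using assms by blast
  then have "translates p q (code p n K \<frown> y) (SOME w'. translates p q (code p n K \<frown> y) w')"
    by (rule someI[where P = "translates p q (code p n K \<frown> y)"])
  with t have "(SOME w'. translates p q (code p n K \<frown> y) w') = code p n (K + a) \<frown> y"
    using translates_functional by blast
  with t show ?thesis unfolding translate_def by auto
qed

lemma translate_outside:
  assumes "w \<notin> domain_of p"
  shows "translate p q w = w"
proof -
  have "\<not> translates p q w w'" for w'
    using assms code_range[of p] unfolding translates_def domain_of_def by blast
  then show ?thesis by (simp add: translate_def)
qed

lemma domain_code:
  assumes "w \<in> domain_of p"
  obtains n K a y where "(q::rat) * fact n = of_int a" "w = code p n K \<frown> y"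
proof -
  obtain n a where "q * fact n = of_int a" using fact_clears_denominator[of q] by blast
  moreover obtain K y where "w = code p n K \<frown> y"
    using assms code_cover[of p _ _ n] unfolding domain_of_def by blast
  ultimately show ?thesis by (rule that)
qed

lemma domain_code2:
  assumes "w \<in> domain_of p"
  obtains n K a b y where "(q::rat) * fact n = of_int a" "(r::rat) * fact n = of_int b" "w = code p n K \<frown> y"
proof -
  obtain n1 n2 where "\<forall>n\<ge>n1. \<exists>a. q * fact n = of_int a" "\<forall>n\<ge>n2. \<exists>b. r * fact n = of_int b"
    using fact_clears_denominator[of q] fact_clears_denominator[of r] by blast
  then obtain a b where "q * fact (max n1 n2) = of_int a" "r * fact (max n1 n2) = of_int b"
    by (meson max.cobounded1 max.cobounded2)
  moreover obtain K y where "w = code p (max n1 n2) K \<frown> y"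
    using assms code_cover[of p _ _ "max n1 n2"] unfolding domain_of_def by blast
  ultimately show ?thesis by (rule that)
qed

lemma code_in_domain: "code p n K \<frown> y \<in> domain_of p"
  using code_range[of p n K y] unfolding domain_of_def by blast

lemma translate_in_domain: "w \<in> domain_of p \<Longrightarrow> translate p q w \<in> domain_of p"
  by (metis domain_code code_in_domain translate_code)

lemma translate_add: "translate p (q + r) w = translate p q (translate p r w)"
proof (cases "w \<in> domain_of p")
  case True
  then obtain n K a b y where n: "q * fact n = of_int a" "r * fact n = of_int b" "w = code p n K \<frown> y"
    by (rule domain_code2)
  have "(q + r) * fact n = of_int (b + a)" using n by (simp add: algebra_simps)
  then show ?thesis by (simp only: n(3) translate_code n(1,2) add.assoc)
next
  case False
  then show ?thesis by (simp add: translate_outside)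
qed

lemma translate_0 [simp]: "translate p 0 w = w"
proof (cases "w \<in> domain_of p")
  case True
  then obtain n K a y where n: "0 * fact n = (of_int a :: rat)" "w = code p n K \<frown> y"
    by (rule domain_code)
  then show ?thesis using translate_code[OF n(1)] by simp
next
  case False
  then show ?thesis by (rule translate_outside)
qed

text \<open>
  Translation acts freely, apart from the elements that act trivially: a shift that goes unnoticed at one
  index goes unnoticed at all others by \<open>shiftable\<close>.
\<close>
lemma translate_fixed_point:
  assumes w: "w \<in> domain_of p" "translate p q w = w"
  shows "translate p q x = x"
proof (cases "x \<in> domain_of p")
  case True
  obtain n a where n: "q * fact n = of_int a" using fact_clears_denominator[of q] by blast
  obtain K y where K: "w = code p n K \<frown> y"
    using w(1) code_cover[of p _ _ n] unfolding domain_of_def by blast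
  obtain L z where L: "x = code p n L \<frown> z"
    using True code_cover[of p _ _ n] unfolding domain_of_def by blast
  have "code p n (K + a) \<frown> y = code p n K \<frown> y" using w(2) translate_code[OF n] K by simp
  from shiftableD(2)[OF shiftable_code[OF p] this, of "L - K"]
  have "code p n (L + a) = code p n L" by (simp add: algebra_simps)
  then show ?thesis using translate_code[OF n] L by simp
qed (rule translate_outside)

lemma translate_local:
  assumes "w \<in> domain_of p"
  shows "\<exists>\<alpha> \<beta>. w \<in> range (conc \<alpha>) \<and> (\<forall>y. translate p q (\<alpha> \<frown> y) = \<beta> \<frown> y)"
  using assms by (rule domain_code[of _ q]) (blast intro: translate_code)

lemma translate_less:
  assumes incr: "\<And>K K'. K < K' \<Longrightarrow> before (p K) (p K')"
    and w: "w \<in> domain_of p" "w' \<in> domain_of p" "w \<prec>\<^sub>L w'"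
  shows "translate p q w \<prec>\<^sub>L translate p q w'"
proof -
  obtain n a where n: "q * fact n = of_int a" using fact_clears_denominator[of q] by blast
  obtain K y where K: "w = code p n K \<frown> y"
    using w(1) code_cover[of p _ _ n] unfolding domain_of_def by blast
  obtain L z where L: "w' = code p n L \<frown> z"
    using w(2) code_cover[of p _ _ n] unfolding domain_of_def by blast
  have bef: "code p n i \<frown> u \<prec>\<^sub>L code p n j \<frown> v" if "i < j" for i j u v
    using code_before[where p = p, OF incr that] unfolding before_def by blast
  consider "K < L" | "K = L" | "L < K" by linarith
  then show ?thesis
  proof cases
    case 1
    then show ?thesis using bef[of "K + a" "L + a" y z] by (simp add: K L translate_code[OF n])
  next
    case 2
    then show ?thesis using w(3) by (simp add: K L translate_code[OF n])
  next
    case 3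
    then have "w' \<prec>\<^sub>L w" using bef[of L K z y] by (simp add: K L)
    then show ?thesis using w(3) less_fun_asym by blast
  qed
qed

end

section \<open>Rotations of the Cantor set\<close>

text \<open>
  Without an integer part there are \<open>n!\<close> intervals at level \<open>n\<close>, cyclically
  permuted.
\<close>
definition rotate :: "rat \<Rightarrow> cantor \<Rightarrow> cantor" where
  "rotate = translate (\<lambda>_. [])"

lemma shiftable_Nil: "shiftable (\<lambda>_. [])"
  by (simp add: shiftable_def)

lemma domain_Nil [simp]: "domain_of (\<lambda>_. []) = UNIV"
  by (auto simp: domain_of_def)

lemma digits_inject:
  assumes "code (\<lambda>_. []) n K \<frown> x = code (\<lambda>_. []) n K' \<frown> y"
  shows "K mod fact n = K' mod fact n"
  using assms
proof (induction n arbitrary: K K' x y)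
  case (Suc n)
  let ?s = "int (Suc n)" and ?c = "code (\<lambda>_. []) n"
  have eq: "?c (K div ?s) \<frown> digit (Suc n) (nat (K mod ?s)) \<frown> x =
      ?c (K' div ?s) \<frown> digit (Suc n) (nat (K' mod ?s)) \<frown> y"
    using Suc.prems by (simp only: code.simps conc_conc)
  have lt: "nat (k mod ?s) < Suc n" for k by (simp add: nat_less_iff del: of_nat_Suc)
  have "nat (K mod ?s) = nat (K' mod ?s)"
    by (rule digit_inject[OF lt lt shiftableD(1)[OF shiftable_code[OF shiftable_Nil] eq]])
  then have "K mod ?s = K' mod ?s"
    using pos_mod_sign[of ?s K] pos_mod_sign[of ?s K'] by (simp add: eq_nat_nat_iff del: of_nat_Suc)
  moreover have "K div ?s mod fact n = K' div ?s mod fact n" by (rule Suc.IH[OF eq])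
  moreover have "k mod fact (Suc n) = ?s * (k div ?s mod fact n) + k mod ?s" for k :: int
    using zmod_zmult2_eq[of "fact n" k ?s] by (simp del: of_nat_Suc add: fact_Suc)
  ultimately show ?case by simp
qed simp

lemma digits_periodic: "code (\<lambda>_. []) n (K + m * fact n) = code (\<lambda>_. []) n K"
proof (induction n arbitrary: K)
  case (Suc n)
  let ?s = "int (Suc n)"
  have e: "K + m * fact (Suc n) = K + (m * fact n) * ?s" by (simp add: fact_Suc algebra_simps)
  have "(K + (m * fact n) * ?s) div ?s = K div ?s + m * fact n"
    by (subst div_mult_self1) (simp_all del: of_nat_Suc)
  then show ?case unfolding e code.simps using Suc[of "K div ?s"] by (simp del: of_nat_Suc add: add.commute)
qed simp

lemma rotate_id_iff: "rotate q = id \<longleftrightarrow> q \<in> \<int>"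
proof
  obtain n a where n: "q * fact n = of_int a" using fact_clears_denominator[of q] by blast
  have r: "rotate q (code (\<lambda>_. []) n K \<frown> y) = code (\<lambda>_. []) n (K + a) \<frown> y" for K y
    unfolding rotate_def by (rule translate_code[OF shiftable_Nil n])
  {
    assume "rotate q = id"
    then have "a mod fact n = 0 mod fact n" using digits_inject[of n a _ 0] r[of 0] by simp
    then obtain m where "a = fact n * m" by (auto elim: dvdE simp: mod_eq_0_iff_dvd)
    then have "q * fact n = of_int m * fact n" using n by simp
    then show "q \<in> \<int>" by simp
  next
    assume "q \<in> \<int>"
    then obtain m where "q = of_int m" by (auto elim: Ints_cases)
    then have "q * fact n = of_int (m * fact n)" by simp
    then have a: "a = m * fact n" using n by (metis of_int_eq_iff)
    show "rotate q = id"
    proof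
      fix w
      obtain K y where "w = code (\<lambda>_. []) n K \<frown> y" using code_cover[of "\<lambda>_. []" 0 w n] by auto
      then show "rotate q w = id w" using r digits_periodic a by simp
    qed
  }
qed

lemma rotate_add: "rotate (q + r) w = rotate q (rotate r w)"
  unfolding rotate_def by (rule translate_add[OF shiftable_Nil])

section \<open>Translations of the line\<close>

text \<open>
  The complete prefix code \<open>\<dots>, 001, 01, 10, 110, \<dots>\<close> of the words that are not
  constant, in increasing order.
\<close>
definition line_code :: "int \<Rightarrow> bool list" where
  "line_code m = (if m < 0 then replicate (nat (- m)) False @ [True] else replicate (nat m + 1) True @ [False])"

definition line :: "rat \<Rightarrow> cantor \<Rightarrow> cantor" where
  "line = translate line_code"

lemma before_replicate: "n < m \<Longrightarrow> before (replicate n True @ [False]) (replicate m True @ \<alpha>)"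
  "n < m \<Longrightarrow> before (replicate m False @ \<alpha>) (replicate n False @ [True])"
proof -
  have *: "\<exists>\<gamma>. replicate m c @ \<alpha> = replicate n c @ c # \<gamma>" if lt: "n < m" for c :: bool
  proof -
    obtain k where "m = n + Suc k" using less_imp_Suc_add[OF lt] by auto
    then show ?thesis by (simp add: replicate_add replicate_app_Cons_same)
  qed
  show "n < m \<Longrightarrow> before (replicate n True @ [False]) (replicate m True @ \<alpha>)"
    using *[of True] by (auto intro!: before_append_same before_first)
  show "n < m \<Longrightarrow> before (replicate m False @ \<alpha>) (replicate n False @ [True])"
    using *[of False] by (auto intro!: before_append_same before_first)
qed

lemma line_code_before:
  assumes "K < K'" shows "before (line_code K) (line_code K')"
proof -
  consider "K' < 0" | "K < 0" "0 \<le> K'" | "0 \<le> K" by linarith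
  then show ?thesis
  proof cases
    case 1
    then show ?thesis using assms by (simp add: line_code_def before_replicate)
  next
    case 2
    then obtain i j where "nat (- K) = Suc i" "nat K' + 1 = Suc j" by (metis Suc_eq_plus1 gr0_conv_Suc neg_0_less_iff_less zero_less_nat_eq)
    then show ?thesis using 2 by (simp add: line_code_def before_first)
  next
    case 3
    then show ?thesis using assms before_replicate(1)[of "nat K + 1" "nat K' + 1" "[False]"]
      by (simp add: line_code_def)
  qed
qed

lemma shiftable_line_code: "shiftable line_code"
  unfolding shiftable_def using before_tails[of line_code, OF line_code_before] by blast

lemma constant_or_line:
  obtains "w = (\<lambda>_. False)" | "w = (\<lambda>_. True)" | K y where "w = line_code K \<frown> y"
proof (cases "\<exists>i. w i \<noteq> w 0")
  case False
  then have "w = (\<lambda>_. w 0)" by auto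
  then show ?thesis using that(1,2) by (cases "w 0") auto
next
  case True
  define n where "n = (LEAST i. w i \<noteq> w 0)"
  have n: "w n \<noteq> w 0" using LeastI_ex[OF True] by (simp add: n_def)
  have le: "w i = w 0" if "i < n" for i using not_less_Least that unfolding n_def by blast
  have n0: "n > 0" using n by (cases n) auto
  have w: "w = (replicate n (w 0) @ [\<not> w 0]) \<frown> (\<lambda>i. w (Suc n + i))"
  proof
    fix i
    consider "i < n" | "i = n" | "n < i" by linarith
    then show "w i = ((replicate n (w 0) @ [\<not> w 0]) \<frown> (\<lambda>i. w (Suc n + i))) i"
    proof cases
      case 1
      then show ?thesis using le[of i] by (simp add: conc_def nth_append)
    next
      case 2
      then show ?thesis using n by (simp add: conc_def nth_append)
    next
      case 3
      then show ?thesis by (simp add: conc_def)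
    qed
  qed
  have "replicate n (w 0) @ [\<not> w 0] = line_code (if w 0 then int n - 1 else - int n)"
    using gr0_implies_Suc[OF n0] by (auto simp: line_code_def)
  then show ?thesis using w that(3) by metis
qed

lemma line_code_not_const: "line_code K \<frown> y \<noteq> (\<lambda>_. c)"
proof
  assume e: "line_code K \<frown> y = (\<lambda>_. c)"
  define n where "n = length (line_code K) - 1"
  have "line_code K ! 0 \<noteq> line_code K ! n" "n < length (line_code K)" by (auto simp: n_def line_code_def nth_append)
  then show False using fun_cong[OF e, of 0] fun_cong[OF e, of n] by (simp add: conc_def split: if_splits)
qed

lemma domain_line_code: "w \<in> domain_of line_code \<longleftrightarrow> w \<noteq> (\<lambda>_. False) \<and> w \<noteq> (\<lambda>_. True)"
proof -
  have *: "(\<lambda>_. c) \<noteq> line_code K \<frown> y" for c K y using line_code_not_const by metis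
  show ?thesis
    by (rule constant_or_line[of w]) (auto simp: domain_of_def * line_code_not_const)
qed

lemma line_const [simp]: "line q (\<lambda>_. c) = (\<lambda>_. c)"
  unfolding line_def by (rule translate_outside[OF shiftable_line_code]) (cases c; simp add: domain_line_code)

lemma line_add: "line (q + r) w = line q (line r w)"
  unfolding line_def by (rule translate_add[OF shiftable_line_code])

lemma line_0 [simp]: "line 0 w = w"
  unfolding line_def by (rule translate_0[OF shiftable_line_code])

lemma line_int: "line (of_int a) (line_code K \<frown> y) = line_code (K + a) \<frown> y"
  unfolding line_def using translate_code[OF shiftable_line_code, of "of_int a" 0 a K y] by simp

section \<open>The ends of the line\<close>

lemma range_replicate_iff: "x \<in> range (conc (replicate k c)) \<longleftrightarrow> (\<forall>i<k. x i = c)"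
proof
  assume "\<forall>i<k. x i = c"
  then have "x = replicate k c \<frown> (\<lambda>i. x (k + i))" by (intro ext) (auto simp: conc_def)
  then show "x \<in> range (conc (replicate k c))" by blast
qed auto

text \<open>
  If \<open>K\<close> lies on the side of \<open>c\<close>, its code begins with exactly as many letters
  \<open>c\<close> as the right-hand side says. The two ends differ by one because \<open>01\<close> has the
  index \<open>-1\<close> and \<open>10\<close> the index \<open>0\<close>.
\<close>
lemma line_code_prefix_iff:
  assumes "0 < k"
  shows "line_code K \<frown> y \<in> range (conc (replicate k c)) \<longleftrightarrow> int k \<le> (if c then K + 1 else - K)"
proof -
  define d n where "d \<longleftrightarrow> 0 \<le> K" and "n = (if 0 \<le> K then nat K + 1 else nat (- K))"
  let ?w = "line_code K \<frown> y"
  have "line_code K = replicate n d @ [\<not> d]" by (simp add: line_code_def d_def n_def)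
  then have w: "?w i = d" "?w n \<noteq> d" if "i < n" for i using that by (simp_all add: conc_def nth_append)
  have n: "0 < n" by (simp add: n_def)
  have "(\<forall>i<k. ?w i = c) \<longleftrightarrow> c = d \<and> k \<le> n"
  proof
    assume all: "\<forall>i<k. ?w i = c"
    then have "c = d" using w(1)[OF n] assms by auto
    then show "c = d \<and> k \<le> n" using all w(2)[OF n] by (meson not_le)
  qed (use w(1) in auto)
  also have "\<dots> \<longleftrightarrow> int k \<le> (if c then K + 1 else - K)" using assms by (auto simp: d_def n_def)
  finally show ?thesis unfolding range_replicate_iff .
qed

lemma line_of_line_code: "\<exists>K' y'. line q (line_code K \<frown> y) = line_code K' \<frown> y'"
  using translate_in_domain[OF shiftable_line_code, of "line_code K \<frown> y" q]
  unfolding domain_of_def line_def by blast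

lemma line_less: "w \<prec>\<^sub>L w' \<Longrightarrow> line q w \<prec>\<^sub>L line q w'"
proof -
  assume less: "w \<prec>\<^sub>L w'"
  have F: "(\<lambda>_. False) \<prec>\<^sub>L x" if "x \<noteq> (\<lambda>_. False)" for x
  proof -
    have "\<not> x \<prec>\<^sub>L (\<lambda>_. False)" by (simp add: less_fun_def)
    then show ?thesis using that word_less_cases[of x "\<lambda>_. False"] by blast
  qed
  have T: "x \<prec>\<^sub>L (\<lambda>_. True)" if "x \<noteq> (\<lambda>_. True)" for x
  proof -
    have "\<not> (\<lambda>_. True) \<prec>\<^sub>L x" by (simp add: less_fun_def)
    then show ?thesis using that word_less_cases[of x "\<lambda>_. True"] by blast
  qed
  have ne: "w \<noteq> w'" using less less_fun_irrefl by blast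
  have inj: "line q x = line q y \<Longrightarrow> x = y" for x y
    using line_add[of "- q" q x] line_add[of "- q" q y] by simp
  then have ne': "line q w \<noteq> line q w'" using ne by blast
  consider "w = (\<lambda>_. False)" | "w' = (\<lambda>_. True)" | "w \<in> domain_of line_code" "w' \<in> domain_of line_code"
    using less F T less_fun_asym ne unfolding domain_line_code by metis
  then show ?thesis
  proof cases
    case 1
    then show ?thesis using F[of "line q w'"] ne' by simp
  next
    case 2
    then show ?thesis using T[of "line q w"] ne' by simp
  next
    case 3
    then show ?thesis unfolding line_def
      by (intro translate_less[OF shiftable_line_code line_code_before] less)
  qed
qed

text \<open>
  Continuity at the ends of the line. As \<open>line q\<close> is increasing, the words that it sends beyond a
  given word are those beyond the image of that word under \<open>line (- q)\<close>.
\<close>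
lemma line_near_const: "\<exists>k. \<forall>y. \<exists>z. line q (replicate k c \<frown> y) = replicate n c \<frown> z"
proof -
  \<comment> \<open>the index of an interval so close to the end that its words begin with \<open>n\<close> letters \<open>c\<close>\<close>
  let ?K = "if c then int n else - int n - 1"
  obtain M x0 where M: "line (- q) (line_code ?K \<frown> (\<lambda>_. c)) = line_code M \<frown> x0" using line_of_line_code by blast
  have bk: "line q (line_code M \<frown> x0) = line_code ?K \<frown> (\<lambda>_. c)"
    unfolding M[symmetric] using line_add[of q "- q"] by simp
  \<comment> \<open>words with \<open>k\<close> equal letters have indices beyond \<open>M\<close>, on the side of \<open>c\<close>\<close>
  define k where "k = nat \<bar>M\<bar> + 2"
  have "\<exists>z. line q (replicate k c \<frown> y) = replicate n c \<frown> z" for y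
  proof (cases "n = 0")
    case True
    then show ?thesis by simp
  next
    case n: False
    show ?thesis
    proof (cases rule: constant_or_line[of "replicate k c \<frown> y"])
      case (3 K x)
      obtain K' x' where K': "line q (line_code K \<frown> x) = line_code K' \<frown> x'" using line_of_line_code by blast
      have "0 < k" by (simp add: k_def)
      then have K: "int k \<le> (if c then K + 1 else - K)" using line_code_prefix_iff[of k K x c] 3 by (metis rangeI)
      have "int n \<le> (if c then K' + 1 else - K')"
      proof (cases c)
        case True
        then have "M < K" using K by (simp add: k_def)
        then have "line_code M \<frown> x0 \<prec>\<^sub>L line_code K \<frown> x" using line_code_before unfolding before_def by blast
        then have "line_code ?K \<frown> (\<lambda>_. c) \<prec>\<^sub>L line_code K' \<frown> x'"
          using line_less bk K' by metis
        then have "\<not> K' < ?K" using line_code_before less_fun_asym unfolding before_def by blast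
        then show ?thesis using True by simp
      next
        case False
        then have "K < M" using K by (simp add: k_def)
        then have "line_code K \<frown> x \<prec>\<^sub>L line_code M \<frown> x0" using line_code_before unfolding before_def by blast
        then have "line_code K' \<frown> x' \<prec>\<^sub>L line_code ?K \<frown> (\<lambda>_. c)"
          using line_less bk K' by metis
        then have "\<not> ?K < K'" using line_code_before less_fun_asym unfolding before_def by blast
        then show ?thesis using False by simp
      qed
      then show ?thesis using line_code_prefix_iff[of n K' x' c] n K' 3 by auto
    next
      case 1
      have "(replicate k c \<frown> y) 0 = c" by (simp add: k_def conc_def)
      then have "\<not> c" unfolding 1 by simp
      then have "line q (replicate k c \<frown> y) = replicate n c \<frown> (\<lambda>_. False)"
        using 1 conc_const[of n False] by simp
      then show ?thesis by blast
    next
      case 2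
      have "(replicate k c \<frown> y) 0 = c" by (simp add: k_def conc_def)
      then have "c" unfolding 2 by simp
      then have "line q (replicate k c \<frown> y) = replicate n c \<frown> (\<lambda>_. True)"
        using 2 conc_const[of n True] by simp
      then show ?thesis by blast
    qed
  qed
  then show ?thesis by blast
qed

text \<open>
  Near the ends of the line, deleting the first letter is translation by an integer.
\<close>
lemma line_unit_shift: "line (if c then -1 else 1) ([c, c] \<frown> x) = [c] \<frown> x"
proof (cases rule: constant_or_line[of "[c, c] \<frown> x"])
  case (3 K y)
  have "replicate 2 c \<frown> x = line_code K \<frown> y" using 3 by (simp add: numeral_2_eq_2)
  then have K: "2 \<le> (if c then K + 1 else - K)" using line_code_prefix_iff[of 2 K y c] by (metis rangeI of_nat_numeral zero_less_numeral)
  have "nat K = Suc (nat (K - 1))" if c using K that by simp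
  moreover have "nat (- K) = Suc (nat (- (K + 1)))" if "\<not> c" using K that by simp
  ultimately have "line_code K = c # line_code (if c then K - 1 else K + 1)" using K by (cases c) (simp_all add: line_code_def)
  then have "[c] \<frown> [c] \<frown> x = [c] \<frown> line_code (if c then K - 1 else K + 1) \<frown> y" using 3 by simp
  then have e: "[c] \<frown> x = line_code (if c then K - 1 else K + 1) \<frown> y" by (simp only: conc_inject)
  have "line (if c then -1 else 1) (line_code K \<frown> y) = line_code (if c then K - 1 else K + 1) \<frown> y"
    using line_int[of 1 K y] line_int[of "-1" K y] by simp
  then show ?thesis using 3 e by simp
next
  case 1
  have "c = False" using fun_cong[OF 1, of 0] by (simp add: conc_def)
  then have "[c] \<frown> [c] \<frown> x = [c] \<frown> (\<lambda>_. False)" using 1 conc_const[of 1 False] by (simp del: build_cons)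
  then have "[c] \<frown> x = (\<lambda>_. False)" by (simp only: conc_inject)
  then show ?thesis using 1 by simp
next
  case 2
  have "c = True" using fun_cong[OF 2, of 0] by (simp add: conc_def)
  then have "[c] \<frown> [c] \<frown> x = [c] \<frown> (\<lambda>_. True)" using 2 conc_const[of 1 True] by (simp del: build_cons)
  then have "[c] \<frown> x = (\<lambda>_. True)" by (simp only: conc_inject)
  then show ?thesis using 2 by simp
qed

text \<open>
  Deleting one letter \<open>c\<close> after \<open>\<gamma>\<close> is the map \<open>L\<close> at the word
  \<open>\<gamma>ccc\<dots>\<close>. So \<open>f\<close> fixes this word and commutes with \<open>L\<close>
  near it, on a neighborhood determined by \<open>k\<close>. This form applies to both ends and transfers to
  the circle.
\<close>
definition self_similar :: "(cantor \<Rightarrow> cantor) \<Rightarrow> bool list \<Rightarrow> bool \<Rightarrow> bool" where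
  "self_similar f \<gamma> c \<longleftrightarrow> (\<exists>k. \<forall>y. \<exists>z.
     f (\<gamma> \<frown> replicate (Suc k) c \<frown> y) = \<gamma> \<frown> [c] \<frown> z \<and> f (\<gamma> \<frown> replicate k c \<frown> y) = \<gamma> \<frown> z)"

text \<open>
  By \<open>line_unit_shift\<close> this says that translations commute, once \<open>line_near_const\<close>
  keeps the image of the word so close to the end that deleting a letter is a translation there, too.
\<close>
lemma self_similar_line: "self_similar (line q) [] c"
proof -
  obtain k where k: "\<And>y. \<exists>z. line q (replicate k c \<frown> y) = replicate 2 c \<frown> z"
    using line_near_const by blast
  let ?e = "if c then -1 else 1 :: rat"
  have "\<exists>z. line q (replicate (Suc (Suc k)) c \<frown> y) = [c] \<frown> z \<and> line q (replicate (Suc k) c \<frown> y) = z" for y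
  proof -
    have rep: "replicate (Suc (Suc k)) c \<frown> y = [c, c] \<frown> replicate k c \<frown> y"
      "replicate (Suc k) c \<frown> y = [c] \<frown> replicate k c \<frown> y" by simp_all
    have "replicate (Suc (Suc k)) c \<frown> y = replicate k c \<frown> [c, c] \<frown> y"
      using replicate_add[of k 2 c] by (simp only: conc_conc numeral_2_eq_2 replicate.simps add_Suc_right add_0_right)
    then obtain z where z: "line q (replicate (Suc (Suc k)) c \<frown> y) = [c, c] \<frown> z"
      using k[of "[c, c] \<frown> y"] by (auto simp only: numeral_2_eq_2 replicate.simps)
    have "line q (replicate (Suc k) c \<frown> y) = line q (line ?e (replicate (Suc (Suc k)) c \<frown> y))"
      unfolding rep line_unit_shift ..
    also have "\<dots> = line ?e (line q (replicate (Suc (Suc k)) c \<frown> y))"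
      using line_add[of q ?e] line_add[of ?e q] by (simp only: add.commute[of q])
    also have "\<dots> = [c] \<frown> z" unfolding z line_unit_shift ..
    finally show ?thesis using z by simp
  qed
  then show ?thesis unfolding self_similar_def conc_empty by blast
qed

lemma self_similar_id: "(\<And>y. f (\<gamma> \<frown> y) = \<gamma> \<frown> y) \<Longrightarrow> self_similar f \<gamma> c"
  unfolding self_similar_def by (rule exI[of _ 0]) simp

lemma self_similar_embed:
  assumes "self_similar g [] c" "\<And>y. f (\<gamma> \<frown> y) = \<gamma> \<frown> g y"
  shows "self_similar f \<gamma> c"
  using assms(1) unfolding self_similar_def assms(2) conc_empty conc_inject .

text \<open>
  Taking \<open>y\<close> constant gives \<open>z = cz\<close>, which forces \<open>z\<close> to be constant.
\<close>
lemma self_similar_fixed: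
  assumes "self_similar f \<gamma> c"
  shows "f (\<gamma> \<frown> (\<lambda>_. c)) = \<gamma> \<frown> (\<lambda>_. c)"
proof -
  obtain k where "\<forall>y. \<exists>z. f (\<gamma> \<frown> replicate (Suc k) c \<frown> y) = \<gamma> \<frown> [c] \<frown> z \<and> f (\<gamma> \<frown> replicate k c \<frown> y) = \<gamma> \<frown> z"
    using assms unfolding self_similar_def by blast
  then obtain z where z: "f (\<gamma> \<frown> (\<lambda>_. c)) = \<gamma> \<frown> [c] \<frown> z" "f (\<gamma> \<frown> (\<lambda>_. c)) = \<gamma> \<frown> z"
    using conc_const[of k c] conc_const[of "Suc k" c] by metis
  then have cz: "[c] \<frown> z = z" by (metis conc_inject)
  have "z i = c" for i
  proof (induction i)
    case 0
    show ?case using fun_cong[OF cz, of 0] by (simp add: conc_def)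
  next
    case (Suc i)
    then show ?case using fun_cong[OF cz, of "Suc i"] by (simp add: conc_def)
  qed
  then have "z = (\<lambda>_. c)" by auto
  then show ?thesis using z by simp
qed

section \<open>Germs of homeomorphisms of the Cantor set\<close>

definition agree :: "nat \<Rightarrow> cantor \<Rightarrow> cantor \<Rightarrow> bool" where
  "agree n x y \<longleftrightarrow> (\<forall>i<n. x i = y i)"

text \<open>
  The germ of \<open>f\<close> at \<open>w\<close> is a prefix replacement, as for the elements of
  \<open>V\<close>.
\<close>
definition locally_replacement :: "(cantor \<Rightarrow> cantor) \<Rightarrow> cantor \<Rightarrow> bool" where
  "locally_replacement f w \<longleftrightarrow> (\<exists>\<alpha> \<beta>. w \<in> range (conc \<alpha>) \<and> (\<forall>y. f (\<alpha> \<frown> y) = \<beta> \<frown> y))"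

lemma agree_conc_iff: "agree (length \<alpha>) x (\<alpha> \<frown> y) \<longleftrightarrow> x \<in> range (conc \<alpha>)"
proof
  assume "agree (length \<alpha>) x (\<alpha> \<frown> y)"
  then have "x = \<alpha> \<frown> (\<lambda>i. x (length \<alpha> + i))" by (intro ext) (auto simp: agree_def conc_def)
  then show "x \<in> range (conc \<alpha>)" by blast
qed (auto simp: agree_def)

lemma agree_conc: "agree (length \<alpha> + n) (\<alpha> \<frown> x) (\<alpha> \<frown> y) \<longleftrightarrow> agree n x y"
proof
  assume a: "agree (length \<alpha> + n) (\<alpha> \<frown> x) (\<alpha> \<frown> y)"
  show "agree n x y" unfolding agree_def
  proof (intro allI impI)
    fix i assume "i < n"
    then have "(\<alpha> \<frown> x) (length \<alpha> + i) = (\<alpha> \<frown> y) (length \<alpha> + i)"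
      using a[unfolded agree_def, rule_format, of "length \<alpha> + i"] by (simp del: conc_snd)
    then show "x i = y i" by (simp add: conc_def)
  qed
qed (auto simp: agree_def conc_def)

lemma agree_mono: "agree n x y \<Longrightarrow> m \<le> n \<Longrightarrow> agree m x y"
  by (auto simp: agree_def)

lemma open_agree: "open {x. agree n x y}"
proof -
  have "continuous_on UNIV (\<lambda>x::cantor. x i)" for i by (rule continuous_on_product_coordinates)
  then have "open {x::cantor. x i = y i}" for i
    using continuous_on_open_vimage[of UNIV "\<lambda>x::cantor. x i"] open_discrete[of "{y i}"]
    by (auto simp: vimage_def)
  then have "open (\<Inter>i\<in>{..<n}. {x::cantor. x i = y i})" by (intro open_INT) auto
  moreover have "(\<Inter>i\<in>{..<n}. {x. x i = y i}) = {x. agree n x y}" by (auto simp: agree_def)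
  ultimately show ?thesis by simp
qed

lemma open_range_conc: "open (range (conc \<alpha> :: cantor \<Rightarrow> cantor))"
proof -
  have "range (conc \<alpha>) = {x. agree (length \<alpha>) x (\<alpha> \<frown> undefined)}" using agree_conc_iff by blast
  then show ?thesis by (simp add: open_agree)
qed

lemma eventually_nhds_cylinder:
  assumes "\<And>y. P (\<alpha> \<frown> y)" "w \<in> range (conc \<alpha>)"
  shows "\<forall>\<^sub>F x in nhds (w :: cantor). P x"
  using assms open_range_conc[of \<alpha>] unfolding eventually_nhds by blast

text \<open>
  Continuity at \<open>w\<close> for the product topology, in terms of common prefixes.
\<close>
definition continuous_at_word :: "(cantor \<Rightarrow> cantor) \<Rightarrow> cantor \<Rightarrow> bool" where
  "continuous_at_word f w \<longleftrightarrow> (\<forall>n. \<exists>k. \<forall>x. agree k x w \<longrightarrow> agree n (f x) (f w))"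

lemma continuous_cantorI:
  assumes "\<And>w. continuous_at_word f w"
  shows "continuous_on UNIV (f :: cantor \<Rightarrow> cantor)"
proof (rule continuous_on_coordinatewise_then_product)
  fix i
  show "continuous_on UNIV (\<lambda>x. f x i)"
  proof (subst continuous_on_open_vimage, simp, intro allI impI)
    fix B :: "bool set"
    have "\<exists>T. open T \<and> w \<in> T \<and> T \<subseteq> {x. f x i \<in> B}" if w: "f w i \<in> B" for w
    proof -
      obtain k where k: "\<And>x. agree k x w \<Longrightarrow> agree (Suc i) (f x) (f w)"
        using assms[of w] unfolding continuous_at_word_def by blast
      have "f x i = f w i" if "agree k x w" for x using k[OF that] by (simp add: agree_def)
      then have "{x. agree k x w} \<subseteq> {x. f x i \<in> B}" using w by auto
      moreover have "w \<in> {x. agree k x w}" by (simp add: agree_def)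
      ultimately show ?thesis using open_agree by blast
    qed
    then have "open {x. f x i \<in> B}" by (subst open_subopen) auto
    then show "open ((\<lambda>x. f x i) -` B \<inter> UNIV)" by (simp add: vimage_def)
  qed
qed

lemma homeo_cantorI:
  assumes "\<And>w. g (f w) = w" "\<And>w. f (g w) = w" "\<And>w. continuous_at_word f w" "\<And>w. continuous_at_word g w"
  shows "f \<in> carrier (homeo_group :: (cantor \<Rightarrow> cantor) monoid)"
proof -
  have "homeomorphic_maps euclidean euclidean f g"
    using assms by (simp add: homeomorphic_maps_def continuous_cantorI)
  then show ?thesis unfolding homeo_group_def homeomorphic_map_maps by auto
qed

lemma continuous_at_word_locally_replacement:
  assumes "locally_replacement f w" shows "continuous_at_word f w"
  unfolding continuous_at_word_def
proof
  fix n
  obtain \<alpha> \<beta> y where w: "w = \<alpha> \<frown> y" and f: "\<And>y. f (\<alpha> \<frown> y) = \<beta> \<frown> y"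
    using assms unfolding locally_replacement_def by blast
  have "agree n (f x) (f w)" if x: "agree (length \<alpha> + n) x w" for x
  proof -
    have "agree (length \<alpha>) x (\<alpha> \<frown> y)" using agree_mono[OF x] w by simp
    then obtain z where z: "x = \<alpha> \<frown> z" using agree_conc_iff by blast
    then have "agree n z y" using x w agree_conc by simp
    then have "agree (length \<beta> + n) (f x) (f w)" using z w f agree_conc by simp
    then show ?thesis by (rule agree_mono) simp
  qed
  then show "\<exists>k. \<forall>x. agree k x w \<longrightarrow> agree n (f x) (f w)" by blast
qed

text \<open>
  The map that exchanges the two cylinders and fixes all other words.
\<close>
lemma exchange_in_V:
  assumes inc: "\<And>x y. \<alpha> \<frown> x \<noteq> \<beta> \<frown> y"
  shows "\<exists>g\<in>thompson_V. \<forall>y. g (\<alpha> \<frown> y) = \<beta> \<frown> y"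
proof -
  define g where "g w = (if w \<in> range (conc \<alpha>) then \<beta> \<frown> suffix (length \<alpha>) w
    else if w \<in> range (conc \<beta>) then \<alpha> \<frown> suffix (length \<beta>) w else w)" for w :: cantor
  have ga: "g (\<alpha> \<frown> y) = \<beta> \<frown> y" for y by (simp add: g_def)
  have gb: "g (\<beta> \<frown> y) = \<alpha> \<frown> y" for y
  proof -
    have "\<beta> \<frown> y \<notin> range (conc \<alpha>)" using inc by (metis imageE)
    then show ?thesis by (simp add: g_def)
  qed
  have gc: "g w = w" if "w \<notin> range (conc \<alpha>)" "w \<notin> range (conc \<beta>)" for w using that by (simp add: g_def)
  have gg: "g (g w) = w" for w
  proof (cases "w \<in> range (conc \<alpha>) \<or> w \<in> range (conc \<beta>)")
    case True
    then show ?thesis using ga gb by auto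
  next
    case False
    then show ?thesis using gc by simp
  qed
  have loc: "\<exists>\<gamma> \<delta>. w \<in> range (conc \<gamma>) \<and> (\<forall>y. g (\<gamma> \<frown> y) = \<delta> \<frown> y)" for w
  proof (cases "w \<in> range (conc \<alpha>) \<or> w \<in> range (conc \<beta>)")
    case True
    then show ?thesis using ga gb by blast
  next
    case False
    let ?n = "length \<alpha> + length \<beta>"
    let ?\<gamma> = "map w [0..<?n]"
    have "?\<gamma> \<frown> y \<notin> range (conc \<delta>)" if \<delta>: "w \<notin> range (conc \<delta>)" "length \<delta> \<le> ?n" for y \<delta>
    proof
      assume "?\<gamma> \<frown> y \<in> range (conc \<delta>)"
      then obtain z where z: "?\<gamma> \<frown> y = \<delta> \<frown> z" by blast
      have "agree ?n (?\<gamma> \<frown> y) w" by (auto simp: agree_def conc_def)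
      then have "agree ?n w (\<delta> \<frown> z)" unfolding z by (simp add: agree_def)
      then have "agree (length \<delta>) w (\<delta> \<frown> z)" by (rule agree_mono) (rule \<delta>(2))
      then show False using agree_conc_iff \<delta>(1) by blast
    qed
    then have "g (?\<gamma> \<frown> y) = ?\<gamma> \<frown> y" for y using False by (intro gc) auto
    moreover have "w \<in> range (conc ?\<gamma>)" using word_split_prefix[of w ?n] by (metis rangeI)
    ultimately show ?thesis by blast
  qed
  have "continuous_at_word g w" for w
    by (rule continuous_at_word_locally_replacement) (use loc in \<open>simp add: locally_replacement_def\<close>)
  then have "g \<in> carrier homeo_group" using homeo_cantorI[of g g] gg by blast
  moreover have "\<exists>\<gamma> \<delta>. w \<in> range (conc \<gamma>) \<and> g w \<in> range (conc \<delta>) \<and>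
      (\<forall>\<^sub>F x in nhds w. g x = prefix_replacement \<gamma> \<delta> x)" for w
  proof -
    obtain \<gamma> \<delta> where *: "w \<in> range (conc \<gamma>)" "\<And>y. g (\<gamma> \<frown> y) = \<delta> \<frown> y" using loc by blast
    then have "\<forall>\<^sub>F x in nhds w. g x = prefix_replacement \<gamma> \<delta> x"
      by (intro eventually_nhds_cylinder[of _ \<gamma>]) (auto simp: prefix_replacement_def)
    moreover have "g w \<in> range (conc \<delta>)" using * by auto
    ultimately show ?thesis using *(1) by blast
  qed
  ultimately have "g \<in> thompson_V" unfolding thompson_V_def by blast
  then show ?thesis using ga by blast
qed

lemma id_in_V: "id \<in> thompson_V"
proof -
  have "id \<in> carrier (homeo_group :: (cantor \<Rightarrow> cantor) monoid)"
    by (rule homeo_cantorI[of id]) (auto simp: continuous_at_word_def)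
  moreover have "w \<in> range (conc []) \<and> id w \<in> range (conc []) \<and>
      (\<forall>\<^sub>F x in nhds w. id x = prefix_replacement [] [] x)" for w :: cantor
    by (auto simp: prefix_replacement_def)
  ultimately show ?thesis unfolding thompson_V_def by blast
qed

text \<open>
  The two situations in which a prefix replacement is recognized as the germ of an element of
  \<open>V\<close>.
\<close>
definition free_at :: "(cantor \<Rightarrow> cantor) \<Rightarrow> cantor \<Rightarrow> bool" where
  "free_at f w \<longleftrightarrow> f w \<noteq> w \<or> (\<exists>\<gamma>. w \<in> range (conc \<gamma>) \<and> (\<forall>y. f (\<gamma> \<frown> y) = \<gamma> \<frown> y))"

text \<open>
  Suppose that \<open>f\<close> moves \<open>w\<close>. Sufficiently long prefixes of \<open>w\<close> and
  \<open>f w\<close> are then incomparable, and the exchange of their cylinders agrees with \<open>f\<close>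
  near \<open>w\<close>.
\<close>
lemma nonsingular_V:
  assumes loc: "locally_replacement f w"
    and moved: "free_at f w"
  shows "w \<notin> sing thompson_V f"
proof -
  have "\<exists>g\<in>thompson_V. \<forall>\<^sub>F x in nhds w. f x = g x"
  proof (cases "f w = w")
    case True
    then obtain \<gamma> where "w \<in> range (conc \<gamma>)" "\<And>y. f (\<gamma> \<frown> y) = \<gamma> \<frown> y" using moved unfolding free_at_def by blast
    then have "\<forall>\<^sub>F x in nhds w. f x = id x"
      by (intro eventually_nhds_cylinder[of _ \<gamma>]) auto
    then show ?thesis using id_in_V by blast
  next
    case False
    obtain \<alpha> \<beta> y where w: "w = \<alpha> \<frown> y" and f: "\<And>y. f (\<alpha> \<frown> y) = \<beta> \<frown> y"
      using loc unfolding locally_replacement_def by blast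
    obtain i where i: "f w i \<noteq> w i" using False by auto
    \<comment> \<open>both prefixes become longer than \<open>i\<close>, a position at which \<open>w\<close> and \<open>f w\<close> differ\<close>
    define \<gamma> where "\<gamma> = map y [0..<Suc i]"
    define z where "z = (\<lambda>j. y (Suc i + j))"
    have y: "y = \<gamma> \<frown> z" unfolding \<gamma>_def z_def by (rule word_split_prefix)
    have "(\<alpha> @ \<gamma>) \<frown> u \<noteq> (\<beta> @ \<gamma>) \<frown> v" for u v
    proof
      assume eq: "(\<alpha> @ \<gamma>) \<frown> u = (\<beta> @ \<gamma>) \<frown> v"
      have len: "i < length (\<alpha> @ \<gamma>)" "i < length (\<beta> @ \<gamma>)" by (simp_all add: \<gamma>_def)
      have "w = (\<alpha> @ \<gamma>) \<frown> z" using w y by simp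
      then have "w i = ((\<alpha> @ \<gamma>) \<frown> u) i" using len(1) by simp
      moreover have "f w = (\<beta> @ \<gamma>) \<frown> z" using w y f[of "\<gamma> \<frown> z"] by simp
      then have "f w i = ((\<beta> @ \<gamma>) \<frown> v) i" using len(2) by simp
      ultimately show False using eq i by simp
    qed
    then have "\<exists>g\<in>thompson_V. \<forall>u. g ((\<alpha> @ \<gamma>) \<frown> u) = (\<beta> @ \<gamma>) \<frown> u"
      by (rule exchange_in_V)
    then obtain g where g: "g \<in> thompson_V" "\<And>u. g ((\<alpha> @ \<gamma>) \<frown> u) = (\<beta> @ \<gamma>) \<frown> u"
      by blast
    have "f ((\<alpha> @ \<gamma>) \<frown> u) = g ((\<alpha> @ \<gamma>) \<frown> u)" for u
      using g(2) f by (simp flip: conc_conc)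
    moreover have "w \<in> range (conc (\<alpha> @ \<gamma>))" using w y by simp
    ultimately have "\<forall>\<^sub>F x in nhds w. f x = g x"
      by (intro eventually_nhds_cylinder[of _ "\<alpha> @ \<gamma>"])
    then show ?thesis using g(1) by blast
  qed
  then show ?thesis by (simp add: sing_def)
qed

section \<open>Rotations and translations on disjoint cylinders\<close>

text \<open>
  The cylinders of these words cover everything but the word \<open>000\<dots>\<close>.
\<close>
definition block :: "nat \<Rightarrow> bool list" where
  "block j = replicate j False @ [True]"

definition blockwise :: "(nat \<Rightarrow> cantor \<Rightarrow> cantor) \<Rightarrow> cantor \<Rightarrow> cantor" where
  "blockwise u w = (if \<exists>i. w i then let j = (LEAST i. w i) in block j \<frown> u j (suffix (Suc j) w) else w)"

lemma block_True: "(block j \<frown> y) j" "i < j \<Longrightarrow> \<not> (block j \<frown> y) i"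
  by (simp_all add: block_def conc_def nth_append)

lemma Least_block: "(LEAST i. (block j \<frown> y) i) = j"
  by (rule Least_equality) (use block_True(1)[of j y] block_True(2)[of _ j y] not_le in blast)+

lemma length_block [simp]: "length (block j) = Suc j"
  by (simp add: block_def)

lemma blockwise_block: "blockwise u (block j \<frown> y) = block j \<frown> u j y"
proof -
  have "\<exists>i. (block j \<frown> y) i" using block_True(1) by blast
  moreover have "suffix (Suc j) (block j \<frown> y) = y" using suffix_conc_length[of "block j" y] by simp
  ultimately show ?thesis unfolding blockwise_def Least_block by (simp add: Let_def)
qed

lemma blockwise_zero: "blockwise u (\<lambda>_. False) = (\<lambda>_. False)"
  by (simp add: blockwise_def)

lemma block_cases:
  obtains "w = (\<lambda>_. False)" | j y where "w = block j \<frown> y"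
proof (cases "\<exists>i. w i")
  case False
  then have "w = (\<lambda>_. False)" by auto
  then show ?thesis by (rule that(1))
next
  case True
  define j where "j = (LEAST i. w i)"
  have "w j" unfolding j_def using True by (rule LeastI_ex)
  moreover have "\<not> w i" if "i < j" for i using not_less_Least that unfolding j_def by blast
  ultimately have "agree (Suc j) w (block j \<frown> w)"
    unfolding agree_def using block_True(1)[of j w] block_True(2)[of _ j w] by (metis less_antisym)
  then have "w \<in> range (conc (block j))" using agree_conc_iff[of "block j" w w] by simp
  then show ?thesis using that(2) by blast
qed

lemma block_before: "i < j \<Longrightarrow> before (block j) (block i)"
  using before_replicate(2)[of i j "[True]"] by (simp add: block_def)

lemma blockwise_less:
  assumes incr: "\<And>j x y. x \<prec>\<^sub>L y \<Longrightarrow> u j x \<prec>\<^sub>L u j y" and less: "x \<prec>\<^sub>L y"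
  shows "blockwise u x \<prec>\<^sub>L blockwise u y"
proof (cases rule: block_cases[of x])
  case 1
  note x = 1
  show ?thesis
  proof (cases rule: block_cases[of y])
    case 1
    then show ?thesis using x less less_fun_irrefl by blast
  next
    case (2 j z)
    have "(\<lambda>_. False) \<prec>\<^sub>L block j \<frown> u j z"
      unfolding less_fun_def by (rule exI[of _ j]) (use block_True in auto)
    then show ?thesis using x 2 by (simp add: blockwise_block blockwise_zero)
  qed
next
  case (2 i x')
  note x = 2
  show ?thesis
  proof (cases rule: block_cases[of y])
    case 1
    then show ?thesis using less by (simp add: less_fun_def)
  next
    case (2 j y')
    consider "j < i" | "j = i" | "i < j" by linarith
    then show ?thesis
    proof cases
      case 1
      then show ?thesis using x 2 block_before unfolding before_def by (simp add: blockwise_block)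
    next
      case 2
      then show ?thesis using x \<open>y = block j \<frown> y'\<close> less incr by (simp add: blockwise_block)
    next
      case 3
      then have "y \<prec>\<^sub>L x" using x 2 block_before unfolding before_def by blast
      then show ?thesis using less less_fun_asym by blast
    qed
  qed
qed

definition block_maps :: "(nat \<Rightarrow> rat) \<Rightarrow> (nat \<Rightarrow> rat) \<Rightarrow> nat \<Rightarrow> cantor \<Rightarrow> cantor" where
  "block_maps s r j = (if even j then rotate (r (j div 2)) else line (s (j div 2)))"

text \<open>
  Rotations on even blocks and lines on odd blocks. The alternation keeps the ends of a line away from other
  lines: the other binary expansion of such an end lies in an even block.
\<close>
definition act :: "(nat \<Rightarrow> rat) \<Rightarrow> (nat \<Rightarrow> rat) \<Rightarrow> cantor \<Rightarrow> cantor" where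
  "act s r = blockwise (block_maps s r)"

lemma act_block: "act s r (block j \<frown> y) = block j \<frown> block_maps s r j y"
  by (simp add: act_def blockwise_block)

lemma act_zero_word [simp]: "act s r (\<lambda>_. False) = (\<lambda>_. False)"
  by (simp add: act_def blockwise_zero)

lemma rotate_int: "q \<in> \<int> \<Longrightarrow> rotate q w = w"
  using rotate_id_iff[of q] by simp

lemma act_add: "act (\<lambda>i. s i + s' i) (\<lambda>i. r i + r' i) w = act s r (act s' r' w)"
  by (cases rule: block_cases[of w]) (simp_all add: act_block block_maps_def rotate_add line_add)

lemma act_id: "(\<And>i. s i = 0) \<Longrightarrow> (\<And>i. r i \<in> \<int>) \<Longrightarrow> act s r w = w"
  by (cases rule: block_cases[of w]) (simp_all add: act_block block_maps_def rotate_int)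

text \<open>
  The images of the word with index \<open>0\<close> under distinct translations have distinct indices.
\<close>
lemma line_trivial: "(\<And>w. line q w = w) \<Longrightarrow> q = 0"
proof -
  assume id: "\<And>w. line q w = w"
  obtain n0 where "\<forall>n\<ge>n0. \<exists>a. q * fact n = of_int a" using fact_clears_denominator by blast
  then obtain a where n: "q * fact n0 = of_int a" by blast
  have "code line_code n0 0 \<frown> undefined = code line_code n0 a \<frown> undefined"
    using id[of "code line_code n0 0 \<frown> undefined"] translate_code[OF shiftable_line_code n, of 0 undefined]
    by (simp add: line_def)
  then have "0 = a"
    by (intro before_tails(1)[of "code line_code n0" 0 undefined a undefined] code_before[of line_code] line_code_before)
  then show "q = 0" using n by simp
qed

lemma act_eqD:
  assumes "act s r = act s' r'"
  shows "s i = s' i" "r i - r' i \<in> \<int>"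
proof -
  have "act (\<lambda>i. s i + - s' i) (\<lambda>i. r i + - r' i) w = w" for w
  proof -
    have "act (\<lambda>i. s i + - s' i) (\<lambda>i. r i + - r' i) w = act s r (act (\<lambda>i. - s' i) (\<lambda>i. - r' i) w)"
      by (rule act_add)
    also have "\<dots> = act (\<lambda>i. s' i + - s' i) (\<lambda>i. r' i + - r' i) w"
      unfolding assms by (rule act_add[symmetric])
    also have "\<dots> = w" by (rule act_id) simp_all
    finally show ?thesis .
  qed
  then have b: "block_maps (\<lambda>i. s i + - s' i) (\<lambda>i. r i + - r' i) j y = y" for j y
    using act_block by (metis conc_inject)
  have "line (s i + - s' i) y = y" for y using b[of "2 * i + 1" y] by (simp add: block_maps_def)
  then have "s i + - s' i = 0" by (rule line_trivial)
  then show "s i = s' i" by simp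
  have "rotate (r i + - r' i) y = y" for y using b[of "2 * i" y] by (simp add: block_maps_def)
  then have "rotate (r i + - r' i) = id" by auto
  then show "r i - r' i \<in> \<int>" by (simp add: rotate_id_iff)
qed

lemma act_less:
  assumes "\<And>i. r i \<in> \<int>" "x \<prec>\<^sub>L y"
  shows "act s r x \<prec>\<^sub>L act s r y"
  unfolding act_def by (rule blockwise_less) (use assms line_less rotate_int in \<open>auto simp: block_maps_def\<close>)

section \<open>The action lies in VA\<close>

lemma locally_replacement_embed:
  assumes "locally_replacement g y" "\<And>y. f (\<gamma> \<frown> y) = \<gamma> \<frown> g y"
  shows "locally_replacement f (\<gamma> \<frown> y)"
proof -
  obtain \<alpha> \<beta> z where "y = \<alpha> \<frown> z" "\<And>y. g (\<alpha> \<frown> y) = \<beta> \<frown> y"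
    using assms(1) unfolding locally_replacement_def by blast
  then have "\<gamma> \<frown> y \<in> range (conc (\<gamma> @ \<alpha>))" "\<And>x. f ((\<gamma> @ \<alpha>) \<frown> x) = (\<gamma> @ \<beta>) \<frown> x"
    using assms(2) by (auto simp flip: conc_conc)
  then show ?thesis unfolding locally_replacement_def by blast
qed

lemma continuous_at_word_embed:
  assumes g: "continuous_at_word g y" and f: "\<And>y. f (\<gamma> \<frown> y) = \<gamma> \<frown> g y"
  shows "continuous_at_word f (\<gamma> \<frown> y)"
  unfolding continuous_at_word_def
proof
  fix n
  obtain k where k: "\<And>x. agree k x y \<Longrightarrow> agree n (g x) (g y)" using g unfolding continuous_at_word_def by blast
  have "agree n (f x) (f (\<gamma> \<frown> y))" if x: "agree (length \<gamma> + k) x (\<gamma> \<frown> y)" for x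
  proof -
    have "agree (length \<gamma>) x (\<gamma> \<frown> y)" using x by (rule agree_mono) simp
    then obtain z where z: "x = \<gamma> \<frown> z" using agree_conc_iff by blast
    then have "agree n (g z) (g y)" using x agree_conc k by simp
    then have "agree (length \<gamma> + n) (f x) (f (\<gamma> \<frown> y))" unfolding z f agree_conc .
    then show ?thesis by (rule agree_mono) simp
  qed
  then show "\<exists>k. \<forall>x. agree k x (\<gamma> \<frown> y) \<longrightarrow> agree n (f x) (f (\<gamma> \<frown> y))" by blast
qed

lemma agree_const_iff: "agree k x (\<lambda>_. c) \<longleftrightarrow> x \<in> range (conc (replicate k c))"
  by (simp add: agree_def range_replicate_iff)

lemma line_continuous_at_const: "continuous_at_word (line q) (\<lambda>_. c)"
  unfolding continuous_at_word_def
proof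
  fix n
  obtain k where "\<forall>y. \<exists>z. line q (replicate k c \<frown> y) = replicate n c \<frown> z"
    using line_near_const by blast
  then have "\<forall>x. agree k x (\<lambda>_. c) \<longrightarrow> agree n (line q x) (line q (\<lambda>_. c))"
    unfolding agree_const_iff line_const by auto
  then show "\<exists>k. \<forall>x. agree k x (\<lambda>_. c) \<longrightarrow> agree n (line q x) (line q (\<lambda>_. c))" ..
qed

lemma translate_regular:
  assumes p: "shiftable p" and y: "y \<in> domain_of p"
    and f: "\<And>y. f (\<gamma> \<frown> y) = \<gamma> \<frown> translate p q y"
  shows "locally_replacement f (\<gamma> \<frown> y)" "free_at f (\<gamma> \<frown> y)"
proof -
  show "locally_replacement f (\<gamma> \<frown> y)"
    by (rule locally_replacement_embed[where g = "translate p q"])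
      (use translate_local[OF p y] f in \<open>simp_all add: locally_replacement_def\<close>)
  show "free_at f (\<gamma> \<frown> y)"
  proof (cases "translate p q y = y")
    case True
    then have "f (\<gamma> \<frown> x) = \<gamma> \<frown> x" for x using translate_fixed_point[OF p y] f by simp
    then show ?thesis unfolding free_at_def by blast
  next
    case False
    then show ?thesis unfolding free_at_def f by simp
  qed
qed

text \<open>
  The candidates for singular points: the ends of the lines with a nontrivial translation.
\<close>
definition line_ends :: "(nat \<Rightarrow> rat) \<Rightarrow> cantor set" where
  "line_ends s = {block (2 * i + 1) \<frown> (\<lambda>_. c) | i c. s i \<noteq> 0}"

lemma finite_line_ends:
  assumes "finite {i. s i \<noteq> 0}" shows "finite (line_ends s)"
proof -
  have "line_ends s = (\<lambda>(i, c). block (2 * i + 1) \<frown> (\<lambda>_. c)) ` ({i. s i \<noteq> 0} \<times> UNIV)"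
    unfolding line_ends_def by force
  then show ?thesis using assms by simp
qed

context
  fixes s r :: "nat \<Rightarrow> rat"
  assumes fin_s: "finite {i. s i \<noteq> 0}" and fin_r: "finite {i. r i \<notin> \<int>}"
begin

text \<open>
  The blocks close to \<open>000\<dots>\<close> are beyond the finite support.
\<close>
lemma act_near_zero: "\<exists>N. \<forall>y. act s r (replicate N False \<frown> y) = replicate N False \<frown> y"
proof -
  have "finite ({i. s i \<noteq> 0} \<union> {i. r i \<notin> \<int>})" using fin_s fin_r by simp
  then obtain M where M: "\<And>i. i \<in> {i. s i \<noteq> 0} \<union> {i. r i \<notin> \<int>} \<Longrightarrow> i < M"
    using finite_nat_bounded by (meson lessThan_iff subsetD)
  have "act s r w = w" if w: "w = replicate (2 * M) False \<frown> y" for w y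
  proof (cases rule: block_cases[of w])
    case (2 j z)
    have "\<not> j < 2 * M"
    proof
      assume "j < 2 * M"
      then have "\<not> w j" unfolding w by (simp add: conc_def)
      then show False using block_True(1) unfolding 2 by blast
    qed
    then have "\<not> j div 2 < M" by auto
    then have "s (j div 2) = 0" "r (j div 2) \<in> \<int>" using M by blast+
    then show ?thesis unfolding 2 act_block by (simp add: block_maps_def rotate_int)
  qed simp
  then show ?thesis by blast
qed

lemma act_regular:
  assumes w: "w \<notin> line_ends s"
  shows "locally_replacement (act s r) w \<and> free_at (act s r) w"
proof (cases rule: block_cases[of w])
  case 1
  obtain N where N: "\<And>y. act s r (replicate N False \<frown> y) = replicate N False \<frown> y"
    using act_near_zero by blast
  moreover have "w \<in> range (conc (replicate N False))" unfolding 1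
    by (rule image_eqI[of _ _ "\<lambda>_. False"]) (simp_all add: conc_const)
  ultimately show ?thesis unfolding locally_replacement_def free_at_def by blast
next
  case (2 j y)
  show ?thesis
  proof (cases "even j")
    case True
    then have "\<And>y. act s r (block j \<frown> y) = block j \<frown> translate (\<lambda>_. []) (r (j div 2)) y"
      by (simp add: act_block block_maps_def rotate_def)
    from translate_regular[OF shiftable_Nil _ this, of y] show ?thesis unfolding 2 by simp
  next
    case False
    then have odd: "\<And>y. act s r (block j \<frown> y) = block j \<frown> line (s (j div 2)) y"
      by (simp add: act_block block_maps_def)
    show ?thesis
    proof (cases "s (j div 2) = 0")
      case True
      then have "\<And>y. act s r (block j \<frown> y) = block j \<frown> y" using odd by simp
      then show ?thesis unfolding 2 locally_replacement_def free_at_def by blast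
    next
      case s: False
      obtain i where i: "j = 2 * i + 1" using False by (rule oddE)
      then have "s i \<noteq> 0" using s by simp
      then have "block j \<frown> (\<lambda>_. c) \<in> line_ends s" for c unfolding i line_ends_def by blast
      then have "y \<in> domain_of line_code" using w unfolding 2 domain_line_code by blast
      from translate_regular[OF shiftable_line_code this odd[unfolded line_def]] show ?thesis unfolding 2 by blast
    qed
  qed
qed

lemma act_continuous_at_word: "continuous_at_word (act s r) w"
proof (cases "w \<in> line_ends s")
  case True
  then obtain i c where w: "w = block (2 * i + 1) \<frown> (\<lambda>_. c)" unfolding line_ends_def by blast
  show ?thesis unfolding w
    by (rule continuous_at_word_embed[OF line_continuous_at_const[of "s i" c]]) (simp add: act_block block_maps_def)
next
  case False
  then show ?thesis using act_regular continuous_at_word_locally_replacement by blast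
qed

end

lemma act_homeo:
  assumes fin_s: "finite {i. s i \<noteq> 0}" and fin_r: "finite {i. r i \<notin> \<int>}"
  shows "act s r \<in> carrier homeo_group"
proof (rule homeo_cantorI[where g = "act (\<lambda>i. - s i) (\<lambda>i. - r i)"])
  fix w
  show "act (\<lambda>i. - s i) (\<lambda>i. - r i) (act s r w) = w"
    unfolding act_add[symmetric] by (rule act_id) simp_all
  show "act s r (act (\<lambda>i. - s i) (\<lambda>i. - r i) w) = w"
    unfolding act_add[symmetric] by (rule act_id) simp_all
  show "continuous_at_word (act s r) w" by (rule act_continuous_at_word[OF fin_s fin_r])
  have "finite {i. - s i \<noteq> 0}" "finite {i. - r i \<notin> \<int>}" using fin_s fin_r by (simp_all add: minus_in_Ints_iff)
  then show "continuous_at_word (act (\<lambda>i. - s i) (\<lambda>i. - r i)) w" by (rule act_continuous_at_word)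
qed

lemma act_self_similar:
  assumes "odd j \<or> (\<forall>i. r i \<in> \<int>)"
  shows "self_similar (act s r) (block j) c"
proof (cases "odd j")
  case True
  then show ?thesis
    by (intro self_similar_embed[OF self_similar_line[of "s (j div 2)"]]) (simp add: act_block block_maps_def)
next
  case False
  then show ?thesis using assms by (intro self_similar_id) (simp add: act_block block_maps_def rotate_int)
qed

text \<open>
  Singular points are ends of lines. There the neighborhood is taken inside one block, on which the action is
  increasing, and \<open>act_self_similar\<close> is the commutation with \<open>L\<close>.
\<close>
lemma act_in_VA:
  assumes fin_s: "finite {i. s i \<noteq> 0}" and fin_r: "finite {i. r i \<notin> \<int>}"
  shows "act s r \<in> carrier VA"
proof -
  let ?f = "act s r"
  have sing: "sing thompson_V ?f \<subseteq> line_ends s"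
    using act_regular[OF fin_s fin_r] nonsingular_V by blast
  have "(\<exists>\<alpha> c. w = \<alpha> \<frown> (\<lambda>_. c)) \<and> (\<exists>U g h. open U \<and> w \<in> U \<and> monotone_on U less_fun less_fun ?f \<and>
      cantor_L w g \<and> cantor_L (?f w) h \<and> (\<forall>x\<in>U. h (?f x) = ?f (g x)))" if ends: "w \<in> line_ends s" for w
  proof -
    obtain i c where w: "w = block (2 * i + 1) \<frown> (\<lambda>_. c)" using ends unfolding line_ends_def by blast
    let ?\<gamma> = "block (2 * i + 1)"
    have ss: "self_similar ?f ?\<gamma> c" by (rule act_self_similar) simp
    obtain k where k: "\<And>y. \<exists>z. ?f (?\<gamma> \<frown> replicate (Suc k) c \<frown> y) = ?\<gamma> \<frown> [c] \<frown> z \<and>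
        ?f (?\<gamma> \<frown> replicate k c \<frown> y) = ?\<gamma> \<frown> z"
      using ss unfolding self_similar_def by blast
    define g where "g = prefix_replacement (?\<gamma> @ [c]) ?\<gamma>"
    have g: "g (?\<gamma> \<frown> [c] \<frown> y) = ?\<gamma> \<frown> y" for y
      unfolding g_def prefix_replacement_def conc_conc suffix_conc_length ..
    let ?U = "range (conc (?\<gamma> @ replicate (Suc k) c))"
    have U: "\<exists>y. x = ?\<gamma> \<frown> replicate (Suc k) c \<frown> y" if "x \<in> ?U" for x using that by (auto simp only: conc_conc)
    have "w = ?\<gamma> \<frown> replicate (Suc k) c \<frown> (\<lambda>_. c)" unfolding w conc_const ..
    then have "w \<in> ?U" by (simp only: conc_conc rangeI)
    moreover have "monotone_on ?U less_fun less_fun ?f"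
    proof (rule monotone_onI)
      fix x y assume "x \<in> ?U" "y \<in> ?U" and less: "x \<prec>\<^sub>L y"
      then obtain x' y' where "x = ?\<gamma> \<frown> x'" "y = ?\<gamma> \<frown> y'" using U by meson
      then show "?f x \<prec>\<^sub>L ?f y" using less line_less by (simp add: act_block block_maps_def)
    qed
    moreover have "cantor_L w g" unfolding cantor_L_def w g_def by blast
    moreover from this have "cantor_L (?f w) g" using self_similar_fixed[OF ss] w by simp
    moreover have "g (?f x) = ?f (g x)" if "x \<in> ?U" for x
    proof -
      obtain y where x: "x = ?\<gamma> \<frown> replicate (Suc k) c \<frown> y" using U \<open>x \<in> ?U\<close> by blast
      obtain z where z: "?f (?\<gamma> \<frown> replicate (Suc k) c \<frown> y) = ?\<gamma> \<frown> [c] \<frown> z"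
        "?f (?\<gamma> \<frown> replicate k c \<frown> y) = ?\<gamma> \<frown> z" using k by blast
      have "x = ?\<gamma> \<frown> [c] \<frown> replicate k c \<frown> y" unfolding x by simp
      then have "g x = ?\<gamma> \<frown> replicate k c \<frown> y" using g by simp
      then show ?thesis unfolding x z(1) g using z(2) by simp
    qed
    ultimately show ?thesis using open_range_conc w by blast
  qed
  then show ?thesis
    unfolding VA_def using sing finite_subset[OF sing finite_line_ends[OF fin_s]] act_homeo[OF fin_s fin_r]
    by auto
qed

section \<open>Binary expansions\<close>

text \<open>
  The number with the binary expansion \<open>0.w\<close>.
\<close>
definition val :: "cantor \<Rightarrow> real" where
  "val w = suminf (\<lambda>i. of_bool (w i) / 2 ^ Suc i)"

lemma summable_val: "summable (\<lambda>i. of_bool (w i) / 2 ^ Suc i :: real)"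
proof (rule summable_comparison_test)
  show "\<exists>N. \<forall>n\<ge>N. norm (of_bool (w n) / 2 ^ Suc n :: real) \<le> (1 / 2) ^ n"
    by (intro exI[of _ 0]) (simp add: field_simps)
  show "summable (\<lambda>n. (1 / 2 :: real) ^ n)" by (rule summable_geometric) simp
qed

lemma val_Cons: "val ([c] \<frown> y) = of_bool c / 2 + val y / 2"
proof -
  have "val ([c] \<frown> y) = suminf (\<lambda>i. of_bool (([c] \<frown> y) (Suc i)) / 2 ^ Suc (Suc i)) + of_bool (([c] \<frown> y) 0) / 2 ^ Suc 0"
    unfolding val_def using suminf_split_head[OF summable_val[of "[c] \<frown> y"]] by simp
  also have "(\<lambda>i. of_bool (([c] \<frown> y) (Suc i)) / 2 ^ Suc (Suc i) :: real) = (\<lambda>i. (of_bool (y i) / 2 ^ Suc i) / 2)"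
    by (rule ext) simp
  also have "suminf (\<lambda>i. (of_bool (y i) / 2 ^ Suc i) / 2 :: real) = val y / 2"
    unfolding val_def by (rule suminf_divide[OF summable_val])
  finally show ?thesis by simp
qed

lemma val_nonneg [simp]: "0 \<le> val w"
  unfolding val_def by (rule suminf_nonneg[OF summable_val]) simp

lemma val_False [simp]: "val (\<lambda>_. False) = 0"
  by (simp add: val_def)

lemma val_True [simp]: "val (\<lambda>_. True) = 1"
  using val_Cons[of True "\<lambda>_. True"] conc_const[of 1 True] by simp

lemma val_not: "val (\<lambda>i. \<not> w i) = 1 - val w"
proof -
  have "val w + val (\<lambda>i. \<not> w i) = suminf (\<lambda>i. of_bool (w i) / 2 ^ Suc i + of_bool (\<not> w i) / 2 ^ Suc i)"
    unfolding val_def by (rule suminf_add[OF summable_val summable_val])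
  also have "\<dots> = val (\<lambda>_. True)" unfolding val_def by (rule arg_cong[of _ _ suminf]) (auto simp: fun_eq_iff)
  finally show ?thesis by simp
qed

lemma val_le_1 [simp]: "val w \<le> 1"
  using val_nonneg[of "\<lambda>i. \<not> w i"] unfolding val_not by simp

lemma val_eq_0_iff: "val w = 0 \<longleftrightarrow> w = (\<lambda>_. False)"
proof
  assume "val w = 0"
  then have "\<forall>i. of_bool (w i) / 2 ^ Suc i = (0::real)"
    unfolding val_def using suminf_eq_zero_iff[OF summable_val] by simp
  then show "w = (\<lambda>_. False)" by (intro ext) simp
qed simp

lemma val_eq_1_iff: "val w = 1 \<longleftrightarrow> w = (\<lambda>_. True)"
  using val_eq_0_iff[of "\<lambda>i. \<not> w i"] unfolding val_not by (auto simp: fun_eq_iff)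

lemma val_conc: "val (\<alpha> \<frown> y) = val (\<alpha> \<frown> (\<lambda>_. False)) + val y / 2 ^ length \<alpha>"
proof (induction \<alpha>)
  case (Cons c \<alpha>)
  have c: "val ((c # \<alpha>) \<frown> x) = of_bool c / 2 + val (\<alpha> \<frown> x) / 2" for x
    using val_Cons[of c "\<alpha> \<frown> x"] by simp
  show ?case unfolding c by (subst Cons) (simp add: field_simps)
qed simp

text \<open>
  The only ambiguity of binary expansions is \<open>\<alpha>0111\<dots> = \<alpha>1000\<dots>\<close>.
\<close>
lemma val_less_cases:
  assumes "x \<prec>\<^sub>L y"
  shows "val x < val y \<or> (val x = val y \<and> (\<exists>\<alpha>. x = \<alpha> \<frown> [False] \<frown> (\<lambda>_. True) \<and> y = \<alpha> \<frown> [True] \<frown> (\<lambda>_. False)))"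
proof -
  obtain k where k: "x k < y k" "\<And>i. i < k \<Longrightarrow> x i = y i" using assms by (rule less_funE) blast
  define \<alpha> x' y' where "\<alpha> = map x [0..<k]" and "x' = (\<lambda>i. x (Suc (k + i)))" and "y' = (\<lambda>i. y (Suc (k + i)))"
  have split: "w = map w [0..<k] \<frown> [w k] \<frown> (\<lambda>i. w (Suc (k + i)))" for w :: cantor
  proof -
    have "(\<lambda>i. w (k + i)) = [w k] \<frown> (\<lambda>i. w (Suc (k + i)))"
      by (rule ext) (simp add: conc_def)
    then show ?thesis using word_split_prefix[of w k] by simp
  qed
  have x: "x = \<alpha> \<frown> [False] \<frown> x'" using split[of x] k(1) by (simp add: \<alpha>_def x'_def)
  have "\<alpha> = map y [0..<k]" using k(2) by (simp add: \<alpha>_def)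
  then have y: "y = \<alpha> \<frown> [True] \<frown> y'" using split[of y] k(1) by (simp add: y'_def)
  have v: "val x = val (\<alpha> \<frown> (\<lambda>_. False)) + (val x' / 2) / 2 ^ k"
    "val y = val (\<alpha> \<frown> (\<lambda>_. False)) + (1 / 2 + val y' / 2) / 2 ^ k"
    unfolding x y val_conc[of \<alpha> "[_] \<frown> _"] val_Cons by (simp_all add: \<alpha>_def)
  consider "val x' < 1 + val y'" | "x' = (\<lambda>_. True)" "y' = (\<lambda>_. False)"
    using val_le_1[of x'] val_nonneg[of y'] val_eq_1_iff[of x'] val_eq_0_iff[of y'] by linarith
  then show ?thesis
  proof cases
    case 1
    then have "(val x' / 2) / 2 ^ k < (1 / 2 + val y' / 2) / (2 ^ k :: real)"
      by (intro divide_strict_right_mono) simp_all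
    then show ?thesis unfolding v by simp
  next
    case 2
    then show ?thesis using v x y by auto
  qed
qed

lemma val_mono: "x \<prec>\<^sub>L y \<Longrightarrow> val x \<le> val y"
  using val_less_cases by fastforce

lemma less_if_val_less: "val x < val y \<Longrightarrow> x \<prec>\<^sub>L y"
  using word_less_cases[of x y] val_mono[of y x] by fastforce

lemma val_eq_cases:
  assumes "val x = val y" "x \<prec>\<^sub>L y"
  shows "\<exists>n. \<forall>i\<ge>n. x i" "\<exists>n. \<forall>i\<ge>n. \<not> y i"
proof -
  obtain \<alpha> where \<alpha>: "x = \<alpha> \<frown> [False] \<frown> (\<lambda>_. True)" "y = \<alpha> \<frown> [True] \<frown> (\<lambda>_. False)"
    using val_less_cases[OF assms(2)] assms(1) by auto
  have "\<forall>i\<ge>Suc (length \<alpha>). x i" "\<forall>i\<ge>Suc (length \<alpha>). \<not> y i"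
    unfolding \<alpha> by (simp_all add: conc_def)
  then show "\<exists>n. \<forall>i\<ge>n. x i" "\<exists>n. \<forall>i\<ge>n. \<not> y i" by blast+
qed

text \<open>
  The letters are found by repeated doubling; the remainder after \<open>n\<close> steps, scaled by a power of
  two, stays in the unit interval.
\<close>
lemma val_surj:
  assumes "0 \<le> t" "t \<le> 1"
  obtains w where "val w = t"
proof -
  define rem :: "nat \<Rightarrow> real" where "rem = rec_nat t (\<lambda>_ r. if 1 / 2 \<le> r then 2 * r - 1 else 2 * r)"
  have rem: "rem 0 = t" "rem (Suc n) = (if 1 / 2 \<le> rem n then 2 * rem n - 1 else 2 * rem n)" for n
    by (simp_all add: rem_def)
  define w where "w n \<longleftrightarrow> 1 / 2 \<le> rem n" for n
  have bounds: "0 \<le> rem n \<and> rem n \<le> 1" for n by (induction n) (use assms in \<open>auto simp: rem\<close>)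
  have part: "(\<Sum>i<n. of_bool (w i) / 2 ^ Suc i) = t - rem n / 2 ^ n" for n
  proof (induction n)
    case (Suc n)
    then show ?case by (simp add: rem w_def field_simps)
  qed (simp add: rem)
  have "(\<lambda>n. rem n / 2 ^ n) \<longlonglongrightarrow> 0"
  proof (rule tendsto_sandwich)
    show "\<forall>\<^sub>F n in sequentially. 0 \<le> rem n / 2 ^ n" using bounds by simp
    show "\<forall>\<^sub>F n in sequentially. rem n / 2 ^ n \<le> (1 / 2) ^ n" using bounds by (simp add: power_divide divide_right_mono)
    show "(\<lambda>n. (1 / 2 :: real) ^ n) \<longlonglongrightarrow> 0" by (rule LIMSEQ_realpow_zero) simp_all
  qed simp
  then have "(\<lambda>n. t - rem n / 2 ^ n) \<longlonglongrightarrow> t" using tendsto_diff[OF tendsto_const, of _ 0 sequentially t] by simp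
  then have "(\<lambda>i. of_bool (w i) / 2 ^ Suc i) sums t" unfolding sums_def part .
  then have "val w = t" unfolding val_def by (rule sums_unique[symmetric])
  then show ?thesis by (rule that)
qed

lemma val_surj_not_ones:
  assumes "0 \<le> t" "t < 1"
  obtains w where "val w = t" "\<And>n. \<exists>i\<ge>n. \<not> w i"
proof -
  obtain w where w: "val w = t" using assms val_surj by (metis less_imp_le)
  show ?thesis
  proof (cases "\<exists>n. \<forall>i\<ge>n. w i")
    case False
    then show ?thesis using that w by blast
  next
    case True
    define n where "n = (LEAST n. \<forall>i\<ge>n. w i)"
    have n: "\<forall>i\<ge>n. w i" unfolding n_def by (rule LeastI_ex[OF True])
    have "n \<noteq> 0"
    proof
      assume "n = 0"
      then have "w = (\<lambda>_. True)" using n by auto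
      then show False using w assms by simp
    qed
    then obtain m where m: "n = Suc m" by (cases n) auto
    then have "\<not> (\<forall>i\<ge>m. w i)" using not_less_Least[of m "\<lambda>n. \<forall>i\<ge>n. w i"] unfolding n_def by simp
    then have wm: "\<not> w m" using n m by (metis Suc_leI le_neq_implies_less)
    define \<alpha> where "\<alpha> = map w [0..<m]"
    have "(\<lambda>i. w (m + i)) = [False] \<frown> (\<lambda>_. True)"
      using wm n m by (intro ext) (auto simp: conc_def)
    then have w': "w = \<alpha> \<frown> [False] \<frown> (\<lambda>_. True)" using word_split_prefix[of w m] unfolding \<alpha>_def by metis
    let ?w = "\<alpha> \<frown> [True] \<frown> (\<lambda>_. False)"
    have "val ?w = val w" unfolding w' val_conc[of \<alpha> "[_] \<frown> _"] val_Cons by simp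
    moreover have "\<exists>i\<ge>n. \<not> ?w i" for n
      by (rule exI[of _ "n + Suc (length \<alpha>)"]) (simp add: conc_def)
    ultimately show ?thesis using that w by blast
  qed
qed

lemma val_surj_not_zeros:
  assumes "0 < t" "t \<le> 1"
  obtains w where "val w = t" "\<And>n. \<exists>i\<ge>n. w i"
proof -
  obtain w where "val w = 1 - t" "\<And>n. \<exists>i\<ge>n. \<not> w i" using val_surj_not_ones[of "1 - t"] assms by auto
  then show ?thesis using that[of "\<lambda>i. \<not> w i"] by (simp add: val_not)
qed

section \<open>Dyadic numbers\<close>

lemma dyadics_add: "x \<in> dyadics \<Longrightarrow> y \<in> dyadics \<Longrightarrow> x + y \<in> dyadics"
proof -
  assume "x \<in> dyadics" "y \<in> dyadics"
  then obtain m k n l where xy: "x = of_int m / 2 ^ k" "y = of_int n / 2 ^ l" unfolding dyadics_def by auto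
  have "x + y = of_int (m * 2 ^ l + n * 2 ^ k) / 2 ^ (k + l)" unfolding xy by (simp add: field_simps power_add)
  then show ?thesis unfolding dyadics_def by blast
qed

lemma dyadics_powi: "x \<in> dyadics \<Longrightarrow> 2 powi n * x \<in> dyadics"
proof -
  assume "x \<in> dyadics"
  then obtain m k where x: "x = of_int m / 2 ^ k" unfolding dyadics_def by auto
  show ?thesis
  proof (cases "n \<ge> 0")
    case True
    then have "2 powi n * x = of_int (2 ^ nat n * m) / 2 ^ k" unfolding x by (simp add: power_int_def)
    then show ?thesis unfolding dyadics_def by blast
  next
    case False
    then have "2 powi n * x = of_int m / 2 ^ (nat (- n) + k)" unfolding x
      by (simp add: power_int_def power_add field_simps)
    then show ?thesis unfolding dyadics_def by blast
  qed
qed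

lemma dyadics_int: "of_int m \<in> dyadics"
  unfolding dyadics_def using div_by_1 power_0 by (metis (mono_tags, lifting) mem_Collect_eq)

lemma dyadics_minus: "x \<in> dyadics \<Longrightarrow> - x \<in> dyadics"
  unfolding dyadics_def by (auto, metis minus_divide_left of_int_minus)

lemma dyadics_diff: "x \<in> dyadics \<Longrightarrow> y \<in> dyadics \<Longrightarrow> x - y \<in> dyadics"
  using dyadics_add[of x "- y"] dyadics_minus by simp

lemma val_dyadic: "val (\<alpha> \<frown> (\<lambda>_. c)) \<in> dyadics"
proof (induction \<alpha>)
  case Nil
  then show ?case using dyadics_int[of 0] dyadics_int[of 1] by (cases c) simp_all
next
  case (Cons b \<alpha>)
  have "val ((b # \<alpha>) \<frown> (\<lambda>_. c)) = 2 powi (-1) * (of_int (of_bool b) + val (\<alpha> \<frown> (\<lambda>_. c)))"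
    using val_Cons[of b "\<alpha> \<frown> (\<lambda>_. c)"] by (simp add: field_simps)
  then show ?case using dyadics_powi dyadics_add dyadics_int Cons by metis
qed

section \<open>Dyadic piecewise linear maps\<close>

definition dyadic_affine :: "(real \<Rightarrow> real) \<Rightarrow> real \<Rightarrow> real \<Rightarrow> bool" where
  "dyadic_affine G a b \<longleftrightarrow> a < b \<and> a \<in> dyadics \<and> b \<in> dyadics \<and>
     (\<exists>n::int. \<exists>c\<in>dyadics. \<forall>t\<in>{a..b}. G t = 2 powi n * t + c)"

text \<open>
  The inductive form of a subdivision into finitely many affine pieces, so that facts about such maps are
  proved by induction over the pieces.
\<close>
inductive dyadic_pl :: "(real \<Rightarrow> real) \<Rightarrow> real \<Rightarrow> real \<Rightarrow> bool" for G where
  single: "dyadic_affine G a b \<Longrightarrow> dyadic_pl G a b"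
| step: "dyadic_affine G a b \<Longrightarrow> dyadic_pl G b c \<Longrightarrow> dyadic_pl G a c"

lemma dyadic_affine_cong:
  "dyadic_affine G a b \<Longrightarrow> (\<And>t. a \<le> t \<Longrightarrow> t \<le> b \<Longrightarrow> G' t = G t) \<Longrightarrow> dyadic_affine G' a b"
  unfolding dyadic_affine_def by auto

lemma dyadic_pl_less: "dyadic_pl G a b \<Longrightarrow> a < b"
  by (induction rule: dyadic_pl.induct) (auto simp: dyadic_affine_def)

lemma dyadic_pl_cong:
  "dyadic_pl G a b \<Longrightarrow> (\<And>t. a \<le> t \<Longrightarrow> t \<le> b \<Longrightarrow> G' t = G t) \<Longrightarrow> dyadic_pl G' a b"
proof (induction rule: dyadic_pl.induct)
  case (single a b)
  show ?case by (rule dyadic_pl.single[OF dyadic_affine_cong[OF single(1)]]) (rule single(2))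
next
  case (step a b c)
  have "a < b" "b < c" using step.hyps dyadic_pl_less by (auto simp: dyadic_affine_def)
  then show ?case
    by (intro dyadic_pl.step[OF dyadic_affine_cong[OF step.hyps(1)] step.IH] step.prems) auto
qed

lemma dyadic_pl_join: "dyadic_pl G a b \<Longrightarrow> dyadic_pl G b c \<Longrightarrow> dyadic_pl G a c"
  by (induction rule: dyadic_pl.induct) (auto intro: dyadic_pl.step)

lemma dyadic_pl_glue:
  assumes "dyadic_pl G1 a b" "dyadic_pl G2 b c" "G1 b = G2 b"
  shows "dyadic_pl (\<lambda>t. if t \<le> b then G1 t else G2 t) a c"
proof (rule dyadic_pl_join)
  show "dyadic_pl (\<lambda>t. if t \<le> b then G1 t else G2 t) a b"
    by (rule dyadic_pl_cong[OF assms(1)]) simp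
  show "dyadic_pl (\<lambda>t. if t \<le> b then G1 t else G2 t) b c"
    by (rule dyadic_pl_cong[OF assms(2)]) (use assms(3) in \<open>auto simp: order_antisym\<close>)
qed

lemma dyadic_pl_dyadic: "dyadic_pl G a b \<Longrightarrow> a \<in> dyadics \<and> b \<in> dyadics \<and> G a \<in> dyadics \<and> G b \<in> dyadics"
proof (induction rule: dyadic_pl.induct)
  case (single a b)
  then obtain n c where "a < b" "a \<in> dyadics" "b \<in> dyadics" "c \<in> dyadics" "\<forall>t\<in>{a..b}. G t = 2 powi n * t + c"
    unfolding dyadic_affine_def by blast
  then show ?case by (auto intro!: dyadics_add dyadics_powi)
next
  case (step a b c)
  then obtain n e where "a < b" "a \<in> dyadics" "e \<in> dyadics" "\<forall>t\<in>{a..b}. G t = 2 powi n * t + e"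
    unfolding dyadic_affine_def by blast
  then show ?case using step.IH by (auto intro!: dyadics_add dyadics_powi)
qed

lemma dyadic_pl_mono: "dyadic_pl G a b \<Longrightarrow> a \<le> x \<Longrightarrow> x < y \<Longrightarrow> y \<le> b \<Longrightarrow> G x < G y"
proof (induction arbitrary: x y rule: dyadic_pl.induct)
  case (single a b)
  then show ?case unfolding dyadic_affine_def by auto
next
  case (step a b c)
  have aff: "a \<le> x \<Longrightarrow> x < y \<Longrightarrow> y \<le> b \<Longrightarrow> G x < G y" for x y
    using step.hyps(1) unfolding dyadic_affine_def by auto
  have lt: "a < b" "b < c" using step.hyps dyadic_pl_less by (auto simp: dyadic_affine_def)
  consider "y \<le> b" | "b \<le> x" | "x < b" "b < y" by linarith
  then show ?case
  proof cases
    case 3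
    have "G x < G b" using aff[of x b] 3 step.prems by simp
    also have "G b < G y" using step.IH[of b y] 3 step.prems by simp
    finally show ?thesis .
  qed (use aff step in auto)
qed

lemma dyadic_pl_continuous: "dyadic_pl G a b \<Longrightarrow> continuous_on {a..b} G"
proof (induction rule: dyadic_pl.induct)
  case (single a b)
  then obtain n c where *: "\<And>t. t \<in> {a..b} \<Longrightarrow> G t = 2 powi n * t + c" unfolding dyadic_affine_def by blast
  show ?case by (subst continuous_on_cong[OF refl *]) (auto intro!: continuous_intros)
next
  case (step a b c)
  then obtain n e where *: "\<And>t. t \<in> {a..b} \<Longrightarrow> G t = 2 powi n * t + e" unfolding dyadic_affine_def by blast
  have "continuous_on {a..b} G"
    by (subst continuous_on_cong[OF refl *]) (auto intro!: continuous_intros)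
  then have "continuous_on ({a..b} \<union> {b..c}) G" using step.IH by (intro continuous_on_closed_Un) auto
  moreover have "a < b" "b < c" using step.hyps dyadic_pl_less by (auto simp: dyadic_affine_def)
  then have "{a..b} \<union> {b..c} = {a..c}" by auto
  ultimately show ?case by simp
qed

text \<open>
  The form of subdivision in the definition of Thompson's group \<open>T\<close>.
\<close>
lemma dyadic_pl_subdivision:
  "dyadic_pl G a b \<Longrightarrow> \<exists>xs. sorted_wrt (<) xs \<and> xs \<noteq> [] \<and> hd xs = a \<and> last xs = b \<and> set xs \<subseteq> dyadics \<and>
     (\<forall>i. Suc i < length xs \<longrightarrow> dyadic_affine G (xs ! i) (xs ! Suc i))"
proof (induction rule: dyadic_pl.induct)
  case (single a b)
  then show ?case by (intro exI[of _ "[a, b]"]) (auto simp: dyadic_affine_def)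
next
  case (step a b c)
  then obtain xs where xs: "sorted_wrt (<) xs" "xs \<noteq> []" "hd xs = b" "last xs = c" "set xs \<subseteq> dyadics"
    "\<And>i. Suc i < length xs \<Longrightarrow> dyadic_affine G (xs ! i) (xs ! Suc i)" by blast
  obtain ys where ys: "xs = b # ys" using xs(2,3) by (cases xs) auto
  have ab: "a < b" "a \<in> dyadics" using step.hyps(1) by (auto simp: dyadic_affine_def)
  have "dyadic_affine G ((a # xs) ! i) ((a # xs) ! Suc i)" if "Suc i < length (a # xs)" for i
    using that xs(6) step.hyps(1) ys by (cases i) auto
  moreover have "sorted_wrt (<) (a # xs)" using xs(1) ab unfolding ys by (auto intro: less_trans)
  ultimately show ?case using xs ab by (intro exI[of _ "a # xs"]) auto
qed

lemma dyadic_affine_exists: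
  assumes "a \<in> dyadics" "c \<in> dyadics"
  shows "\<exists>G. dyadic_affine G a (a + 2 powi i) \<and> G a = c \<and> G (a + 2 powi i) = c + 2 powi j"
proof (intro exI conjI)
  let ?G = "\<lambda>t. 2 powi (j - i) * t + (c - 2 powi (j - i) * a)"
  have "(2::real) powi i \<in> dyadics" using dyadics_powi[OF dyadics_int[of 1], of i] by simp
  then show "dyadic_affine ?G a (a + 2 powi i)" unfolding dyadic_affine_def
    using assms by (auto intro!: dyadics_add dyadics_diff dyadics_powi)
  show "?G a = c" by simp
  have "(2::real) powi (j - i) * 2 powi i = 2 powi j" by (simp add: power_int_add[symmetric])
  then show "?G (a + 2 powi i) = c + 2 powi j" by (simp add: algebra_simps)
qed

text \<open>
  Map the first unit of the source to the first unit of the target and continue with one unit less on both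
  sides. A side that is down to its last unit is cut in half first, unless both are.
\<close>
lemma dyadic_pl_exists_units:
  assumes "a \<in> dyadics" "c \<in> dyadics" "0 < M" "0 < N"
  shows "\<exists>G. dyadic_pl G a (a + real M * 2 powi i) \<and> G a = c \<and> G (a + real M * 2 powi i) = c + real N * 2 powi j"
  using assms
proof (induction "M + N" arbitrary: M N a c i j rule: less_induct)
  case less
  have dy: "(2::real) powi k \<in> dyadics" for k using dyadics_powi[OF dyadics_int[of 1], of k] by simp
  have half: "(2::real) powi k = 2 * 2 powi (k - 1)" for k :: int
    by (simp add: power_int_diff)
  have peel: "\<exists>G. dyadic_pl G a b \<and> G a = c \<and> G b = d"
    if M': "0 < M'" "0 < N'" "M' + N' < M + N" and b: "b = a + 2 powi k + real M' * 2 powi i'"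
      and d: "d = c + 2 powi l + real N' * 2 powi j'" for M' N' b d k l i' j'
  proof -
    obtain G1 where G1: "dyadic_affine G1 a (a + 2 powi k)" "G1 a = c" "G1 (a + 2 powi k) = c + 2 powi l"
      using dyadic_affine_exists less.prems(1,2) by blast
    obtain G2 where G2: "dyadic_pl G2 (a + 2 powi k) b" "G2 (a + 2 powi k) = c + 2 powi l" "G2 b = d"
      using less.hyps[OF M'(3) dyadics_add[OF less.prems(1) dy] dyadics_add[OF less.prems(2) dy] M'(1,2), of k i' l j']
      unfolding b d by blast
    let ?G = "\<lambda>t. if t \<le> a + 2 powi k then G1 t else G2 t"
    have "dyadic_pl ?G a b"
      by (rule dyadic_pl_glue[OF dyadic_pl.single[OF G1(1)] G2(1)]) (simp add: G1 G2)
    moreover have "a < a + 2 powi k" "a + 2 powi k < b" using dyadic_pl_less[OF G2(1)] by simp_all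
    ultimately show ?thesis using G1(2) G2(3) by (intro exI[of _ ?G]) auto
  qed
  consider "M = 1" "N = 1" | "M = 1" "N \<ge> 2" | "M \<ge> 2" "N = 1" | "M \<ge> 2" "N \<ge> 2"
    using less.prems(3,4) by linarith
  then show ?case
  proof cases
    case 1
    then show ?thesis using dyadic_affine_exists[OF less.prems(1,2), of i j] dyadic_pl.single by auto
  next
    case 2
    then show ?thesis using peel[of 1 "N - 1" _ "i - 1" "i - 1" _ j j] half[of i]
      by (simp add: of_nat_diff algebra_simps)
  next
    case 3
    then show ?thesis using peel[of "M - 1" 1 _ i i _ "j - 1" "j - 1"] half[of j]
      by (simp add: of_nat_diff algebra_simps)
  next
    case 4
    then show ?thesis using peel[of "M - 1" "N - 1" _ i i _ j j]
      by (simp add: of_nat_diff algebra_simps)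
  qed
qed

lemma dyadic_positive_units:
  assumes "x \<in> dyadics" "0 < x"
  obtains M :: nat and k :: int where "0 < M" "x = real M * 2 powi k"
proof -
  obtain m n where x: "x = of_int m / 2 ^ n" using assms(1) unfolding dyadics_def by blast
  then have "m > 0" using assms(2) by (simp add: zero_less_divide_iff)
  then have "real (nat m) = of_int m" "0 < nat m" by simp_all
  moreover from this(1) have "x = real (nat m) * 2 powi (- int n)"
    unfolding x by (simp add: power_int_minus field_simps)
  ultimately show ?thesis by (intro that)
qed

lemma dyadic_pl_exists:
  assumes "a \<in> dyadics" "b \<in> dyadics" "c \<in> dyadics" "d \<in> dyadics" "a < b" "c < d"
  shows "\<exists>G. dyadic_pl G a b \<and> G a = c \<and> G b = d"
proof -
  obtain M i where M: "0 < M" "b - a = real M * 2 powi i"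
    using dyadic_positive_units[of "b - a"] dyadics_diff assms by auto
  obtain N j where N: "0 < N" "d - c = real N * 2 powi j"
    using dyadic_positive_units[of "d - c"] dyadics_diff assms by auto
  have "b = a + real M * 2 powi i" "d = c + real N * 2 powi j" using M N by simp_all
  then show ?thesis using dyadic_pl_exists_units[OF assms(1,3) M(1) N(1), of i j] by simp
qed

text \<open>
  Local elements of \<open>T\<close> are germs of global ones: what is left of \<open>[0, 1]\<close> on each
  side of \<open>[a, b]\<close> is filled in by \<open>dyadic_pl_exists\<close>.
\<close>
lemma dyadic_pl_extend_unit_interval:
  assumes G: "dyadic_pl G a b" and a: "0 \<le> a" "G 0 = 0" "0 \<le> G a" and b: "b \<le> 1" "G 1 = 1" "G b \<le> 1"
    and ends: "0 < a \<Longrightarrow> 0 < G a" "b < 1 \<Longrightarrow> G b < 1"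
  shows "\<exists>G'. dyadic_pl G' 0 1 \<and> G' 0 = 0 \<and> G' 1 = 1 \<and> (\<forall>t\<in>{a..b}. G' t = G t)"
proof -
  note dy = dyadic_pl_dyadic[OF G]
  have 01: "0 \<in> dyadics" "1 \<in> dyadics" using dyadics_int[of 0] dyadics_int[of 1] by simp_all
  have ab: "a < b" using G by (rule dyadic_pl_less)
  have "\<exists>H. dyadic_pl H 0 b \<and> H 0 = 0 \<and> (\<forall>t\<in>{a..b}. H t = G t)"
  proof (cases "a = 0")
    case True
    then show ?thesis using G a by auto
  next
    case False
    then have a0: "0 < a" using a by simp
    obtain K where K: "dyadic_pl K 0 a" "K 0 = 0" "K a = G a"
      using dyadic_pl_exists[of 0 a 0 "G a"] dy 01 a0 ends(1) by blast
    have "dyadic_pl (\<lambda>t. if t \<le> a then K t else G t) 0 b" by (rule dyadic_pl_glue[OF K(1) G K(3)])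
    then show ?thesis using K a0 by (intro exI[of _ "\<lambda>t. if t \<le> a then K t else G t"]) auto
  qed
  then obtain H where H: "dyadic_pl H 0 b" "H 0 = 0" "\<And>t. t \<in> {a..b} \<Longrightarrow> H t = G t" by blast
  have Hb: "H b = G b" using H(3) ab by simp
  show ?thesis
  proof (cases "b = 1")
    case True
    then show ?thesis using H Hb b by (intro exI[of _ H]) auto
  next
    case False
    then have b1: "b < 1" using b by simp
    obtain K where K: "dyadic_pl K b 1" "K b = G b" "K 1 = 1"
      using dyadic_pl_exists[of b 1 "G b" 1] dy 01 b1 ends(2) by blast
    have "dyadic_pl (\<lambda>t. if t \<le> b then H t else K t) 0 1"
      by (rule dyadic_pl_glue[OF H(1) K(1)]) (simp add: K Hb)
    then show ?thesis
      using H K b1 a ab by (intro exI[of _ "\<lambda>t. if t \<le> b then H t else K t"]) auto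
  qed
qed

section \<open>Circle maps\<close>

lemma abs_circle_eq_iff: "abs_circle x = abs_circle y \<longleftrightarrow> x - y \<in> \<int>"
  using circle.abs_eq_iff by simp

lemma abs_circle_add_int: "n \<in> \<int> \<Longrightarrow> abs_circle (x + n) = abs_circle x"
  by (simp add: abs_circle_eq_iff)

lemma circle_cases: obtains x where "z = abs_circle x" "0 \<le> x" "x < 1"
proof -
  obtain y where y: "z = abs_circle y" using Quotient_abs_rep[OF Quotient_circle] by metis
  have "z = abs_circle (frac y)"
    unfolding y abs_circle_eq_iff by (simp add: frac_def)
  then show ?thesis using that frac_ge_0 frac_lt_1 by blast
qed

text \<open>
  The projection from the line to the circle is open.
\<close>
lemma eventually_nhds_circle:
  assumes "\<forall>\<^sub>F t in nhds x. P (abs_circle t)"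
  shows "\<forall>\<^sub>F z in nhds (abs_circle x). P z"
proof -
  obtain S where S: "open S" "x \<in> S" "\<And>t. t \<in> S \<Longrightarrow> P (abs_circle t)"
    using assms unfolding eventually_nhds by blast
  have "abs_circle -` abs_circle ` S = (\<Union>n\<in>\<int>. (\<lambda>t. t + n) ` S)"
  proof (intro subset_antisym subsetI)
    fix t assume "t \<in> abs_circle -` abs_circle ` S"
    then obtain s where "s \<in> S" "t - s \<in> \<int>" by (auto simp: abs_circle_eq_iff)
    then have "t = (\<lambda>u. u + (t - s)) s" by simp
    then show "t \<in> (\<Union>n\<in>\<int>. (\<lambda>t. t + n) ` S)" using \<open>s \<in> S\<close> \<open>t - s \<in> \<int>\<close> by blast
  qed (auto simp: abs_circle_add_int)
  moreover have "open (\<Union>n\<in>\<int>. (\<lambda>t. t + n) ` S)"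
    using open_translation[OF S(1)] by (intro open_UN) (simp add: add.commute)
  ultimately have "open (abs_circle ` S)" by (simp add: open_circle_def)
  then show ?thesis unfolding eventually_nhds using S(2,3) by blast
qed

text \<open>
  The lift to the line of the circle map that is \<open>F\<close> on a fundamental domain.
\<close>
definition periodic_extension :: "(real \<Rightarrow> real) \<Rightarrow> real \<Rightarrow> real" where
  "periodic_extension F x = of_int \<lfloor>x\<rfloor> + F (frac x)"

definition circle_map :: "(real \<Rightarrow> real) \<Rightarrow> circle \<Rightarrow> circle" where
  "circle_map F z = abs_circle (periodic_extension F (rep_circle z))"

lemma periodic_extension_add_int:
  assumes "n \<in> \<int>" shows "periodic_extension F (x + n) = periodic_extension F x + n"
proof -
  obtain m :: int where "n = of_int m" using assms by (rule Ints_cases)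
  then show ?thesis by (simp add: periodic_extension_def frac_def)
qed

lemma circle_map_abs: "circle_map F (abs_circle x) = abs_circle (periodic_extension F x)"
proof -
  define y where "y = rep_circle (abs_circle x)"
  have "abs_circle y = abs_circle x" unfolding y_def by (rule Quotient_abs_rep[OF Quotient_circle])
  then have n: "y - x \<in> \<int>" by (simp add: abs_circle_eq_iff)
  have "periodic_extension F y = periodic_extension F x + (y - x)"
    using periodic_extension_add_int[OF n, of F x] by simp
  then show ?thesis unfolding circle_map_def y_def[symmetric] using abs_circle_add_int[OF n] by simp
qed

lemma periodic_extension_unit: "0 \<le> x \<Longrightarrow> x < 1 \<Longrightarrow> periodic_extension F x = F x"
  by (simp add: periodic_extension_def floor_eq_iff frac_eq)

lemma circle_map_unit:
  assumes "0 \<le> x" "x \<le> 1" "F 0 = 0" "F 1 = 1"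
  shows "circle_map F (abs_circle x) = abs_circle (F x)"
proof (cases "x = 1")
  case True
  then show ?thesis using assms by (simp add: circle_map_abs periodic_extension_def)
next
  case False
  then show ?thesis using assms by (simp add: circle_map_abs periodic_extension_unit)
qed

definition unit_increasing :: "(real \<Rightarrow> real) \<Rightarrow> bool" where
  "unit_increasing F \<longleftrightarrow> strict_mono_on {0..1} F \<and> F ` {0..1} = {0..1}"

lemma unit_increasing_less: "unit_increasing F \<Longrightarrow> 0 \<le> x \<Longrightarrow> x < y \<Longrightarrow> y \<le> 1 \<Longrightarrow> F x < F y"
  unfolding unit_increasing_def by (auto intro: strict_mono_onD)

lemma unit_increasing_range:
  assumes "unit_increasing F" "0 \<le> x" "x \<le> 1" shows "0 \<le> F x" "F x \<le> 1"
proof -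
  have "F x \<in> F ` {0..1}" using assms by simp
  then show "0 \<le> F x" "F x \<le> 1" using assms(1) by (simp_all add: unit_increasing_def)
qed

lemma unit_increasing_surj:
  assumes "unit_increasing F" "0 \<le> y" "y \<le> 1"
  obtains x where "0 \<le> x" "x \<le> 1" "F x = y"
proof -
  have "y \<in> F ` {0..1}" using assms by (simp add: unit_increasing_def)
  then show ?thesis using that by auto
qed

lemma unit_increasing_ends:
  assumes F: "unit_increasing F" shows "F 0 = 0" "F 1 = 1"
proof -
  obtain x where x: "0 \<le> x" "x \<le> 1" "F x = 0" using unit_increasing_surj[OF F, of 0] by auto
  show "F 0 = 0" using unit_increasing_less[OF F, of 0 x] unit_increasing_range[OF F, of 0] x
    by (cases "x = 0") auto
  obtain y where y: "0 \<le> y" "y \<le> 1" "F y = 1" using unit_increasing_surj[OF F, of 1] by auto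
  show "F 1 = 1" using unit_increasing_less[OF F, of y 1] unit_increasing_range[OF F, of 1] y
    by (cases "y = 1") auto
qed

lemma unit_increasing_frac:
  assumes F: "unit_increasing F" shows "0 \<le> F (frac x)" "F (frac x) < 1"
  using unit_increasing_range(1)[OF F, of "frac x"] unit_increasing_less[OF F, of "frac x" 1]
    unit_increasing_ends[OF F] frac_ge_0[of x] frac_lt_1[of x] by simp_all

lemma periodic_extension_mono:
  assumes F: "unit_increasing F"
  shows "x < y \<Longrightarrow> periodic_extension F x < periodic_extension F y"
proof -
  assume xy: "x < y"
  have "\<lfloor>x\<rfloor> \<le> \<lfloor>y\<rfloor>" using xy by (intro floor_mono) simp
  then consider "\<lfloor>x\<rfloor> = \<lfloor>y\<rfloor>" | "\<lfloor>x\<rfloor> + 1 \<le> \<lfloor>y\<rfloor>" by linarith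
  then show ?thesis
  proof cases
    case 1
    then have "frac x < frac y" using xy by (simp add: frac_def)
    then show ?thesis using 1 unit_increasing_less[OF F, of "frac x" "frac y"] frac_lt_1[of y]
      by (simp add: periodic_extension_def)
  next
    case 2
    then have "real_of_int \<lfloor>x\<rfloor> + 1 \<le> real_of_int \<lfloor>y\<rfloor>" by linarith
    then show ?thesis using unit_increasing_frac(2)[OF F, of x] unit_increasing_frac(1)[OF F, of y] by (simp add: periodic_extension_def)
  qed
qed

lemma periodic_extension_comp:
  assumes F: "unit_increasing F"
  shows "periodic_extension E (periodic_extension F x) = periodic_extension (\<lambda>t. E (F t)) x"
proof -
  have "periodic_extension E (F (frac x)) = E (F (frac x))"
    by (intro periodic_extension_unit unit_increasing_frac[OF F])
  then show ?thesis using periodic_extension_add_int[of "of_int \<lfloor>x\<rfloor>" E "F (frac x)"]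
    by (simp add: periodic_extension_def add.commute)
qed

lemma circle_map_comp:
  assumes "unit_increasing F"
  shows "circle_map E (circle_map F z) = circle_map (\<lambda>t. E (F t)) z"
proof -
  obtain x where "z = abs_circle x" by (rule circle_cases)
  then show ?thesis by (simp add: circle_map_abs periodic_extension_comp[OF assms])
qed

lemma circle_map_id:
  assumes "\<And>t. 0 \<le> t \<Longrightarrow> t \<le> 1 \<Longrightarrow> F t = t"
  shows "circle_map F z = z"
proof -
  obtain x where "z = abs_circle x" "0 \<le> x" "x < 1" by (rule circle_cases)
  then show ?thesis using assms by (simp add: circle_map_abs periodic_extension_unit)
qed

text \<open>
  An increasing surjection of the line is continuous.
\<close>
lemma continuous_circle_map:
  assumes F: "unit_increasing F"
  shows "continuous_on UNIV (circle_map F)"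
proof -
  let ?H = "periodic_extension F"
  have surj: "\<exists>x. ?H x = y" for y
  proof -
    obtain u where u: "0 \<le> u" "u \<le> 1" "F u = frac y"
      using unit_increasing_surj[OF F, of "frac y"] frac_ge_0[of y] frac_lt_1[of y] by auto
    have "u \<noteq> 1" using u unit_increasing_ends[OF F] frac_lt_1[of y] by auto
    then have "?H u = frac y" using u by (simp add: periodic_extension_unit)
    then have "?H (u + of_int \<lfloor>y\<rfloor>) = y" by (simp add: periodic_extension_add_int frac_def)
    then show ?thesis by blast
  qed
  then have "range ?H = UNIV" by (metis UNIV_eq_I rangeI)
  then have cont: "continuous_on UNIV ?H"
    by (intro continuous_onI_mono) (use periodic_extension_mono[OF F] in \<open>auto simp: le_less\<close>)
  have "open (circle_map F -` U)" if "open U" for U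
  proof -
    have "abs_circle -` (circle_map F -` U) = ?H -` (abs_circle -` U)"
      by (auto simp: circle_map_abs)
    moreover have "open (abs_circle -` U)" using that by (simp add: open_circle_def)
    then have "open (?H -` (abs_circle -` U))" using cont continuous_on_open_vimage[of UNIV ?H] by simp
    ultimately show ?thesis by (simp add: open_circle_def)
  qed
  then show ?thesis using continuous_on_open_vimage[of UNIV "circle_map F"] by simp
qed

lemma unit_increasing_inverse:
  assumes F: "unit_increasing F"
  shows "\<exists>E. unit_increasing E \<and> (\<forall>t\<in>{0..1}. E (F t) = t \<and> F (E t) = t)"
proof -
  let ?E = "inv_into {0..1} F"
  have mono: "strict_mono_on {0..1} F" and im: "F ` {0..1} = {0..1}"
    using F unfolding unit_increasing_def by blast+
  have inj: "inj_on F {0..1}" using mono by (rule strict_mono_on_imp_inj_on)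
  have l: "?E (F t) = t" if "t \<in> {0..1}" for t using inj that by (rule inv_into_f_f)
  have r: "F (?E t) = t" "?E t \<in> {0..1}" if "t \<in> {0..1}" for t
  proof -
    have "t \<in> F ` {0..1}" using that im by simp
    then show "F (?E t) = t" "?E t \<in> {0..1}" by (rule f_inv_into_f, rule inv_into_into)
  qed
  have "?E ` {0..1} = {0..1}"
  proof (intro subset_antisym subsetI)
    fix t assume t: "t \<in> {0..1::real}"
    then have "F t \<in> {0..1}" using im by blast
    then show "t \<in> ?E ` {0..1}" using l[OF t] by (metis imageI)
  qed (use r(2) in blast)
  moreover have "strict_mono_on {0..1} ?E"
  proof (rule strict_mono_onI)
    fix x y :: real assume xy: "x \<in> {0..1}" "y \<in> {0..1}" "x < y"
    show "?E x < ?E y"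
    proof (rule ccontr)
      assume "\<not> ?E x < ?E y"
      then have "F (?E y) \<le> F (?E x)"
        using strict_mono_on_leD[OF mono r(2)[OF xy(2)] r(2)[OF xy(1)]] by simp
      then show False using r(1) xy by simp
    qed
  qed
  ultimately have "unit_increasing ?E" by (simp add: unit_increasing_def)
  then show ?thesis using l r(1) by (intro exI[of _ ?E]) simp
qed

lemma circle_map_homeo:
  assumes F: "unit_increasing F"
  shows "circle_map F \<in> carrier homeo_group"
proof -
  obtain E where E: "unit_increasing E" "\<forall>t\<in>{0..1}. E (F t) = t \<and> F (E t) = t"
    using unit_increasing_inverse[OF F] by blast
  have "circle_map E (circle_map F z) = z" "circle_map F (circle_map E z) = z" for z
    using circle_map_comp[OF F, of E] circle_map_comp[OF E(1), of F] E(2) by (simp_all add: circle_map_id)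
  then have "homeomorphic_maps euclidean euclidean (circle_map F) (circle_map E)"
    using continuous_circle_map F E(1) by (simp add: homeomorphic_maps_def)
  then show ?thesis unfolding homeo_group_def homeomorphic_map_maps by auto
qed

lemma dyadic_pl_in_T:
  assumes G: "dyadic_pl G 0 1" "G 0 = 0" "G 1 = 1"
  shows "circle_map G \<in> thompson_T"
proof -
  have mono: "strict_mono_on {0..1} G"
    by (rule strict_mono_onI) (use dyadic_pl_mono[OF G(1)] in auto)
  have "unit_increasing G" unfolding unit_increasing_def
  proof (intro conjI mono subset_antisym subsetI)
    fix y assume "y \<in> G ` {0..1}"
    then obtain x where x: "x \<in> {0..1}" "y = G x" by blast
    then show "y \<in> {0..1}"
      using strict_mono_on_leD[OF mono, of 0 x] strict_mono_on_leD[OF mono, of x 1] G by auto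
  next
    fix y :: real assume "y \<in> {0..1}"
    then show "y \<in> G ` {0..1}"
      using IVT'[of G 0 y 1] dyadic_pl_continuous[OF G(1)] G by (auto simp: image_iff)
  qed
  then have "circle_map G \<in> carrier homeo_group" by (rule circle_map_homeo)
  moreover obtain xs where xs: "sorted_wrt (<) xs" "xs \<noteq> []" "hd xs = 0" "last xs = 1" "set xs \<subseteq> dyadics"
    and aff: "\<And>i. Suc i < length xs \<Longrightarrow> dyadic_affine G (xs ! i) (xs ! Suc i)"
    using dyadic_pl_subdivision[OF G(1)] by blast
  have "\<exists>n::int. \<exists>b\<in>dyadics. \<forall>t\<in>{xs ! i..xs ! Suc i}. circle_map G (abs_circle t) = abs_circle (2 powi n * t + b)"
    if i: "Suc i < length xs" for i
  proof -
    have "sorted xs" using xs(1) by (simp add: strict_sorted_imp_sorted)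
    then have "xs ! 0 \<le> xs ! i" "xs ! Suc i \<le> xs ! (length xs - 1)"
      using i by (auto intro!: sorted_nth_mono)
    then have "0 \<le> xs ! i" "xs ! Suc i \<le> 1" using xs by (simp_all add: hd_conv_nth last_conv_nth)
    then have "circle_map G (abs_circle t) = abs_circle (G t)" if "t \<in> {xs ! i..xs ! Suc i}" for t
      using that G by (intro circle_map_unit) auto
    moreover obtain n b where "b \<in> dyadics" "\<forall>t\<in>{xs ! i..xs ! Suc i}. G t = 2 powi n * t + b"
      using aff[OF i] unfolding dyadic_affine_def by blast
    ultimately show ?thesis by metis
  qed
  ultimately show ?thesis unfolding thompson_T_def using xs by blast
qed

section \<open>From the Cantor set to the circle\<close>

text \<open>
  The value does not depend on the choice of the binary expansion if \<open>f\<close> is an increasing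
  bijection, see \<open>descend_val\<close>.
\<close>
definition descend :: "(cantor \<Rightarrow> cantor) \<Rightarrow> real \<Rightarrow> real" where
  "descend f t = val (f (SOME w. val w = t))"

lemma dyadic_affine_left:
  assumes "dyadic_affine G a b" "a < x" "x \<le> b" "x \<in> dyadics"
  shows "dyadic_affine G a x"
proof -
  obtain n c where nc: "c \<in> dyadics" "\<forall>t\<in>{a..b}. G t = 2 powi n * t + c"
    using assms(1) unfolding dyadic_affine_def by blast
  then have "\<forall>t\<in>{a..x}. G t = 2 powi n * t + c" using assms(3) by simp
  then show ?thesis
    using assms nc(1) unfolding dyadic_affine_def by blast
qed

text \<open>
  A number has at most two binary expansions.
\<close>
lemma val_less_if_word_between: "x \<prec>\<^sub>L z \<Longrightarrow> z \<prec>\<^sub>L y \<Longrightarrow> val x < val y"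
proof (rule ccontr)
  assume xz: "x \<prec>\<^sub>L z" and zy: "z \<prec>\<^sub>L y" and "\<not> val x < val y"
  then have eq: "val x = val z" "val z = val y" using val_mono[OF xz] val_mono[OF zy] by linarith+
  obtain n m where nm: "\<And>i. n \<le> i \<Longrightarrow> \<not> z i" "\<And>i. m \<le> i \<Longrightarrow> z i"
    using val_eq_cases(2)[OF eq(1) xz] val_eq_cases(1)[OF eq(2) zy] by blast
  show False using nm(1)[of "max n m"] nm(2)[of "max n m"] by simp
qed

lemma word_between:
  assumes "val x < val y"
  obtains z where "x \<prec>\<^sub>L z" "z \<prec>\<^sub>L y"
proof -
  obtain t where t: "val x < t" "t < val y" using dense[OF assms] by blast
  have "0 \<le> t" "t \<le> 1" using t val_nonneg[of x] val_le_1[of y] by linarith+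
  then obtain z where "val z = t" by (rule val_surj)
  then show ?thesis using that less_if_val_less t by blast
qed

context
  fixes f :: "cantor \<Rightarrow> cantor"
  assumes f_less: "\<And>x y. x \<prec>\<^sub>L y \<Longrightarrow> f x \<prec>\<^sub>L f y" and f_surj: "surj f"
begin

lemma increasing_less_iff: "f x \<prec>\<^sub>L f y \<longleftrightarrow> x \<prec>\<^sub>L y"
  using f_less word_less_cases[of x y] less_fun_asym less_fun_irrefl by metis

text \<open>
  Words have equal values if and only if no word lies between them, and increasing bijections preserve this.
\<close>
lemma val_image_cong:
  assumes "val x = val y" shows "val (f x) = val (f y)"
proof -
  have *: "\<not> val (f x) < val (f y)" if "val x = val y" for x y
  proof
    assume "val (f x) < val (f y)"
    then obtain z where z: "f x \<prec>\<^sub>L z" "z \<prec>\<^sub>L f y" by (rule word_between)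
    obtain z' where "z = f z'" using f_surj by (metis surjD)
    then have "x \<prec>\<^sub>L z'" "z' \<prec>\<^sub>L y" using z by (simp_all add: increasing_less_iff)
    then have "val x < val y" by (rule val_less_if_word_between)
    then show False using that by simp
  qed
  show ?thesis using *[OF assms] *[OF assms[symmetric]] by simp
qed

lemma descend_val: "descend f (val w) = val (f w)"
  unfolding descend_def by (rule val_image_cong) (rule someI[of "\<lambda>u. val u = val w" w], simp)

lemma unit_increasing_descend: "unit_increasing (descend f)"
  unfolding unit_increasing_def
proof (intro conjI strict_mono_onI subset_antisym subsetI)
  fix s t :: real assume "s \<in> {0..1}" "t \<in> {0..1}" "s < t"
  then obtain x y where xy: "val x = s" "val y = t" using val_surj by (metis atLeastAtMost_iff)
  then obtain z where "x \<prec>\<^sub>L z" "z \<prec>\<^sub>L y" using word_between[of x y] \<open>s < t\<close> by blast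
  then have "val (f x) < val (f y)" by (intro val_less_if_word_between[of _ "f z"] f_less)
  then show "descend f s < descend f t" unfolding xy[symmetric] descend_val .
next
  fix t assume "t \<in> descend f ` {0..1}"
  then show "t \<in> {0..1}" by (auto simp: descend_def)
next
  fix t :: real assume "t \<in> {0..1}"
  then obtain w where w: "val w = t" using val_surj by (metis atLeastAtMost_iff)
  obtain w' where "w = f w'" using f_surj by (metis surjD)
  then have "t = descend f (val w')" using w by (simp add: descend_val)
  then show "t \<in> descend f ` {0..1}" by simp
qed

text \<open>
  In terms of binary expansions, a prefix replacement scales the cylinder of \<open>\<alpha>\<close> onto the
  cylinder of \<open>\<beta>\<close>.
\<close>
lemma descend_affine:
  assumes "\<And>y. f (\<alpha> \<frown> y) = \<beta> \<frown> y"
  defines "a \<equiv> val (\<alpha> \<frown> (\<lambda>_. False))"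
  shows "\<exists>n::int. \<exists>c\<in>dyadics. \<forall>t\<in>{a..a + 1 / 2 ^ length \<alpha>}. descend f t = 2 powi n * t + c"
proof (intro exI bexI ballI)
  let ?n = "int (length \<alpha>) - int (length \<beta>)" and ?b = "val (\<beta> \<frown> (\<lambda>_. False))"
  fix t assume t: "t \<in> {a..a + 1 / 2 ^ length \<alpha>}"
  then have "0 \<le> (t - a) * 2 ^ length \<alpha>" "(t - a) * 2 ^ length \<alpha> \<le> 1" by (simp_all add: field_simps)
  then obtain y where y: "val y = (t - a) * 2 ^ length \<alpha>" by (rule val_surj)
  then have "t = val (\<alpha> \<frown> y)" unfolding val_conc[of \<alpha> y] a_def by simp
  then have "descend f t = ?b + val y / 2 ^ length \<beta>" using descend_val assms(1) val_conc by metis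
  then show "descend f t = 2 powi ?n * t + (?b - 2 powi ?n * a)"
    unfolding y by (simp add: power_int_diff algebra_simps diff_divide_distrib)
next
  show "val (\<beta> \<frown> (\<lambda>_. False)) - 2 powi (int (length \<alpha>) - int (length \<beta>)) * a \<in> dyadics"
    unfolding a_def by (intro dyadics_diff dyadics_powi val_dyadic)
qed

text \<open>
  The values of the words with prefix \<open>\<alpha>\<close> fill an interval with dyadic ends. The value is
  the left end only for a word that is eventually \<open>0\<close>, and the right end only for a word that is
  eventually \<open>1\<close>.
\<close>
lemma descend_affine_near:
  assumes loc: "locally_replacement f w"
  shows "\<exists>a b. dyadic_affine (descend f) a b \<and> a \<le> val w \<and> val w \<le> b \<and> 0 \<le> a \<and> b \<le> 1 \<and>
    ((\<forall>n. \<exists>i\<ge>n. w i) \<longrightarrow> a < val w) \<and> ((\<forall>n. \<exists>i\<ge>n. \<not> w i) \<longrightarrow> val w < b)"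
proof -
  obtain \<alpha> \<beta> y where w: "w = \<alpha> \<frown> y" and f: "\<And>y. f (\<alpha> \<frown> y) = \<beta> \<frown> y"
    using loc unfolding locally_replacement_def by blast
  let ?a = "val (\<alpha> \<frown> (\<lambda>_. False))" and ?b = "val (\<alpha> \<frown> (\<lambda>_. True))"
  have b: "?b = ?a + 1 / 2 ^ length \<alpha>" using val_conc[of \<alpha> "\<lambda>_. True"] by simp
  have v: "val w = ?a + val y / 2 ^ length \<alpha>" unfolding w by (rule val_conc)
  have "dyadic_affine (descend f) ?a ?b"
    unfolding dyadic_affine_def using val_dyadic[of \<alpha> False] val_dyadic[of \<alpha> True] descend_affine[of \<alpha> \<beta>, OF f] b by simp
  moreover have "val w \<le> ?b" using v b by (simp add: divide_right_mono)
  moreover have "?a < val w" if inf: "\<forall>n. \<exists>i\<ge>n. w i"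
  proof -
    obtain i where "i \<ge> length \<alpha>" "w i" using inf by blast
    then have "y \<noteq> (\<lambda>_. False)" unfolding w by (auto simp: conc_def)
    then have "val y \<noteq> 0" by (simp add: val_eq_0_iff)
    then have "0 < val y" using val_nonneg[of y] by linarith
    then show ?thesis using v by simp
  qed
  moreover have "val w < ?b" if inf: "\<forall>n. \<exists>i\<ge>n. \<not> w i"
  proof -
    obtain i where "i \<ge> length \<alpha>" "\<not> w i" using inf by blast
    then have "y \<noteq> (\<lambda>_. True)" unfolding w by (auto simp: conc_def)
    then have "val y \<noteq> 1" by (simp add: val_eq_1_iff)
    then have "val y < 1" using val_le_1[of y] by linarith
    then show ?thesis using v b by (simp add: divide_strict_right_mono)
  qed
  ultimately show ?thesis using v by (intro exI[of _ ?a] exI[of _ ?b]) simp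
qed

text \<open>
  The germs on the two sides of \<open>x\<close> are found at an expansion of \<open>x\<close> that is not
  eventually \<open>0\<close> and one that is not eventually \<open>1\<close>. Together they are a dyadic
  piecewise linear map, which extends to an element of \<open>T\<close>.
\<close>
lemma descend_nonsingular:
  assumes x: "0 < x" "x < 1" and loc: "\<And>w. val w = x \<Longrightarrow> locally_replacement f w"
  shows "abs_circle x \<notin> sing thompson_T (circle_map (descend f))"
proof -
  let ?F = "descend f"
  obtain u where u: "val u = x" "\<forall>n. \<exists>i\<ge>n. u i" using val_surj_not_zeros[of x] x by (metis less_imp_le)
  obtain v where v: "val v = x" "\<forall>n. \<exists>i\<ge>n. \<not> v i" using val_surj_not_ones[of x] x by (metis less_imp_le)
  obtain a b where l: "dyadic_affine ?F a b" "a < x" "x \<le> b" "0 \<le> a" "b \<le> 1"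
    using descend_affine_near[OF loc[OF u(1)]] u by blast
  obtain a' b' where r: "dyadic_affine ?F a' b'" "a' \<le> x" "x < b'" "0 \<le> a'" "b' \<le> 1"
    using descend_affine_near[OF loc[OF v(1)]] v by blast
  have "\<exists>a b. dyadic_pl ?F a b \<and> a < x \<and> x < b \<and> 0 \<le> a \<and> b \<le> 1"
  proof (cases "a' < x")
    case True
    then show ?thesis using r dyadic_pl.single by blast
  next
    case False
    \<comment> \<open>the right germ begins at \<open>x\<close>, which is then dyadic and may be used as a breakpoint\<close>
    then have a': "a' = x" using r by simp
    have "dyadic_affine ?F a x"
      using l(1) by (rule dyadic_affine_left) (use l r(1) a' in \<open>auto simp: dyadic_affine_def\<close>)
    then have "dyadic_pl ?F a b'"
      by (rule dyadic_pl.step[OF _ dyadic_pl.single[OF r(1)[unfolded a']]])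
    then show ?thesis using l r by blast
  qed
  then obtain a b where ab: "dyadic_pl ?F a b" "a < x" "x < b" "0 \<le> a" "b \<le> 1" by blast
  note ui = unit_increasing_descend
  have "\<exists>G. dyadic_pl G 0 1 \<and> G 0 = 0 \<and> G 1 = 1 \<and> (\<forall>t\<in>{a..b}. G t = ?F t)"
  proof (rule dyadic_pl_extend_unit_interval[OF ab(1)])
    show "0 \<le> a" "b \<le> 1" using ab by simp_all
    show "?F 0 = 0" "?F 1 = 1" using unit_increasing_ends[OF ui] by simp_all
    show "0 \<le> ?F a" "?F b \<le> 1" using unit_increasing_range[OF ui] ab x by simp_all
    show "0 < ?F a" if "0 < a" using unit_increasing_less[OF ui, of 0 a] unit_increasing_ends[OF ui] that ab x by simp
    show "?F b < 1" if "b < 1" using unit_increasing_less[OF ui, of b 1] unit_increasing_ends[OF ui] that ab x by simp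
  qed
  then obtain G where G: "dyadic_pl G 0 1" "G 0 = 0" "G 1 = 1" "\<forall>t\<in>{a..b}. G t = ?F t" by blast
  have "\<forall>\<^sub>F t in nhds x. t \<in> {a<..<b}" using ab by (intro eventually_nhds_in_open) auto
  then have "\<forall>\<^sub>F t in nhds x. circle_map ?F (abs_circle t) = circle_map G (abs_circle t)"
  proof eventually_elim
    case (elim t)
    then show ?case using ab G unit_increasing_ends[OF ui] by (simp add: circle_map_unit)
  qed
  then have "\<forall>\<^sub>F z in nhds (abs_circle x). circle_map ?F z = circle_map G z"
    by (rule eventually_nhds_circle)
  then show ?thesis using dyadic_pl_in_T[OF G(1-3)] unfolding sing_def by blast
qed

text \<open>
  The one-sided form of commutation with \<open>t \<mapsto> 2t - x\<close>: words beginning with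
  \<open>\<gamma>0\<dots>0\<close> lie to the right of \<open>x\<close>, and words beginning with
  \<open>\<gamma>1\<dots>1\<close> to the left.
\<close>
lemma descend_self_similar:
  assumes ss: "self_similar f \<gamma> c"
  defines "x \<equiv> val (\<gamma> \<frown> (\<lambda>_. c))"
  shows "\<exists>e>0. \<forall>t. \<bar>t - x\<bar> < e \<and> (if c then t \<le> x else x \<le> t) \<longrightarrow>
    0 \<le> t \<and> t \<le> 1 \<and> 0 \<le> 2 * t - x \<and> 2 * t - x \<le> 1 \<and> descend f (2 * t - x) = 2 * descend f t - x"
proof -
  obtain k where k: "\<And>y. \<exists>z. f (\<gamma> \<frown> replicate (Suc k) c \<frown> y) = \<gamma> \<frown> [c] \<frown> z \<and> f (\<gamma> \<frown> replicate k c \<frown> y) = \<gamma> \<frown> z"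
    using ss unfolding self_similar_def by blast
  let ?o = "of_bool c :: real"
  have pos: "val (\<gamma> \<frown> y) = x + (val y - ?o) / 2 ^ length \<gamma>" for y
  proof -
    have "val (\<lambda>_. c) = ?o" by (cases c) simp_all
    then show ?thesis unfolding x_def using val_conc[of \<gamma> y] val_conc[of \<gamma> "\<lambda>_. c"]
      by (simp add: diff_divide_distrib)
  qed
  have one: "val ([c] \<frown> y) - ?o = (val y - ?o) / 2" for y unfolding val_Cons by (cases c) simp_all
  have rep: "val (replicate n c \<frown> y) - ?o = (val y - ?o) / 2 ^ n" for n y
  proof (induction n)
    case (Suc n)
    have "val (replicate (Suc n) c \<frown> y) - ?o = (val (replicate n c \<frown> y) - ?o) / 2"
      using one[of "replicate n c \<frown> y"] by simp
    then show ?case using Suc by simp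
  qed simp
  let ?N = "length \<gamma> + Suc k"
  have "0 \<le> t \<and> t \<le> 1 \<and> 0 \<le> 2 * t - x \<and> 2 * t - x \<le> 1 \<and> descend f (2 * t - x) = 2 * descend f t - x"
    if t: "\<bar>t - x\<bar> < 1 / 2 ^ ?N" "if c then t \<le> x else x \<le> t" for t
  proof -
    let ?s = "(t - x) * 2 ^ ?N + ?o"
    have "\<bar>(t - x) * 2 ^ ?N\<bar> < 1" using t(1) by (simp add: abs_mult pos_less_divide_eq)
    moreover have "if c then (t - x) * 2 ^ ?N \<le> 0 else 0 \<le> (t - x) * 2 ^ ?N"
      using t(2) by (auto simp: mult_le_0_iff)
    ultimately have "0 \<le> ?s" "?s \<le> 1" by (auto split: if_splits)
    then obtain y where y: "val y = ?s" by (rule val_surj)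
    have t1: "t = val (\<gamma> \<frown> replicate (Suc k) c \<frown> y)"
      unfolding pos rep y by (simp add: power_add)
    have t2: "2 * t - x = val (\<gamma> \<frown> replicate k c \<frown> y)"
      unfolding pos rep y by (simp add: power_add)
    obtain z where z: "f (\<gamma> \<frown> replicate (Suc k) c \<frown> y) = \<gamma> \<frown> [c] \<frown> z" "f (\<gamma> \<frown> replicate k c \<frown> y) = \<gamma> \<frown> z"
      using k by blast
    have d1: "descend f t = val (\<gamma> \<frown> [c] \<frown> z)" by (subst t1) (simp only: descend_val z)
    have d2: "descend f (2 * t - x) = val (\<gamma> \<frown> z)" by (subst t2) (simp only: descend_val z)
    have "descend f (2 * t - x) = 2 * descend f t - x"
      unfolding d1 d2 pos one by (cases c) (simp_all add: field_simps)
    moreover have "0 \<le> t" "t \<le> 1" "0 \<le> 2 * t - x" "2 * t - x \<le> 1"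
      using t1 t2 val_nonneg val_le_1 by metis+
    ultimately show ?thesis by blast
  qed
  then show ?thesis by (intro exI[of _ "1 / 2 ^ ?N"]) (simp del: power_Suc)
qed

text \<open>
  The two sides of the point \<open>abs_circle x\<close> are governed by the two words that represent it. They
  have the same value, except at the point \<open>0\<close>, where the values are \<open>x = 0\<close> and
  \<open>x' = 1\<close>.
\<close>
lemma descend_commutes_circle_L:
  assumes g0: "self_similar f \<gamma>0 False" "val (\<gamma>0 \<frown> (\<lambda>_. False)) = x"
    and g1: "self_similar f \<gamma>1 True" "val (\<gamma>1 \<frown> (\<lambda>_. True)) = x'" and int: "x' - x \<in> \<int>"
  shows "\<forall>\<^sub>F z in nhds (abs_circle x).
    circle_L (circle_map (descend f) (abs_circle x)) (circle_map (descend f) z) =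
    circle_map (descend f) (circle_L (abs_circle x) z)"
proof (rule eventually_nhds_circle)
  let ?F = "descend f" and ?p = "abs_circle x"
  note ui = unit_increasing_descend
  obtain e0 where e0: "0 < e0" "\<And>t. \<bar>t - x\<bar> < e0 \<Longrightarrow> x \<le> t \<Longrightarrow>
    0 \<le> t \<and> t \<le> 1 \<and> 0 \<le> 2 * t - x \<and> 2 * t - x \<le> 1 \<and> ?F (2 * t - x) = 2 * ?F t - x"
    using descend_self_similar[OF g0(1)] unfolding g0(2) by auto
  obtain e1 where e1: "0 < e1" "\<And>t. \<bar>t - x'\<bar> < e1 \<Longrightarrow> t \<le> x' \<Longrightarrow>
    0 \<le> t \<and> t \<le> 1 \<and> 0 \<le> 2 * t - x' \<and> 2 * t - x' \<le> 1 \<and> ?F (2 * t - x') = 2 * ?F t - x'"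
    using descend_self_similar[OF g1(1)] unfolding g1(2) by auto
  have p: "abs_circle x' = ?p" using int by (simp add: abs_circle_eq_iff)
  have fix_p: "circle_map ?F ?p = ?p"
  proof -
    have "?F x = x" using descend_val self_similar_fixed[OF g0(1)] g0(2) by metis
    moreover have "0 \<le> x" "x \<le> 1" using g0(2) val_nonneg val_le_1 by metis+
    ultimately show ?thesis using circle_map_unit[of x ?F] unit_increasing_ends[OF ui] by simp
  qed
  have L: "circle_L (abs_circle y) (abs_circle t) = abs_circle (2 * t - y)" for y t
    by (simp add: circle_L.abs_eq algebra_simps)
  have commute: "circle_L ?p (circle_map ?F (abs_circle t)) = circle_map ?F (circle_L ?p (abs_circle t))"
    if "abs_circle y = ?p" "0 \<le> t \<and> t \<le> 1 \<and> 0 \<le> 2 * t - y \<and> 2 * t - y \<le> 1 \<and> ?F (2 * t - y) = 2 * ?F t - y"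
    for t y
  proof -
    have "circle_map ?F (abs_circle t) = abs_circle (?F t)"
      "circle_map ?F (abs_circle (2 * t - y)) = abs_circle (?F (2 * t - y))"
      using that(2) unit_increasing_ends[OF ui] by (intro circle_map_unit; simp)+
    then show ?thesis using that(2) unfolding that(1)[symmetric] L by (simp add: L)
  qed
  have "\<forall>\<^sub>F t in nhds x. \<bar>t - x\<bar> < min e0 e1"
    using e0(1) e1(1) eventually_nhds_metric[of "\<lambda>t. \<bar>t - x\<bar> < min e0 e1" x]
    by (auto simp: dist_real_def intro!: exI[of _ "min e0 e1"])
  then show "\<forall>\<^sub>F t in nhds x. circle_L (circle_map ?F ?p) (circle_map ?F (abs_circle t)) =
      circle_map ?F (circle_L ?p (abs_circle t))"
  proof eventually_elim
    case (elim t)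
    show ?case
    proof (cases "x \<le> t")
      case True
      then show ?thesis using commute[OF refl e0(2)] elim by (simp add: fix_p)
    next
      case False
      have "abs_circle (t + (x' - x)) = abs_circle t" by (rule abs_circle_add_int[OF int])
      then show ?thesis using commute[OF p e1(2)[of "t + (x' - x)"]] elim False by (simp add: fix_p)
    qed
  qed
qed

text \<open>
  Words at which \<open>f\<close> is a prefix replacement give nonsingular points. At the exceptional words,
  the assumption \<open>germs\<close> provides self-similarity at both expansions of the number, and
  \<open>zero\<close> does so for the point of the circle that comes from the ends of the interval.
\<close>
lemma descend_in_TA:
  assumes E: "finite E" "\<And>w. w \<notin> E \<Longrightarrow> locally_replacement f w"
    and germs: "\<And>w. w \<in> E \<Longrightarrow> \<exists>\<gamma>0 \<gamma>1. self_similar f \<gamma>0 False \<and> val (\<gamma>0 \<frown> (\<lambda>_. False)) = val w \<and>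
      self_similar f \<gamma>1 True \<and> val (\<gamma>1 \<frown> (\<lambda>_. True)) = val w"
    and zero: "self_similar f \<delta>0 False" "val (\<delta>0 \<frown> (\<lambda>_. False)) = 0"
      "self_similar f \<delta>1 True" "val (\<delta>1 \<frown> (\<lambda>_. True)) = 1"
  shows "circle_map (descend f) \<in> carrier TA"
proof -
  let ?f = "circle_map (descend f)" and ?S = "insert 0 (val ` E)"
  have sing: "sing thompson_T ?f \<subseteq> abs_circle ` ?S"
  proof
    fix z assume z: "z \<in> sing thompson_T ?f"
    obtain x where x: "z = abs_circle x" "0 \<le> x" "x < 1" by (rule circle_cases)
    have "x \<in> ?S"
    proof (rule ccontr)
      assume n: "x \<notin> ?S"
      then have "0 < x" using x by auto
      moreover have "locally_replacement f w" if "val w = x" for w using n that E(2) by blast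
      ultimately show False using descend_nonsingular x z by blast
    qed
    then show "z \<in> abs_circle ` ?S" using x by blast
  qed
  have "x \<in> dyadics" if xS: "x \<in> ?S" for x
  proof (cases "x = 0")
    case True
    then show ?thesis using dyadics_int[of 0] by simp
  next
    case False
    then obtain w where "w \<in> E" "x = val w" using xS by blast
    then show ?thesis using germs val_dyadic by metis
  qed
  then have "abs_circle ` ?S \<subseteq> abs_circle ` dyadics" by blast
  then have dy: "sing thompson_T ?f \<subseteq> abs_circle ` dyadics" using sing by (rule subset_trans[rotated])
  have "\<forall>\<^sub>F x in nhds z. circle_L (?f z) (?f x) = ?f (circle_L z x)" if zS: "z \<in> abs_circle ` ?S" for z
  proof -
    consider "z = abs_circle 0" | w where "w \<in> E" "z = abs_circle (val w)" using zS by blast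
    then show ?thesis
    proof cases
      case 1
      then show ?thesis using descend_commutes_circle_L[OF zero] by simp
    next
      case 2
      obtain \<gamma>0 \<gamma>1 where "self_similar f \<gamma>0 False" "val (\<gamma>0 \<frown> (\<lambda>_. False)) = val w"
        "self_similar f \<gamma>1 True" "val (\<gamma>1 \<frown> (\<lambda>_. True)) = val w"
        using germs[OF 2(1)] by blast
      from descend_commutes_circle_L[OF this] show ?thesis unfolding 2(2) by simp
    qed
  qed
  then have comm: "\<forall>z\<in>sing thompson_T ?f. \<forall>\<^sub>F x in nhds z. circle_L (?f z) (?f x) = ?f (circle_L z x)"
    using sing by blast
  have "finite (sing thompson_T ?f)" using sing E(1) by (meson finite_imageI finite_insert finite_subset)
  then show ?thesis
    unfolding TA_def using dy comm circle_map_homeo[OF unit_increasing_descend] by simp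
qed

end

section \<open>Direct sums of rationals on the circle\<close>

lemma val_block_twins: "val (block (Suc j) \<frown> (\<lambda>_. True)) = val (block j \<frown> (\<lambda>_. False))"
proof -
  have "block (Suc j) \<frown> (\<lambda>_. True) = replicate j False \<frown> [False] \<frown> [True] \<frown> (\<lambda>_. True)"
    by (simp only: block_def conc_conc replicate_Suc append_assoc) (simp add: replicate_app_Cons_same)
  moreover have "block j \<frown> (\<lambda>_. False) = replicate j False \<frown> [True] \<frown> (\<lambda>_. False)"
    by (simp only: block_def conc_conc)
  ultimately show ?thesis
    using val_conc[of "replicate j False" "[False] \<frown> [True] \<frown> (\<lambda>_. True)"]
      val_conc[of "replicate j False" "[True] \<frown> (\<lambda>_. False)"]
    by (simp add: val_Cons del: build_cons conc_conc)
qed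

lemma act_surj: "surj (act s r)"
proof (rule surjI)
  fix w
  show "act s r (act (\<lambda>i. - s i) (\<lambda>i. - r i) w) = w"
    unfolding act_add[symmetric] by (rule act_id) simp_all
qed

abbreviation line_act :: "(nat \<Rightarrow> rat) \<Rightarrow> cantor \<Rightarrow> cantor" where
  "line_act s \<equiv> act s (\<lambda>_. 0)"

lemma line_act_less: "x \<prec>\<^sub>L y \<Longrightarrow> line_act s x \<prec>\<^sub>L line_act s y"
  by (rule act_less) simp_all

definition circle_act :: "(nat \<Rightarrow> rat) \<Rightarrow> circle \<Rightarrow> circle" where
  "circle_act s = circle_map (descend (line_act s))"

text \<open>
  At the end of a line, the other expansion lies at an end of the neighboring even block, where the action is
  trivial and hence self-similar.
\<close>
lemma circle_act_in_TA:
  assumes fin: "finite {i. s i \<noteq> 0}"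
  shows "circle_act s \<in> carrier TA"
proof -
  let ?f = "line_act s"
  have fin0: "finite {i::nat. (0::rat) \<notin> \<int>}" by simp
  obtain N where N: "\<And>y. ?f (replicate N False \<frown> y) = replicate N False \<frown> y"
    using act_near_zero[OF fin fin0] by blast
  have zero: "self_similar ?f (replicate N False) False" by (rule self_similar_id) (rule N)
  have val_zero: "val (replicate N False \<frown> (\<lambda>_. False)) = 0" by (simp add: conc_const)
  have val_one: "val (block 0 \<frown> (\<lambda>_. True)) = 1" using conc_const[of 1 True] by (simp add: block_def)
  have ss: "self_similar ?f (block j) c" for j c by (rule act_self_similar) simp
  show ?thesis unfolding circle_act_def
  proof (rule descend_in_TA[OF line_act_less act_surj finite_line_ends[OF fin] _ _ zero val_zero ss val_one])
    show "locally_replacement ?f w" if "w \<notin> line_ends s" for w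
      using act_regular[OF fin fin0 that] by blast
    fix w assume "w \<in> line_ends s"
    then obtain i c where w: "w = block (2 * i + 1) \<frown> (\<lambda>_. c)" unfolding line_ends_def by blast
    have "val (block (2 * i + 2) \<frown> (\<lambda>_. True)) = val (block (2 * i + 1) \<frown> (\<lambda>_. False))"
      "val (block (2 * i + 1) \<frown> (\<lambda>_. True)) = val (block (2 * i) \<frown> (\<lambda>_. False))"
      using val_block_twins[of "2 * i + 1"] val_block_twins[of "2 * i"] by simp_all
    then show "\<exists>\<gamma>0 \<gamma>1. self_similar ?f \<gamma>0 False \<and> val (\<gamma>0 \<frown> (\<lambda>_. False)) = val w \<and>
        self_similar ?f \<gamma>1 True \<and> val (\<gamma>1 \<frown> (\<lambda>_. True)) = val w"
      unfolding w using ss by (cases c) metis+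
  qed
qed

lemma descend_act_comp:
  "descend (line_act (\<lambda>i. s i + s' i)) t = descend (line_act s) (descend (line_act s') t)"
proof -
  have "line_act (\<lambda>i. s i + s' i) w = line_act s (line_act s' w)" for w
    using act_add[of s s' "\<lambda>_. 0" "\<lambda>_. 0" w] by simp
  then show ?thesis
    unfolding descend_def[of "line_act (\<lambda>i. s i + s' i)"] descend_def[of "line_act s'"]
    by (simp only: descend_val[OF line_act_less act_surj])
qed

lemma circle_act_add: "circle_act (\<lambda>i. s i + s' i) = circle_act s \<circ> circle_act s'"
  unfolding circle_act_def descend_act_comp
  using circle_map_comp[OF unit_increasing_descend[OF line_act_less act_surj]] by (auto simp: fun_eq_iff)

lemma circle_act_zero: "circle_act (\<lambda>_. 0) = id"
proof
  fix z
  have "descend (line_act (\<lambda>_. 0)) t = t" if t: "0 \<le> t" "t \<le> 1" for t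
  proof -
    obtain w where w: "val w = t" using t by (rule val_surj)
    have "descend (line_act (\<lambda>_. 0)) (val w) = val w"
      using descend_val[where f = "line_act (\<lambda>_. 0)", OF line_act_less act_surj, of w] by (simp add: act_id)
    then show ?thesis unfolding w .
  qed
  then show "circle_act (\<lambda>_. 0) z = id z" unfolding circle_act_def by (simp add: circle_map_id)
qed

text \<open>
  A number with an expansion that is not eventually constant has no other expansion, so the translation by
  \<open>q - q'\<close> fixes \<open>y\<close>.
\<close>
lemma line_determined:
  assumes "val (line q y) = val (line q' y)" and y: "\<And>n. \<exists>i\<ge>n. y i" "\<And>n. \<exists>i\<ge>n. \<not> y i"
  shows "q = q'"
proof -
  have surj: "surj (line (- q'))"
    by (rule surjI[of _ "line q'"]) (simp add: line_add[symmetric])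
  have "val (line (- q') (line q y)) = val (line (- q') (line q' y))"
    by (rule val_image_cong[OF _ surj assms(1)]) (rule line_less)
  then have v: "val (line (q - q') y) = val y" by (simp add: line_add[symmetric])
  have "line (q - q') y = y"
    using word_less_cases[of "line (q - q') y" y] val_eq_cases[of "line (q - q') y" y]
      val_eq_cases[of y "line (q - q') y"] v y by metis
  moreover have "y \<in> domain_of line_code" unfolding domain_line_code using y by auto
  ultimately have "line (q - q') x = x" for x
    unfolding line_def by (rule translate_fixed_point[OF shiftable_line_code, rotated])
  then show ?thesis using line_trivial[of "q - q'"] by simp
qed

text \<open>
  The map is tested at a word in the block of the \<open>i\<close>-th line whose tail is not eventually
  constant.
\<close>
lemma circle_act_inject:
  assumes "circle_act s = circle_act s'" shows "s = s'"
proof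
  fix i
  let ?F = "descend (line_act s)" and ?F' = "descend (line_act s')"
  note ui = unit_increasing_descend[OF line_act_less act_surj]
  \<comment> \<open>any word that is not eventually constant\<close>
  define y :: cantor where "y = (\<lambda>n. even n)"
  have y: "\<exists>i\<ge>n. y i" "\<exists>i\<ge>n. \<not> y i" for n
    by (rule exI[of _ "2 * n"], simp add: y_def) (rule exI[of _ "2 * n + 1"], simp add: y_def)
  define w where "w = block (2 * i + 1) \<frown> y"
  have "w \<noteq> (\<lambda>_. True)"
  proof
    assume "w = (\<lambda>_. True)"
    then have "w 0" by simp
    then show False unfolding w_def by (simp add: block_def conc_def nth_append)
  qed
  then have "val w < 1" using val_eq_1_iff[of w] val_le_1[of w] by linarith
  then have "abs_circle (?F (val w)) = abs_circle (?F' (val w))"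
    using fun_cong[OF assms, of "abs_circle (val w)"]
    by (simp add: circle_act_def circle_map_abs periodic_extension_unit)
  then have "?F (val w) - ?F' (val w) \<in> \<int>" by (simp add: abs_circle_eq_iff)
  then obtain k :: int where k: "?F (val w) - ?F' (val w) = of_int k" by (rule Ints_cases)
  have "0 \<le> ?F (val w)" "?F (val w) < 1" "0 \<le> ?F' (val w)" "?F' (val w) < 1"
    using unit_increasing_range[OF ui] unit_increasing_less[OF ui, of "val w" 1] unit_increasing_ends[OF ui]
      \<open>val w < 1\<close> by simp_all
  then have "real_of_int k < 1" "- 1 < real_of_int k" using k by linarith+
  then have "k = 0" by linarith
  then have "?F (val w) = ?F' (val w)" using k by simp
  then have "val (block (2 * i + 1) \<frown> line (s i) y) = val (block (2 * i + 1) \<frown> line (s' i) y)"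
    by (simp add: w_def descend_val[OF line_act_less act_surj] act_block block_maps_def)
  then have "val (line (s i) y) = val (line (s' i) y)"
    by (simp add: val_conc[of _ "line (s i) y"] val_conc[of _ "line (s' i) y"])
  then show "s i = s' i" using y by (rule line_determined)
qed

lemma act_cong_mod_int:
  assumes "\<And>i. r i - r' i \<in> \<int>" shows "act s r = act s r'"
proof
  fix w
  have "act s r w = act s r' (act (\<lambda>_. 0) (\<lambda>i. r i - r' i) w)"
    unfolding act_add[symmetric] by simp
  also have "\<dots> = act s r' w" using assms by (simp add: act_id)
  finally show "act s r w = act s r' w" .
qed

section \<open>Faithfulness\<close>

definition representative :: "rat set \<Rightarrow> rat" where
  "representative c = (SOME q. c = coset q)"

lemma coset_representative: "c \<in> carrier rat_mod_int_group \<Longrightarrow> coset (representative c) = c"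
  unfolding representative_def carrier_rat_mod_int by (rule sym, rule someI_ex) blast

text \<open>
  By \<open>act_cong_mod_int\<close> the action of a coset of \<open>\<int>\<close> does not depend on its
  representative.
\<close>
definition cantor_act :: "(nat \<Rightarrow> rat \<times> rat set) \<Rightarrow> cantor \<Rightarrow> cantor" where
  "cantor_act x = act (\<lambda>i. fst (x i)) (\<lambda>i. representative (snd (x i)))"

lemma group_rat: "group rat_group"
  using comm_group_rat by (rule comm_group.axioms(2))

lemma comm_group_Q_QZ: "comm_group (rat_group \<times>\<times> rat_mod_int_group)"
  by (rule comm_group_DirProd[OF comm_group_rat comm_group_rat_mod_int])

lemma group_Q_QZ: "group (rat_group \<times>\<times> rat_mod_int_group)"
  using comm_group_Q_QZ by (rule comm_group.axioms(2))

lemma circle_act_faithful: "faithful_rep TA (sum_group (UNIV :: nat set) (\<lambda>_. rat_group)) circle_act"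
  unfolding faithful_rep_def
proof (intro conjI ballI)
  show "circle_act s \<in> carrier TA" if "s \<in> carrier (sum_group (UNIV :: nat set) (\<lambda>_. rat_group))" for s
    using that by (intro circle_act_in_TA) (simp add: carrier_sum_group group_rat)
qed (simp_all add: restrict_UNIV circle_act_add circle_act_zero inj_onI circle_act_inject)

lemma cantor_act_faithful:
  "faithful_rep VA (sum_group (UNIV :: nat set) (\<lambda>_. rat_group \<times>\<times> rat_mod_int_group)) cantor_act"
  (is "faithful_rep VA ?H cantor_act")
  unfolding faithful_rep_def
proof (intro conjI ballI)
  have mem: "snd (x i) \<in> carrier rat_mod_int_group" if "x \<in> carrier ?H" for x i
  proof -
    have "x i \<in> carrier (rat_group \<times>\<times> rat_mod_int_group)"
      using that by (auto simp: carrier_sum_group group_Q_QZ simp del: carrier_DirProd)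
    then show ?thesis by auto
  qed
  have cos: "coset (representative (snd (x i))) = snd (x i)" if "x \<in> carrier ?H" for x i
    using mem[OF that] by (rule coset_representative)
  have mult: "(x \<otimes>\<^bsub>?H\<^esub> y) i = (fst (x i) + fst (y i), snd (x i) \<otimes>\<^bsub>rat_mod_int_group\<^esub> snd (y i))" for x y i
    by (simp add: DirProd_def case_prod_unfold)
  have one: "\<one>\<^bsub>?H\<^esub> = (\<lambda>_. (0, \<int>))"
    by (simp add: DirProd_def one_rat_mod_int restrict_UNIV)
  have one_mem: "\<one>\<^bsub>?H\<^esub> \<in> carrier ?H"
    by (intro monoid.one_closed group.is_monoid sum_group group_Q_QZ)
  have rep_int: "representative c \<in> \<int> \<longleftrightarrow> c = \<int>" if "coset (representative c) = c" for c
    using coset_eq_Ints_iff[of "representative c"] that by simp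
  show "cantor_act x \<in> carrier VA" if x: "x \<in> carrier ?H" for x
    unfolding cantor_act_def
  proof (rule act_in_VA)
    have "\<one>\<^bsub>rat_group \<times>\<times> rat_mod_int_group\<^esub> = (0, \<int>)" by (simp add: DirProd_def one_rat_mod_int)
    then have fin: "finite {i. x i \<noteq> (0, \<int>)}" using x by (simp add: carrier_sum_group group_Q_QZ)
    have "{i. fst (x i) \<noteq> 0} \<subseteq> {i. x i \<noteq> (0, \<int>)}" by auto
    then show "finite {i. fst (x i) \<noteq> 0}" using fin by (rule finite_subset)
    have "{i. representative (snd (x i)) \<notin> \<int>} \<subseteq> {i. x i \<noteq> (0, \<int>)}"
      using rep_int[OF cos[OF x]] by auto
    then show "finite {i. representative (snd (x i)) \<notin> \<int>}" using fin by (rule finite_subset)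
  qed
  show "cantor_act (x \<otimes>\<^bsub>?H\<^esub> y) = cantor_act x \<circ> cantor_act y"
    if x: "x \<in> carrier ?H" and y: "y \<in> carrier ?H" for x y
  proof -
    have xy: "x \<otimes>\<^bsub>?H\<^esub> y \<in> carrier ?H"
      using x y by (intro monoid.m_closed group.is_monoid sum_group group_Q_QZ)
    let ?r = "\<lambda>x i. representative (snd (x i))"
    have "coset (?r (x \<otimes>\<^bsub>?H\<^esub> y) i) = coset (?r x i + ?r y i)" for i
      using hom_mult[OF coset_hom, of "?r x i" "?r y i"] cos[OF xy, of i] cos[OF x, of i] cos[OF y, of i]
      by (simp only: mult rat_group_simps UNIV_I snd_conv)
    then have "?r (x \<otimes>\<^bsub>?H\<^esub> y) i - (?r x i + ?r y i) \<in> \<int>" for i using coset_eq_iff by blast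
    then have "cantor_act (x \<otimes>\<^bsub>?H\<^esub> y) = act (\<lambda>i. fst ((x \<otimes>\<^bsub>?H\<^esub> y) i)) (\<lambda>i. ?r x i + ?r y i)"
      unfolding cantor_act_def by (rule act_cong_mod_int)
    also have "\<dots> = act (\<lambda>i. fst (x i) + fst (y i)) (\<lambda>i. ?r x i + ?r y i)"
      by (simp only: mult fst_conv)
    also have "\<dots> = cantor_act x \<circ> cantor_act y"
      by (rule ext) (simp add: cantor_act_def act_add)
    finally show ?thesis .
  qed
  show "cantor_act \<one>\<^bsub>?H\<^esub> = id"
  proof
    fix w
    have "representative \<int> \<in> \<int>" using rep_int[of \<int>] cos[OF one_mem] unfolding one by simp
    then show "cantor_act \<one>\<^bsub>?H\<^esub> w = id w" unfolding one cantor_act_def by (simp add: act_id)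
  qed
  show "inj_on cantor_act (carrier ?H)"
  proof (rule inj_onI)
    fix x y assume xy: "x \<in> carrier ?H" "y \<in> carrier ?H" "cantor_act x = cantor_act y"
    show "x = y"
    proof
      fix i
      have "fst (x i) = fst (y i)" "representative (snd (x i)) - representative (snd (y i)) \<in> \<int>"
        using xy(3) act_eqD unfolding cantor_act_def by blast+
      moreover from this(2) have "snd (x i) = snd (y i)"
        using coset_eq_iff cos[OF xy(1)] cos[OF xy(2)] by metis
      ultimately show "x i = y i" by (simp add: prod_eq_iff)
    qed
  qed
qed

theorem theorem4p6:
  shows "contains_group TA (sum_group (UNIV :: nat set) (\<lambda>_. rat_group))
    \<and> contains_group VA (sum_group (UNIV :: nat set) (\<lambda>_. rat_group \<times>\<times> rat_mod_int_group))
    \<and> (\<forall>A :: ('a, 'm) monoid_scheme.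
          comm_group A \<and> countable (carrier A) \<and> torsion_free A \<longrightarrow> contains_group TA A)
    \<and> (\<forall>A :: ('b, 'n) monoid_scheme.
          comm_group A \<and> countable (carrier A) \<longrightarrow> contains_group VA A)"
proof (intro conjI allI impI)
  have TA: "mult TA = (\<circ>)" "one TA = id" and VA: "mult VA = (\<circ>)" "one VA = id"
    by (simp_all add: TA_def VA_def homeo_group_def)
  have sum: "group (sum_group (UNIV :: nat set) (\<lambda>_. rat_group))"
    "group (sum_group (UNIV :: nat set) (\<lambda>_. rat_group \<times>\<times> rat_mod_int_group))"
    by (simp_all add: group_rat group_Q_QZ)
  show "contains_group TA (sum_group (UNIV :: nat set) (\<lambda>_. rat_group))"
    by (rule contains_group_if_faithful_rep[OF sum(1) TA circle_act_faithful])
  show "contains_group VA (sum_group (UNIV :: nat set) (\<lambda>_. rat_group \<times>\<times> rat_mod_int_group))"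
    by (rule contains_group_if_faithful_rep[OF sum(2) VA cantor_act_faithful])
  show "contains_group TA A" if A: "comm_group A \<and> countable (carrier A) \<and> torsion_free A"
    for A :: "('a, 'm) monoid_scheme"
  proof -
    have "1 \<in> carrier rat_group" "\<And>j::int. 1 [^]\<^bsub>rat_group\<^esub> j = \<one>\<^bsub>rat_group\<^esub> \<longleftrightarrow> j = 0"
      by (simp_all add: rat_group_int_pow)
    then obtain \<Phi> where \<Phi>: "\<Phi> \<in> hom A (sum_group (UNIV :: nat set) (\<lambda>_. rat_group))" "inj_on \<Phi> (carrier A)"
      using countable_torsion_free_embeds[of A rat_group 1] A comm_group_rat divisible_rat by blast
    have "group A" using A by (simp add: comm_group.axioms)
    then show ?thesis
      using contains_group_if_faithful_rep[OF _ TA faithful_rep_comp[OF circle_act_faithful \<Phi> _ sum(1)]] by blast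
  qed
  show "contains_group VA A" if A: "comm_group A \<and> countable (carrier A)" for A :: "('b, 'n) monoid_scheme"
  proof -
    obtain \<Phi> where \<Phi>: "\<Phi> \<in> hom A (sum_group (UNIV :: nat set) (\<lambda>_. rat_group \<times>\<times> rat_mod_int_group))"
      "inj_on \<Phi> (carrier A)"
      using countable_abelian_embeds[of A "rat_group \<times>\<times> rat_mod_int_group"] A comm_group_Q_QZ
        divisible_DirProd[OF divisible_rat divisible_rat_mod_int] rat_cyclic_subgroups by blast
    have "group A" using A by (simp add: comm_group.axioms)
    then show ?thesis
      using contains_group_if_faithful_rep[OF _ VA faithful_rep_comp[OF cantor_act_faithful \<Phi> _ sum(2)]] by blast
  qed
qed

end
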